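(* Let $C\subset\mathbb{P}^2$ be a plane curve that is the image of a line or of a smooth cubic under a birational transformation of $\mathbb{P}^2=\mathbb{P}^2_{\mathbb{C}}$. Then the group of Cremona transformations that fix $C$ pointwise is not of finite order, is not abelian, and is not conjugate (in the Cremona group) to a subgroup of $\mathrm{Jon}(\mathbb{P}^2)$.
   Context: A Cremona transformation is a birational map $\mathbb{P}^2\dashrightarrow\mathbb{P}^2$; these form the Cremona group. The image of a curve that is not contracted by a birational map means its strict (proper) transform. A birational map $\varphi$ fixes $C$ pointwise if $C$ is contained in the closure of the set of points $x$ at which $\varphi$ is defined and $\varphi(x)=x$. $\mathrm{Jon}(\mathbb{P}^2)$ denotes $\mathrm{Jon}_p(\mathbb{P}^2)$ for a point $p\in\mathbb{P}^2$: the group of Cremona transformations that stabilize the pencil of lines through $p$; its conjugacy class in the Cremona group does not depend on $p$. *)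

theory Defs
  imports
    "HOL-Analysis.Analysis"
    "HOL-Computational_Algebra.Computational_Algebra"
    "HOL-Algebra.Group"
begin

section \<open>The complex projective plane\<close>

quotient_type proj_plane =
  "complex ^ 3" / partial: "\<lambda>u v. u \<noteq> 0 \<and> v \<noteq> 0 \<and> (\<exists>c. c \<noteq> 0 \<and> v = c *s u)"
proof (rule part_equivpI)
  show "\<exists>u::complex ^ 3. u \<noteq> 0 \<and> u \<noteq> 0 \<and> (\<exists>c. c \<noteq> 0 \<and> u = c *s u)"
    by (intro exI[of _ "axis 1 1"] conjI exI[of _ 1]) (auto simp: axis_eq_0_iff)
  show "symp (\<lambda>u v :: complex ^ 3. u \<noteq> 0 \<and> v \<noteq> 0 \<and> (\<exists>c. c \<noteq> 0 \<and> v = c *s u))"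
  proof (rule sympI, elim conjE exE, intro conjI)
    fix u v :: "complex ^ 3" and c :: complex
    assume "c \<noteq> 0" "v = c *s u"
    then show "\<exists>c. c \<noteq> 0 \<and> u = c *s v"
      by (intro exI[of _ "inverse c"]) (simp add: vector_smult_assoc)
  qed auto
  show "transp (\<lambda>u v :: complex ^ 3. u \<noteq> 0 \<and> v \<noteq> 0 \<and> (\<exists>c. c \<noteq> 0 \<and> v = c *s u))"
  proof (rule transpI, elim conjE exE, intro conjI)
    fix u v w :: "complex ^ 3" and c d :: complex
    assume "c \<noteq> 0" "v = c *s u" "d \<noteq> 0" "w = d *s v"
    then show "\<exists>c. c \<noteq> 0 \<and> w = c *s u"
      by (intro exI[of _ "d * c"]) (simp add: vector_smult_assoc)
  qed auto
qed

text \<open>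
  Polynomials in \<open>X\<^sub>1, X\<^sub>2, X\<^sub>3\<close> are nested univariate polynomials; \<open>X\<^sub>1\<close> is the outermost
  variable and \<open>X\<^sub>3\<close> the innermost one.
\<close>

type_synonym poly3 = "complex poly poly poly"

definition eval3 :: "poly3 \<Rightarrow> complex ^ 3 \<Rightarrow> complex" where
  "eval3 F v = poly (poly (poly F [:[:v $ 1:]:]) [:v $ 2:]) (v $ 3)"

text \<open>The zero polynomial is homogeneous of every degree.\<close>

definition homogeneous :: "nat \<Rightarrow> poly3 \<Rightarrow> bool" where
  "homogeneous d F \<longleftrightarrow> (\<forall>i j k. coeff (coeff (coeff F i) j) k \<noteq> 0 \<longrightarrow> i + j + k = d)"

text \<open>
  \<open>vanishes F p\<close> uses the representative of \<open>p\<close> chosen by \<open>rep_proj_plane\<close>; it is independent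
  of this choice for homogeneous \<open>F\<close>, the only case in which it is used below.
\<close>

definition vanishes :: "poly3 \<Rightarrow> proj_plane \<Rightarrow> bool" where
  "vanishes F p \<longleftrightarrow> eval3 F (rep_proj_plane p) = 0"

definition zariski_closed :: "proj_plane set \<Rightarrow> bool" where
  "zariski_closed Z \<longleftrightarrow>
     (\<exists>S. (\<forall>F\<in>S. \<exists>d. homogeneous d F) \<and> Z = {p. \<forall>F\<in>S. vanishes F p})"

definition zariski_closure :: "proj_plane set \<Rightarrow> proj_plane set" where
  "zariski_closure A = zariski_closed hull A"

definition line :: "proj_plane set \<Rightarrow> bool" where
  "line L \<longleftrightarrow> (\<exists>F. homogeneous 1 F \<and> F \<noteq> 0 \<and> L = {p. vanishes F p})"

text \<open>
  The three derivatives are those with respect to \<open>X\<^sub>1\<close>, \<open>X\<^sub>2\<close>, \<open>X\<^sub>3\<close>. The Jacobian criterion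
  forces \<open>F \<noteq> 0\<close>.
\<close>

definition smooth_cubic :: "proj_plane set \<Rightarrow> bool" where
  "smooth_cubic D \<longleftrightarrow>
     (\<exists>F. homogeneous 3 F \<and> D = {p. vanishes F p} \<and>
          (\<forall>p\<in>D. \<not> (vanishes (pderiv F) p \<and>
                     vanishes (map_poly pderiv F) p \<and>
                     vanishes (map_poly (map_poly pderiv) F) p)))"

section \<open>Rational maps and the Cremona group\<close>

text \<open>
  A rational map \<open>\<P>\<^sup>2 \<dashrightarrow> \<P>\<^sup>2\<close> is represented by the partial function on its maximal domain of
  definition: writing it as \<open>[F\<^sub>1 : F\<^sub>2 : F\<^sub>3]\<close> with homogeneous \<open>F\<^sub>i\<close> of the same degree and
  without common factor, it is undefined exactly at the common zeros of the \<open>F\<^sub>i\<close>. Hence equality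
  of rational maps (agreement on a nonempty open set) is equality of partial functions.
  The absence of a common factor excludes \<open>F = 0\<close>.
\<close>

definition eval_triple :: "poly3 ^ 3 \<Rightarrow> complex ^ 3 \<Rightarrow> complex ^ 3" where
  "eval_triple F v = (\<chi> i. eval3 (F $ i) v)"

definition rational_map :: "(proj_plane \<rightharpoonup> proj_plane) \<Rightarrow> bool" where
  "rational_map f \<longleftrightarrow>
     (\<exists>d F. (\<forall>i. homogeneous d (F $ i)) \<and>
            (\<forall>h. (\<forall>i. h dvd F $ i) \<longrightarrow> is_unit h) \<and>
            (\<forall>p. f p = (let w = eval_triple F (rep_proj_plane p)
                        in if w = 0 then None else Some (abs_proj_plane w))))"

text \<open>
  The pointwise composite of two rational maps is defined on an open set. If that set is nonempty,
  then the composite rational map is the unique rational map extending the pointwise composite.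
  The nonemptiness conditions in \<open>birational\<close> express that the composites with the inverse make
  sense; for birational maps they always do.
\<close>

definition rat_comp ::
  "(proj_plane \<rightharpoonup> proj_plane) \<Rightarrow> (proj_plane \<rightharpoonup> proj_plane) \<Rightarrow> (proj_plane \<rightharpoonup> proj_plane)" where
  "rat_comp f g = (THE h. rational_map h \<and> (f \<circ>\<^sub>m g) \<subseteq>\<^sub>m h)"

definition birational :: "(proj_plane \<rightharpoonup> proj_plane) \<Rightarrow> bool" where
  "birational f \<longleftrightarrow> rational_map f \<and>
     (\<exists>g. rational_map g \<and>
          dom (g \<circ>\<^sub>m f) \<noteq> {} \<and> (g \<circ>\<^sub>m f) \<subseteq>\<^sub>m Some \<and>
          dom (f \<circ>\<^sub>m g) \<noteq> {} \<and> (f \<circ>\<^sub>m g) \<subseteq>\<^sub>m Some)"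

definition Cremona :: "(proj_plane \<rightharpoonup> proj_plane) monoid" where
  "Cremona = \<lparr>carrier = {f. birational f}, mult = rat_comp, one = Some\<rparr>"

section \<open>Action on curves\<close>

text \<open>\<open>ran (f |` D)\<close> is the set of the points \<open>f x\<close> with \<open>x \<in> D\<close> in the domain of \<open>f\<close>.\<close>

definition contracts :: "(proj_plane \<rightharpoonup> proj_plane) \<Rightarrow> proj_plane set \<Rightarrow> bool" where
  "contracts f D \<longleftrightarrow> (\<exists>q. ran (f |` D) \<subseteq> {q})"

definition strict_transform ::
  "(proj_plane \<rightharpoonup> proj_plane) \<Rightarrow> proj_plane set \<Rightarrow> proj_plane set" where
  "strict_transform f D = zariski_closure (ran (f |` D))"

definition fixes_pointwise :: "(proj_plane \<rightharpoonup> proj_plane) \<Rightarrow> proj_plane set \<Rightarrow> bool" where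
  "fixes_pointwise f C \<longleftrightarrow> C \<subseteq> zariski_closure {x. f x = Some x}"

definition inertia_group :: "proj_plane set \<Rightarrow> (proj_plane \<rightharpoonup> proj_plane) set" where
  "inertia_group C = {f \<in> carrier Cremona. fixes_pointwise f C}"

text \<open>
  The lines through \<open>p\<close> that \<open>f\<close> contracts have no image curve.
\<close>

definition Jon :: "proj_plane \<Rightarrow> (proj_plane \<rightharpoonup> proj_plane) set" where
  "Jon p = {f \<in> carrier Cremona.
     \<forall>L. line L \<and> p \<in> L \<and> \<not> contracts f L \<longrightarrow>
         line (strict_transform f L) \<and> p \<in> strict_transform f L}"

end

theory Submission
  imports Defs "HOL-Computational_Algebra.Field_as_Ring"
begin

text \<open>
  Let \<open>D\<close> be the given line or smooth cubic. Conjugation by \<open>\<phi>\<close> turns every Cremona transformation that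
  fixes all but finitely many points of \<open>D\<close> into one that fixes \<open>C\<close> pointwise, because \<open>D\<close> is irreducible
  and is not contracted (\<open>conjugate_in_inertia_group\<close>). So it suffices to find enough transformations
  that fix \<open>D\<close>.

  Such transformations are supplied by a point \<open>q\<close> and a curve that contains \<open>D\<close> and meets every line
  through \<open>q\<close> in at most two points other than \<open>q\<close>: the cubic \<open>D\<close> itself with \<open>q\<close> on it, or the line \<open>D\<close> counted
  twice with \<open>q\<close> arbitrary. On each line through \<open>q\<close>, the projective transformations that fix the two
  points (one double point if \<open>D\<close> is a line) form a one-parameter group. Choosing an element of it for each line, depending polynomially on
  the line, gives a birational map that preserves all lines through \<open>q\<close> and fixes \<open>D\<close>
  (\<open>pencil_map_birational\<close>). The choice can be made trivial on one line and arbitrary on another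
  (\<open>pencil_fixers_move\<close>).

  This freedom implies that a pencil of curves preserved by all these maps consists of lines through \<open>q\<close>
  (\<open>preserved_pencil_constant\<close>): some curve of any other pencil meets two different lines through \<open>q\<close>,
  and its point on one line can be kept fixed while its point on the other is moved off the curve. All
  three claims follow. There are infinitely many such maps. If the group were conjugate into a de
  Jonquieres group, then one pencil would be preserved by the maps for two different points \<open>q\<close> and \<open>q'\<close>,
  so it would consist of the lines through \<open>q\<close> and of the lines through \<open>q'\<close> at once
  (\<open>fixers_not_Jon\<close>). If the group were abelian, then each map for \<open>q'\<close> would commute with the maps for \<open>q\<close>,
  so it would permute the lines through \<open>q\<close>, the only pencil that those preserve; but the maps for \<open>q'\<close>
  jointly preserve no pencil other than the lines through \<open>q'\<close> (\<open>fixers_not_commuting\<close>).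

  The geometric foundations are elementary. A rational map is determined by its values at generic
  points, which makes the Cremona group a group (\<open>group_Cremona\<close>). An irreducible form has only finitely many
  common zeros with a form that it does not divide (\<open>finite_common_zeros\<close>), which bounds base points
  and controls vanishing along \<open>D\<close>.
\<close>

(* The symbol $ denotes components of vectors throughout. *)
no_notation fps_nth (infixl \<open>$\<close> 75)

section \<open>Polynomial functions\<close>

lemma eval3_simps [simp]:
  "eval3 0 v = 0" "eval3 1 v = 1"
  "eval3 (F + G) v = eval3 F v + eval3 G v"
  "eval3 (F - G) v = eval3 F v - eval3 G v"
  "eval3 (- F) v = - eval3 F v"
  "eval3 (F * G) v = eval3 F v * eval3 G v"
  "eval3 [:[:[:c:]:]:] v = c"
  "eval3 (smult [:[:c:]:] F) v = c * eval3 F v"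
  by (simp_all add: eval3_def)

text \<open>
  The complex numbers are infinite, so a polynomial in one variable over a domain containing them is
  determined by its values at constants; the three variables are removed one after the other.
\<close>

lemma eval3_eq_0_imp:
  assumes "\<And>v. eval3 F v = 0"
  shows "F = 0"
proof -
  have inf1: "infinite (range (\<lambda>b::complex. [:b:]))"
    by (subst finite_image_iff) (auto simp: inj_def infinite_UNIV_char_0)
  have inf2: "infinite (range (\<lambda>b::complex. [:[:b:]:]))"
    by (subst finite_image_iff) (auto simp: inj_def infinite_UNIV_char_0)
  have "poly (poly F [:[:a:]:]) [:b:] = 0" for a b
  proof -
    have "poly (poly (poly F [:[:a:]:]) [:b:]) c = 0" for c
      using assms[of "vector [a, b, c]"] by (simp add: eval3_def)
    then show ?thesis using poly_all_0_iff_0 by blast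
  qed
  then have "range (\<lambda>b. [:b:]) \<subseteq> {x. poly (poly F [:[:a:]:]) x = 0}" for a
    by auto
  then have "poly F [:[:a:]:] = 0" for a
    using inf1 poly_roots_finite finite_subset by metis
  then have "range (\<lambda>b. [:[:b:]:]) \<subseteq> {x. poly F x = 0}"
    by auto
  then show "F = 0"
    using inf2 poly_roots_finite finite_subset by metis
qed

lemma eval3_inject: "eval3 F = eval3 G \<longleftrightarrow> F = G"
proof
  assume "eval3 F = eval3 G"
  then have "eval3 (F - G) v = 0" for v by simp
  then show "F = G" using eval3_eq_0_imp[of "F - G"] by simp
qed auto

text \<open>
  By injectivity of evaluation, polynomials can be replaced by the functions they define. Substitution
  of polynomials into polynomials then becomes composition, which the nested representation hides.
\<close>

definition poly_fun :: "(complex ^ 3 \<Rightarrow> complex) \<Rightarrow> bool" where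
  "poly_fun f \<longleftrightarrow> (\<exists>F. f = eval3 F)"

lemma poly_fun_eval3 [simp]: "poly_fun (eval3 F)" "poly_fun (\<lambda>v. eval3 F v)"
  by (auto simp: poly_fun_def)

lemma poly_fun_const [simp]: "poly_fun (\<lambda>v. c)"
  by (auto simp: poly_fun_def fun_eq_iff intro!: exI[of _ "[:[:[:c:]:]:]"])

lemma poly_funI: "(\<And>v. f v = eval3 F v) \<Longrightarrow> poly_fun f"
  by (auto simp: poly_fun_def fun_eq_iff)

lemma
  assumes "poly_fun f" "poly_fun g"
  shows poly_fun_add [intro]: "poly_fun (\<lambda>v. f v + g v)"
    and poly_fun_diff [intro]: "poly_fun (\<lambda>v. f v - g v)"
    and poly_fun_mult [intro]: "poly_fun (\<lambda>v. f v * g v)"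
proof -
  obtain F G where "f = eval3 F" "g = eval3 G"
    using assms by (auto simp: poly_fun_def)
  then show "poly_fun (\<lambda>v. f v + g v)" "poly_fun (\<lambda>v. f v - g v)" "poly_fun (\<lambda>v. f v * g v)"
    by (auto intro: poly_funI[of _ "F + G"] poly_funI[of _ "F - G"] poly_funI[of _ "F * G"])
qed

lemma poly_fun_power [intro]: "poly_fun f \<Longrightarrow> poly_fun (\<lambda>v. f v ^ n)"
  by (induction n) auto

lemma index_cases: "(i::3) = 1 \<or> i = 2 \<or> i = 3"
  using exhaust_3 by auto

lemma poly_fun_coord [simp]: "poly_fun (\<lambda>v :: complex ^ 3. v $ i)"
proof -
  have "(\<lambda>v :: complex ^ 3. v $ 1) = eval3 [:0, 1:]" "(\<lambda>v :: complex ^ 3. v $ 2) = eval3 [:[:0, 1:]:]"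
    "(\<lambda>v :: complex ^ 3. v $ 3) = eval3 [:[:[:0, 1:]:]:]"
    by (auto simp: eval3_def)
  then show ?thesis using index_cases[of i] poly_fun_eval3 by metis
qed

lemma poly_fun_compose:
  fixes g :: "complex ^ 3 \<Rightarrow> complex ^ 3"
  assumes "poly_fun f" "\<And>i. poly_fun (\<lambda>v. g v $ i)"
  shows "poly_fun (\<lambda>v. f (g v))"
proof -
  obtain F where F: "f = eval3 F" using assms(1) by (auto simp: poly_fun_def)
  have 1: "poly_fun (\<lambda>v. poly c (g v $ 3))" for c
    by (induction c rule: pCons_induct) (use assms(2) in \<open>auto intro!: poly_fun_add poly_fun_mult\<close>)
  have 2: "poly_fun (\<lambda>v. poly (poly b [:g v $ 2:]) (g v $ 3))" for b
    by (induction b rule: pCons_induct) (use assms(2) 1 in \<open>auto intro!: poly_fun_add poly_fun_mult\<close>)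
  have "poly_fun (\<lambda>v. poly (poly (poly F [:[:g v $ 1:]:]) [:g v $ 2:]) (g v $ 3))"
    by (induction F rule: pCons_induct) (use assms(2) 2 in \<open>auto intro!: poly_fun_add poly_fun_mult\<close>)
  then show ?thesis by (simp add: F eval3_def)
qed

lemma poly_fun_nonzero_mult:
  assumes "poly_fun f" "poly_fun g" "\<exists>v. f v \<noteq> 0" "\<exists>v. g v \<noteq> 0"
  shows "\<exists>v. f v * g v \<noteq> 0"
proof -
  obtain F G where FG: "f = eval3 F" "g = eval3 G"
    using assms by (auto simp: poly_fun_def)
  then have "F * G \<noteq> 0" using assms by auto
  then obtain v where "eval3 (F * G) v \<noteq> 0" using eval3_eq_0_imp by blast
  then show ?thesis by (auto simp: FG)
qed

lemma poly_fun_line: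
  fixes x y :: "complex ^ 3"
  assumes "poly_fun f"
  shows "\<exists>p::complex poly. \<forall>t. poly p t = f (x + t *s y)"
proof -
  obtain F where F: "f = eval3 F" using assms by (auto simp: poly_fun_def)
  have 1: "\<exists>p. \<forall>t. poly p t = poly c (x $ 3 + t * y $ 3)" for c :: "complex poly"
    by (rule exI[of _ "pcompose c [:x $ 3, y $ 3:]"]) (simp add: poly_pcompose)
  have 2: "\<exists>p. \<forall>t. poly p t = poly (poly b [:x $ 2 + t * y $ 2:]) (x $ 3 + t * y $ 3)"
    for b :: "complex poly poly"
  proof (induction b rule: pCons_induct)
    case (pCons a b)
    obtain p where p: "\<forall>t. poly p t = poly (poly b [:x $ 2 + t * y $ 2:]) (x $ 3 + t * y $ 3)"
      using pCons by blast
    obtain r where r: "\<forall>t. poly r t = poly a (x $ 3 + t * y $ 3)" using 1 by blast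
    show ?case
      by (rule exI[of _ "r + [:x $ 2, y $ 2:] * p"]) (use p r in \<open>auto simp: algebra_simps\<close>)
  qed (auto intro: exI[of _ 0])
  have "\<exists>p. \<forall>t. poly p t = poly (poly (poly F [:[:x $ 1 + t * y $ 1:]:]) [:x $ 2 + t * y $ 2:]) (x $ 3 + t * y $ 3)"
  proof (induction F rule: pCons_induct)
    case (pCons a b)
    obtain p where p: "\<forall>t. poly p t = poly (poly (poly b [:[:x $ 1 + t * y $ 1:]:]) [:x $ 2 + t * y $ 2:]) (x $ 3 + t * y $ 3)"
      using pCons by blast
    obtain r where r: "\<forall>t. poly r t = poly (poly a [:x $ 2 + t * y $ 2:]) (x $ 3 + t * y $ 3)" using 2 by blast
    show ?case
      by (rule exI[of _ "r + [:x $ 1, y $ 1:] * p"]) (use p r in \<open>auto simp: algebra_simps\<close>)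
  qed (auto intro: exI[of _ 0])
  then show ?thesis by (simp add: F eval3_def)
qed

lemma poly_fun_line_finite:
  assumes "poly_fun f" "f (x + s *s y) \<noteq> 0"
  shows "finite {t. f (x + t *s y) = 0}"
proof -
  obtain p where p: "\<forall>t. poly p t = f (x + t *s y)" using poly_fun_line assms(1) by blast
  then have "p \<noteq> 0" using assms(2) by (metis poly_0)
  then show ?thesis using poly_roots_finite[of p] p by simp
qed

section \<open>Forms\<close>

text \<open>
  Over an infinite field homogeneity can be read off from the values under scaling; in this shape it
  passes to composites.
\<close>

definition form :: "nat \<Rightarrow> (complex ^ 3 \<Rightarrow> complex) \<Rightarrow> bool" where
  "form d f \<longleftrightarrow> poly_fun f \<and> (\<forall>s v. f (s *s v) = s ^ d * f v)"

lemma form_poly_fun: "form d f \<Longrightarrow> poly_fun f"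
  by (simp add: form_def)

lemma form_scale: "form d f \<Longrightarrow> f (s *s v) = s ^ d * f v"
  by (simp add: form_def)

lemma form_zero: "form d (\<lambda>_. 0)"
  by (simp add: form_def)

lemma form_one: "form 0 (\<lambda>_. c)"
  by (simp add: form_def)

lemma form_add: "form d f \<Longrightarrow> form d g \<Longrightarrow> form d (\<lambda>v. f v + g v)"
  by (auto simp: form_def algebra_simps)

lemma form_diff: "form d f \<Longrightarrow> form d g \<Longrightarrow> form d (\<lambda>v. f v - g v)"
  by (auto simp: form_def algebra_simps)

lemma form_mult: "form d f \<Longrightarrow> form e g \<Longrightarrow> form (d + e) (\<lambda>v. f v * g v)"
  by (auto simp: form_def algebra_simps power_add)

lemma form_cmult: "form d f \<Longrightarrow> form d (\<lambda>v. c * f v)"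
  by (auto simp: form_def algebra_simps)

lemma form_power: "form d f \<Longrightarrow> form (d * n) (\<lambda>v. f v ^ n)"
  by (auto simp: form_def algebra_simps power_mult power_mult_distrib)

lemma form_coord: "form 1 (\<lambda>v :: complex ^ 3. v $ i)"
  by (auto simp: form_def)

lemma form_sum: "(\<And>i. i \<in> I \<Longrightarrow> form d (f i)) \<Longrightarrow> form d (\<lambda>v. \<Sum>i\<in>I. f i v)"
  by (induction I rule: infinite_finite_induct) (auto simp: form_zero form_add)

lemma form_compose:
  fixes g :: "complex ^ 3 \<Rightarrow> complex ^ 3"
  assumes "form d f" "\<And>i. form e (\<lambda>v. g v $ i)"
  shows "form (d * e) (\<lambda>v. f (g v))"
proof -
  have "g (s *s v) = s ^ e *s g v" for s v
    using assms(2) by (simp add: vec_eq_iff form_def)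
  then have "f (g (s *s v)) = s ^ (d * e) * f (g v)" for s v
    using assms(1) by (simp add: form_def power_mult mult.commute[of d])
  then show ?thesis
    using poly_fun_compose[of f g] assms by (simp add: form_def)
qed

lemma form_degree_unique:
  assumes "form d f" "form e f" "f v \<noteq> 0"
  shows "d = e"
proof -
  have "(2::complex) ^ d * f v = 2 ^ e * f v" using assms(1,2) by (metis form_scale)
  then have "(2::complex) ^ d = 2 ^ e" using assms(3) by simp
  then have "(2::real) ^ d = 2 ^ e" by (metis norm_power norm_numeral)
  then show ?thesis by simp
qed

lemma eval3_altdef:
  "eval3 F v = (\<Sum>i\<le>degree F. \<Sum>j\<le>degree (coeff F i). \<Sum>k\<le>degree (coeff (coeff F i) j).
     coeff (coeff (coeff F i) j) k * (v $ 1 ^ i * v $ 2 ^ j * v $ 3 ^ k))"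
proof -
  have c1: "[:[:x:]:] ^ n = [:[:x ^ n:]:]" for x :: complex and n by (induction n) (auto simp: one_pCons)
  have c2: "[:x:] ^ n = [:x ^ n:]" for x :: complex and n by (induction n) (auto simp: one_pCons)
  show ?thesis
    unfolding eval3_def
    by (subst poly_altdef, simp add: poly_sum c1 poly_altdef[of "coeff F _"] sum_distrib_right c2
        poly_altdef[of "coeff (coeff F _) _"] mult_ac sum_distrib_left)
qed

text \<open>
  The coefficients of a form are recovered by doubling all variables: this multiplies the coefficient
  of each monomial of degree \<open>n\<close> by \<open>2\<^sup>n\<close>, and \<open>2\<^sup>n = 2\<^sup>d\<close> only for \<open>n = d\<close>.
\<close>

lemma homogeneous_iff_form: "homogeneous d F \<longleftrightarrow> form d (eval3 F)"
proof
  assume h: "homogeneous d F"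
  have *: "coeff (coeff (coeff F i) j) k * ((s * a) ^ i * (s * b) ^ j * (s * c) ^ k)
     = s ^ d * (coeff (coeff (coeff F i) j) k * (a ^ i * b ^ j * c ^ k))" for i j k s a b c
  proof (cases "coeff (coeff (coeff F i) j) k = 0")
    case False
    then have "i + j + k = d" using h by (simp add: homogeneous_def)
    then show ?thesis by (auto simp: power_mult_distrib power_add)
  qed auto
  have "eval3 F (s *s v) = s ^ d * eval3 F v" for s v
    by (simp add: eval3_altdef * flip: sum_distrib_left)
  then show "form d (eval3 F)" by (simp add: form_def)
next
  assume f: "form d (eval3 F)"
  define s :: complex where "s = 2"
  define \<psi> where "\<psi> r = pcompose r [:0, s:]" for r
  define \<omega> where "\<omega> q = pcompose (map_poly \<psi> q) [:0, [:s:]:]" for q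
  define T where "T = pcompose (map_poly \<omega> F) [:0, [:[:s:]:]:]"
  have [simp]: "\<psi> 0 = 0" "\<omega> 0 = 0" by (auto simp: \<psi>_def \<omega>_def)
  have 1: "poly (poly (map_poly \<psi> q) [:b:]) c = poly (poly q [:b:]) (s * c)" for q b c
    by (induction q rule: pCons_induct)
      (auto simp: map_poly_pCons \<psi>_def poly_pcompose algebra_simps)
  have 2: "poly (poly (\<omega> q) [:b:]) c = poly (poly q [:s * b:]) (s * c)" for q b c
    by (simp add: \<omega>_def poly_pcompose 1 mult.commute)
  have 3: "poly (poly (poly (map_poly \<omega> F) [:[:a:]:]) [:b:]) c
      = poly (poly (poly F [:[:a:]:]) [:s * b:]) (s * c)" for a b c
    by (induction F rule: pCons_induct) (auto simp: map_poly_pCons 2)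
  have "eval3 T v = eval3 F (s *s v)" for v
    by (simp add: T_def eval3_def poly_pcompose 3 mult.commute)
  then have "eval3 T = eval3 ([:[:[:s ^ d:]:]:] * F)"
    using f by (auto simp: form_def)
  then have T: "T = [:[:[:s ^ d:]:]:] * F" by (simp only: eval3_inject)
  show "homogeneous d F"
    unfolding homogeneous_def
  proof (intro allI impI)
    fix i j k
    assume nz: "coeff (coeff (coeff F i) j) k \<noteq> 0"
    have c1: "[:[:s:]:] ^ n = [:[:s ^ n:]:]" for n by (induction n) (auto simp: one_pCons)
    have c2: "[:s:] ^ n = [:s ^ n:]" for n by (induction n) (auto simp: one_pCons)
    have "coeff (coeff (coeff T i) j) k = s ^ (i + j + k) * coeff (coeff (coeff F i) j) k"
      by (simp add: T_def coeff_pcompose_linear coeff_map_poly \<omega>_def \<psi>_def c1 c2 power_add)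
    moreover have "coeff (coeff (coeff T i) j) k = s ^ d * coeff (coeff (coeff F i) j) k"
      by (simp add: T)
    ultimately have "s ^ (i + j + k) = s ^ d" using nz by simp
    then have "(2::real) ^ (i + j + k) = 2 ^ d"
      unfolding s_def by (metis norm_power norm_numeral)
    then show "i + j + k = d" by simp
  qed
qed

lemma form_obtain_poly:
  assumes "form d f"
  obtains F where "f = eval3 F" "homogeneous d F"
  using assms homogeneous_iff_form by (auto simp: form_def poly_fun_def)

lemma poly_fun_components:
  assumes "poly_fun f"
  obtains N c where "\<And>n. form n (c n)" "\<And>v. f v = (\<Sum>n\<le>N. c n v)"
proof -
  obtain F where F: "f = eval3 F" using assms by (auto simp: poly_fun_def)
  define I where "I = (SIGMA i:{..degree F}. SIGMA j:{..degree (coeff F i)}. {..degree (coeff (coeff F i) j)})"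
  define m where "m x v = (case x of (i, j, k) \<Rightarrow>
    coeff (coeff (coeff F i) j) k * (v $ 1 ^ i * v $ 2 ^ j * v $ 3 ^ k))" for x and v :: "complex ^ 3"
  define dg where "dg = (\<lambda>(i, j, k::nat). i + j + k :: nat)"
  have fin: "finite I" by (auto simp: I_def)
  have f: "f v = (\<Sum>x\<in>I. m x v)" for v
    by (simp add: F eval3_altdef I_def m_def sum.Sigma)
  have m: "form (dg x) (m x)" for x
  proof -
    obtain i j k where x: "x = (i, j, k)" by (cases x)
    have "form (1 * i + 1 * j + 1 * k) (\<lambda>v. v $ 1 ^ i * v $ 2 ^ j * v $ 3 ^ k)"
      by (intro form_mult form_power form_coord)
    from form_cmult[OF this, of "coeff (coeff (coeff F i) j) k"] show ?thesis
      by (simp add: x dg_def m_def[abs_def])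
  qed
  define c where "c n v = (\<Sum>x | x \<in> I \<and> dg x = n. m x v)" for n v
  have "form n (c n)" for n
    unfolding c_def using m by (intro form_sum) auto
  moreover have "f v = (\<Sum>n\<le>Max (dg ` I). c n v)" for v
    unfolding f c_def by (rule sum.group[symmetric]) (use fin in auto)
  ultimately show ?thesis using that by blast
qed

text \<open>
  A divisor of a form is a form: on a generic line through the origin it restricts to a divisor of a
  power of the parameter, hence to a monomial, so it cannot have two nonzero homogeneous components.
\<close>

lemma form_divisor:
  assumes H: "form d (eval3 (F * G))" and nz: "F * G \<noteq> 0"
  shows "\<exists>e. form e (eval3 F)"
proof -
  obtain N c where c: "\<And>n. form n (c n)" "\<And>v. eval3 F v = (\<Sum>n\<le>N. c n v)"
    using poly_fun_components[of "eval3 F"] poly_fun_eval3(1) by metis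
  obtain w where w: "eval3 (F * G) w \<noteq> 0" using nz eval3_eq_0_imp by blast
  have unique: "n = m" if nm: "n \<le> N" "m \<le> N" "\<exists>v. c n v \<noteq> 0" "\<exists>v. c m v \<noteq> 0" for n m
  proof (rule ccontr)
    assume "n \<noteq> m"
    have "\<exists>v. c n v * c m v \<noteq> 0" using nm c by (intro poly_fun_nonzero_mult) (auto simp: form_def)
    then have "\<exists>v. (c n v * c m v) * eval3 (F * G) v \<noteq> 0"
      using w c by (intro poly_fun_nonzero_mult poly_fun_mult poly_fun_eval3) (auto simp: form_def)
    then obtain v where v: "c n v \<noteq> 0" "c m v \<noteq> 0" "eval3 (F * G) v \<noteq> 0" by auto
    define p where "p = (\<Sum>n\<le>N. monom (c n v) n)"
    have p: "poly p s = eval3 F (s *s v)" for s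
      using c by (simp add: p_def poly_sum poly_monom form_def mult.commute)
    obtain q where q: "\<forall>t. poly q t = eval3 G (0 + t *s v)" using poly_fun_line poly_fun_eval3(1) by metis
    have "poly (p * q) s = poly (monom (eval3 (F * G) v) d) s" for s
      using H p q by (simp add: poly_monom form_def mult_ac)
    then have "p * q = monom (eval3 (F * G) v) d" using poly_eq_poly_eq_iff by blast
    then have "p dvd smult (eval3 (F * G) v) ([:0, 1:] ^ d)"
      using dvd_triv_left[of p q] by (simp only: monom_altdef)
    then have "p dvd [:0, 1:] ^ d" using v(3) by (metis dvd_smult_cancel)
    moreover have "prime_elem [:0, 1::complex:]" by (rule prime_elem_linear_field_poly) auto
    then have "prime [:0, 1::complex:]" by (simp add: prime_def normalize_poly_eq_map_poly map_poly_pCons)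
    ultimately obtain k where k: "k \<le> d" "normalize p = normalize ([:0, 1:] ^ k)"
      using divides_primepow_weak[of "[:0,1::complex:]" p d] by blast
    then have "p dvd [:0, 1:] ^ k" "[:0, 1:] ^ k dvd p" by (metis associatedD1, metis associatedD2)
    then obtain a b where ab: "p = [:0, 1:] ^ k * a" "[:0, 1:] ^ k = p * b" by (meson dvdE)
    have "p \<noteq> 0" using ab(2) by (metis mult_zero_left pCons_eq_0_iff power_eq_0_iff zero_neq_one)
    moreover have "p * (b * a) = p * 1"
      unfolding mult.assoc[symmetric] ab(2)[symmetric] mult_1_right by (rule ab(1)[symmetric])
    ultimately have "b * a = 1" unfolding mult_cancel_left by simp
    then have "a * b = 1" by (simp only: mult.commute)
    then have "is_unit a" by (metis dvdI)
    then obtain u where u: "a = [:u:]" by (metis is_unit_polyE)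
    then have "p = monom u k" unfolding ab(1) by (simp add: monom_altdef)
    moreover have "coeff p i = (if i \<le> N then c i v else 0)" for i
      by (simp add: p_def coeff_sum if_distrib cong: if_cong)
    ultimately have "c n v = (if n = k then u else 0)" "c m v = (if m = k then u else 0)"
      using nm(1,2) by (metis coeff_monom)+
    then show False using v \<open>n \<noteq> m\<close> by (auto split: if_splits)
  qed
  show ?thesis
  proof (cases "\<exists>n\<le>N. \<exists>v. c n v \<noteq> 0")
    case True
    then obtain n where n: "n \<le> N" "\<exists>v. c n v \<noteq> 0" by blast
    have "eval3 F v = c n v" for v
    proof -
      have "c m v = (if m = n then c n v else 0)" if "m \<le> N" for m
        using unique[OF that n(1) _ n(2)] by auto
      then have "eval3 F v = (\<Sum>m\<le>N. if m = n then c n v else 0)" by (simp add: c)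
      then show ?thesis using n by simp
    qed
    then have "eval3 F = c n" by auto
    then show ?thesis using c by metis
  next
    case False
    then have "eval3 F = (\<lambda>_. 0)" using c(2) by auto
    then show ?thesis using form_zero by metis
  qed
qed

section \<open>Points and generic points\<close>

text \<open>
  Two nonzero vectors represent the same point iff they are parallel. The condition is polynomial and
  also makes sense for the zero vector, so it can be extended from generic vectors to all vectors.
\<close>

definition parallel :: "complex ^ 3 \<Rightarrow> complex ^ 3 \<Rightarrow> bool" where
  "parallel u v \<longleftrightarrow> (\<forall>i j. u $ i * v $ j = u $ j * v $ i)"

lemma rep_nonzero [simp]: "rep_proj_plane p \<noteq> 0"
  using Quotient_rep_reflp[OF Quotient_proj_plane, of p] by blast

lemma abs_rep [simp]: "abs_proj_plane (rep_proj_plane p) = p"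
  by (rule Quotient_abs_rep[OF Quotient_proj_plane])

lemma abs_eq_iff:
  assumes "u \<noteq> 0" "v \<noteq> 0"
  shows "abs_proj_plane u = abs_proj_plane v \<longleftrightarrow> (\<exists>c. c \<noteq> 0 \<and> v = c *s u)"
proof -
  have *: "w \<noteq> 0 \<and> w \<noteq> 0 \<and> (\<exists>c. c \<noteq> 0 \<and> w = c *s w)" if "w \<noteq> 0" for w :: "complex ^ 3"
    using that by (auto intro!: exI[of _ 1])
  show ?thesis
    using Quotient_rel[OF Quotient_proj_plane, of u v] *[OF assms(1)] *[OF assms(2)] assms
    by auto
qed

lemma abs_scale: "v \<noteq> 0 \<Longrightarrow> c \<noteq> 0 \<Longrightarrow> abs_proj_plane (c *s v) = abs_proj_plane v"
  by (subst abs_eq_iff) (auto simp: vector_mul_eq_0 intro!: exI[of _ "inverse c"] simp: vector_smult_assoc)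

lemma point_cases:
  obtains v where "v \<noteq> 0" "p = abs_proj_plane v"
  using rep_nonzero abs_rep by metis

lemma rep_abs:
  assumes "v \<noteq> 0"
  obtains c where "c \<noteq> 0" "rep_proj_plane (abs_proj_plane v) = c *s v"
  using abs_eq_iff[OF assms rep_nonzero, of "abs_proj_plane v"] by auto

lemma parallel_iff:
  assumes "u \<noteq> 0" "v \<noteq> 0"
  shows "parallel u v \<longleftrightarrow> abs_proj_plane u = abs_proj_plane v"
proof
  assume par: "parallel u v"
  obtain j where j: "u $ j \<noteq> 0" using assms(1) by (auto simp: vec_eq_iff)
  have "v = (v $ j / u $ j) *s u"
    using par j by (simp add: vec_eq_iff parallel_def field_simps)
  moreover from this have "v $ j / u $ j \<noteq> 0" using assms(2) by auto
  ultimately show "abs_proj_plane u = abs_proj_plane v"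
    using assms abs_eq_iff by blast
next
  assume "abs_proj_plane u = abs_proj_plane v"
  then show "parallel u v" using assms by (subst (asm) abs_eq_iff) (auto simp: parallel_def)
qed

lemma vanishes_abs:
  assumes "homogeneous d F" "v \<noteq> 0"
  shows "vanishes F (abs_proj_plane v) \<longleftrightarrow> eval3 F v = 0"
proof -
  obtain c where "c \<noteq> 0" "rep_proj_plane (abs_proj_plane v) = c *s v"
    using rep_abs assms(2) by blast
  then show ?thesis
    using assms(1) by (auto simp: vanishes_def homogeneous_iff_form form_scale)
qed

text \<open>
  A property is generic if it holds outside the zeros of some nonzero form, that is, on a
  nonempty principal Zariski open set. The plane is irreducible, so finitely many generic properties hold
  simultaneously at generic points.
\<close>

definition generic :: "(proj_plane \<Rightarrow> bool) \<Rightarrow> bool" where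
  "generic P \<longleftrightarrow> (\<exists>d f. form d f \<and> (\<exists>v. f v \<noteq> 0) \<and>
     (\<forall>v. v \<noteq> 0 \<longrightarrow> f v \<noteq> 0 \<longrightarrow> P (abs_proj_plane v)))"

lemma genericI:
  assumes "form d f" "f w \<noteq> 0" "\<And>v. v \<noteq> 0 \<Longrightarrow> f v \<noteq> 0 \<Longrightarrow> P (abs_proj_plane v)"
  shows "generic P"
  using assms unfolding generic_def by blast

lemma generic_mono: "generic P \<Longrightarrow> (\<And>p. P p \<Longrightarrow> Q p) \<Longrightarrow> generic Q"
  unfolding generic_def by blast

lemma generic_conj:
  assumes "generic P" "generic Q"
  shows "generic (\<lambda>p. P p \<and> Q p)"
proof -
  obtain d f where f: "form d f" "\<exists>v. f v \<noteq> 0"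
    "\<And>v. v \<noteq> 0 \<Longrightarrow> f v \<noteq> 0 \<Longrightarrow> P (abs_proj_plane v)"
    using assms(1) unfolding generic_def by blast
  obtain e g where g: "form e g" "\<exists>v. g v \<noteq> 0"
    "\<And>v. v \<noteq> 0 \<Longrightarrow> g v \<noteq> 0 \<Longrightarrow> Q (abs_proj_plane v)"
    using assms(2) unfolding generic_def by blast
  obtain w where "f w * g w \<noteq> 0"
    using poly_fun_nonzero_mult f g form_poly_fun by metis
  then show ?thesis
    using form_mult[OF f(1) g(1)] f(3) g(3) by (intro genericI[of _ "\<lambda>v. f v * g v"]) auto
qed

lemma poly_fun_nonzero_point:
  assumes "poly_fun f" "f w \<noteq> 0"
  obtains v where "v \<noteq> 0" "f v \<noteq> 0"
proof -
  have "\<exists>v. f v * v $ 1 \<noteq> 0"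
  proof (rule poly_fun_nonzero_mult[OF assms(1) poly_fun_coord])
    show "\<exists>v::complex ^ 3. v $ 1 \<noteq> 0" by (rule exI[of _ "axis 1 1"]) simp
  qed (use assms in auto)
  then obtain v where "f v \<noteq> 0" "v $ 1 \<noteq> 0" by auto
  then show ?thesis using that[of v] by (metis zero_index)
qed

lemma generic_ex:
  assumes "generic P"
  obtains p where "P p"
proof -
  obtain d f w where f: "form d f" "f w \<noteq> 0"
    "\<And>v. v \<noteq> 0 \<Longrightarrow> f v \<noteq> 0 \<Longrightarrow> P (abs_proj_plane v)"
    using assms unfolding generic_def by blast
  then show ?thesis using poly_fun_nonzero_point that form_poly_fun by metis
qed

section \<open>Rational maps\<close>

definition coprime3 :: "poly3 ^ 3 \<Rightarrow> bool" where
  "coprime3 F \<longleftrightarrow> (\<forall>h. (\<forall>i. h dvd F $ i) \<longrightarrow> is_unit h)"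

definition homogeneous3 :: "nat \<Rightarrow> poly3 ^ 3 \<Rightarrow> bool" where
  "homogeneous3 d F \<longleftrightarrow> (\<forall>i. homogeneous d (F $ i))"

definition triple_map :: "poly3 ^ 3 \<Rightarrow> proj_plane \<Rightarrow> proj_plane option" where
  "triple_map F p = (let w = eval_triple F (rep_proj_plane p)
                     in if w = 0 then None else Some (abs_proj_plane w))"

lemma rational_map_iff:
  "rational_map f \<longleftrightarrow> (\<exists>d F. homogeneous3 d F \<and> coprime3 F \<and> f = triple_map F)"
  by (simp add: rational_map_def coprime3_def homogeneous3_def triple_map_def fun_eq_iff)

lemma form_eval_triple: "homogeneous3 d F \<Longrightarrow> form d (\<lambda>v. eval_triple F v $ i)"
  by (simp add: homogeneous3_def eval_triple_def homogeneous_iff_form)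

lemma eval_triple_scale:
  "homogeneous3 d F \<Longrightarrow> eval_triple F (s *s v) = s ^ d *s eval_triple F v"
  by (simp add: homogeneous3_def eval_triple_def homogeneous_iff_form vec_eq_iff form_def)

lemma eval_triple_eq_0_iff: "eval_triple F v = 0 \<longleftrightarrow> (\<forall>i. eval3 (F $ i) v = 0)"
  by (simp add: eval_triple_def vec_eq_iff)

lemma triple_map_abs:
  assumes "homogeneous3 d F" "v \<noteq> 0"
  shows "triple_map F (abs_proj_plane v) =
    (if eval_triple F v = 0 then None else Some (abs_proj_plane (eval_triple F v)))"
proof -
  obtain c where "c \<noteq> 0" "rep_proj_plane (abs_proj_plane v) = c *s v"
    using rep_abs assms(2) by blast
  then show ?thesis
    using assms(1) by (auto simp: triple_map_def eval_triple_scale abs_scale vector_mul_eq_0)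
qed

lemma coprime3_nonzero: "coprime3 F \<Longrightarrow> \<exists>i. F $ i \<noteq> 0"
  unfolding coprime3_def by (metis dvd_0_right not_is_unit_0)

lemma eval3_nonzero: "F \<noteq> 0 \<Longrightarrow> \<exists>v. eval3 F v \<noteq> 0"
  using eval3_eq_0_imp by blast

lemma rational_map_form:
  assumes "rational_map f"
  obtains d F where "homogeneous3 d F" "coprime3 F" "f = triple_map F" "\<exists>v. eval_triple F v \<noteq> 0"
  using assms coprime3_nonzero eval3_nonzero
  unfolding rational_map_iff by (metis eval_triple_eq_0_iff)

lemma generic_eval_triple_nonzero:
  assumes "homogeneous3 d F" "eval_triple F w \<noteq> 0"
    and "\<And>v. v \<noteq> 0 \<Longrightarrow> eval_triple F v \<noteq> 0 \<Longrightarrow> P (abs_proj_plane v)"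
  shows "generic P"
proof -
  obtain i where "eval_triple F w $ i \<noteq> 0" using assms(2) by (auto simp: vec_eq_iff)
  then show ?thesis
    by (rule genericI[OF form_eval_triple[OF assms(1)]]) (metis assms(3) zero_index)
qed

lemma generic_rational_map_defined:
  assumes "rational_map f"
  shows "generic (\<lambda>p. \<exists>q. f p = Some q)"
proof -
  obtain d F where F: "homogeneous3 d F" "f = triple_map F" "\<exists>v. eval_triple F v \<noteq> 0"
    using rational_map_form[OF assms] by metis
  then show ?thesis using generic_eval_triple_nonzero[OF F(1)] triple_map_abs by auto
qed

lemma homogeneous_degree_unique:
  "homogeneous d F \<Longrightarrow> homogeneous e F \<Longrightarrow> F \<noteq> 0 \<Longrightarrow> d = e"
  using form_degree_unique eval3_nonzero unfolding homogeneous_iff_form by metis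

lemma homogeneous_divisor:
  assumes "homogeneous d F" "F \<noteq> 0" "G dvd F"
  shows "\<exists>e. homogeneous e G"
  using assms form_divisor unfolding homogeneous_iff_form dvd_def by metis

lemma homogeneous_mult: "homogeneous d F \<Longrightarrow> homogeneous e G \<Longrightarrow> homogeneous (d + e) (F * G)"
  using form_mult[of d "eval3 F" e "eval3 G"] by (simp add: homogeneous_iff_form form_def)

lemma gcd3_dvd: "gcd (F $ 1) (gcd (F $ 2) (F $ 3)) dvd F $ i" for F :: "poly3 ^ 3"
  using index_cases[of i] dvd_trans[OF gcd_dvd2 gcd_dvd1] dvd_trans[OF gcd_dvd2 gcd_dvd2] by auto

text \<open>
  The greatest common divisor can be cancelled from a triple of forms because divisors of forms are
  forms; comparing degrees shows that the quotients still have a common degree.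
\<close>

lemma reduce_triple:
  assumes "homogeneous3 d F" "\<exists>i. F $ i \<noteq> 0"
  obtains e c G where "homogeneous3 e G" "coprime3 G" "c \<noteq> 0" "\<And>i. F $ i = c * G $ i"
proof -
  define c where "c = gcd (F $ 1) (gcd (F $ 2) (F $ 3))"
  obtain i0 where i0: "F $ i0 \<noteq> 0" using assms(2) by blast
  have c_dvd: "c dvd F $ i" for i unfolding c_def by (rule gcd3_dvd)
  then have "c \<noteq> 0" using i0 by (metis dvd_0_left)
  have c_greatest: "h dvd c" if "\<And>i. h dvd F $ i" for h
    using that by (simp add: c_def)
  define G where "G = (\<chi> i. F $ i div c)"
  have FG: "F $ i = c * G $ i" for i using c_dvd by (simp add: G_def)
  have G_i0: "G $ i0 \<noteq> 0" using i0 FG by (metis mult_zero_right)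
  have "coprime3 G"
    unfolding coprime3_def
  proof (intro allI impI)
    fix h assume "\<forall>i. h dvd G $ i"
    then have "c * h dvd F $ i" for i by (simp add: FG mult_dvd_mono)
    then have "c * h dvd c * 1" using c_greatest by simp
    then show "is_unit h" using \<open>c \<noteq> 0\<close> by (subst (asm) dvd_mult_cancel_left) auto
  qed
  moreover have "homogeneous3 (d - k) G" if k: "homogeneous k c" for k
    unfolding homogeneous3_def
  proof
    fix i
    show "homogeneous (d - k) (G $ i)"
    proof (cases "G $ i = 0")
      case True then show ?thesis by (simp add: homogeneous_def)
    next
      case False
      then have nz: "F $ i \<noteq> 0" using \<open>c \<noteq> 0\<close> FG by simp
      have d: "homogeneous d (F $ i)" using assms(1) by (simp add: homogeneous3_def)
      obtain e where e: "homogeneous e (G $ i)"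
        using homogeneous_divisor[OF d nz, of "G $ i"] FG by auto
      have "d = k + e"
        using homogeneous_degree_unique[OF d _ nz] homogeneous_mult[OF k e] by (simp add: FG)
      then show ?thesis using e by simp
    qed
  qed
  moreover obtain k where "homogeneous k c"
    using homogeneous_divisor[OF _ i0 c_dvd] assms(1) by (auto simp: homogeneous3_def)
  ultimately show ?thesis using that \<open>c \<noteq> 0\<close> FG by blast
qed

lemma coprime3_cancel:
  assumes "coprime3 F" "\<And>j. a dvd F $ j * b"
  shows "a dvd b"
proof -
  have u: "gcd (F $ 1) (gcd (F $ 2) (F $ 3)) = 1"
    using assms(1) gcd3_dvd[of F] unfolding coprime3_def is_unit_gcd_iff[symmetric] by blast
  have *: "a dvd gcd x y * b" if "a dvd x * b" "a dvd y * b" for x y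
    using gcd_greatest[OF that] by (simp add: gcd_mult_right gcd.commute)
  have "a dvd gcd (F $ 1) (gcd (F $ 2) (F $ 3)) * b" by (intro * assms(2))
  then show ?thesis by (simp add: u)
qed

text \<open>
  Proportional coprime triples divide each other componentwise, so they have the same zeros and
  define the same partial function.
\<close>

lemma triple_map_eqI:
  assumes F: "homogeneous3 d F" "coprime3 F" and G: "homogeneous3 e G" "coprime3 G"
    and par: "\<And>v. parallel (eval_triple F v) (eval_triple G v)"
  shows "triple_map F = triple_map G"
proof -
  have eq: "F $ i * G $ j = F $ j * G $ i" for i j
  proof -
    have "eval3 (F $ i * G $ j) = eval3 (F $ j * G $ i)"
      using par by (auto simp: parallel_def eval_triple_def fun_eq_iff)
    then show ?thesis by (simp only: eval3_inject)
  qed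
  have "F $ i dvd G $ i" for i
    using coprime3_cancel[OF F(2), of "F $ i" "G $ i"] eq by (metis dvd_triv_left)
  moreover have "G $ i dvd F $ i" for i
    using coprime3_cancel[OF G(2), of "G $ i" "F $ i"] eq by (metis dvd_triv_left mult.commute)
  ultimately have "eval_triple F v = 0 \<longleftrightarrow> eval_triple G v = 0" for v
    unfolding eval_triple_eq_0_iff
    by (metis (no_types, opaque_lifting) dvdE eval3_simps(6) mult_zero_left)
  then show ?thesis
    using par unfolding triple_map_def fun_eq_iff Let_def by (auto simp flip: parallel_iff)
qed

text \<open>
  Being parallel is a polynomial condition on the values of two triples, so it extends from generic vectors
  to all vectors.
\<close>

lemma rational_map_eqI:
  assumes "rational_map f" "rational_map g" "generic (\<lambda>p. f p = g p)"
  shows "f = g"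
proof -
  obtain d F where F: "homogeneous3 d F" "coprime3 F" "f = triple_map F" "\<exists>v. eval_triple F v \<noteq> 0"
    using rational_map_form[OF assms(1)] by metis
  obtain e G where G: "homogeneous3 e G" "coprime3 G" "g = triple_map G" "\<exists>v. eval_triple G v \<noteq> 0"
    using rational_map_form[OF assms(2)] by metis
  obtain k b where b: "form k b" "\<exists>v. b v \<noteq> 0"
    "\<And>v. v \<noteq> 0 \<Longrightarrow> b v \<noteq> 0 \<Longrightarrow> f (abs_proj_plane v) = g (abs_proj_plane v)"
    using assms(3) unfolding generic_def by blast
  have "parallel (eval_triple F v) (eval_triple G v)" for v
    unfolding parallel_def
  proof (intro allI, rule ccontr)
    fix i j
    define h where "h v = eval_triple F v $ i * eval_triple G v $ j - eval_triple F v $ j * eval_triple G v $ i" for v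
    assume "\<not> eval_triple F v $ i * eval_triple G v $ j = eval_triple F v $ j * eval_triple G v $ i"
    then have "h v \<noteq> 0" by (simp add: h_def)
    moreover have pf: "poly_fun h"
      using form_eval_triple[OF F(1)] form_eval_triple[OF G(1)] unfolding h_def
      by (intro poly_fun_diff poly_fun_mult) (auto simp: form_def)
    ultimately obtain w where "h w * b w \<noteq> 0"
      using poly_fun_nonzero_mult b form_poly_fun by metis
    moreover have "poly_fun (\<lambda>v. h v * b v)" using pf b by (auto simp: form_def)
    ultimately obtain w where w: "w \<noteq> 0" "h w \<noteq> 0" "b w \<noteq> 0"
      using poly_fun_nonzero_point[of "\<lambda>v. h v * b v"] by auto
    have "eval_triple F w \<noteq> 0" "eval_triple G w \<noteq> 0" using w(2) by (auto simp: h_def)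
    moreover have "f (abs_proj_plane w) = g (abs_proj_plane w)" using b w by blast
    ultimately have "parallel (eval_triple F w) (eval_triple G w)"
      by (simp add: F(3) G(3) triple_map_abs[OF F(1) w(1)] triple_map_abs[OF G(1) w(1)] parallel_iff)
    then show False using w(2) by (simp add: h_def parallel_def)
  qed
  then show ?thesis using triple_map_eqI F G by metis
qed

lemma polynomial_triple:
  assumes "\<And>i. form d (\<lambda>v. \<Phi> v $ i)"
  obtains F where "homogeneous3 d F" "eval_triple F = \<Phi>"
proof -
  have "\<forall>i. \<exists>F. homogeneous d F \<and> (\<lambda>v. \<Phi> v $ i) = eval3 F"
    using assms form_obtain_poly by metis
  then obtain F where F: "\<And>i. homogeneous d (F i)" "\<And>i. (\<lambda>v. \<Phi> v $ i) = eval3 (F i)" by metis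
  have "eval3 (F i) v = \<Phi> v $ i" for i v using F(2)[of i] by (metis (full_types))
  then show ?thesis
    using that[of "\<chi> i. F i"] F(1) by (simp add: homogeneous3_def eval_triple_def fun_eq_iff vec_eq_iff)
qed

lemma rational_map_of_forms:
  assumes "\<And>i. form d (\<lambda>v. \<Phi> v $ i)" "\<Phi> w \<noteq> 0"
  obtains f where "rational_map f"
    "\<And>v. v \<noteq> 0 \<Longrightarrow> \<Phi> v \<noteq> 0 \<Longrightarrow> f (abs_proj_plane v) = Some (abs_proj_plane (\<Phi> v))"
proof -
  obtain F where F: "homogeneous3 d F" "eval_triple F = \<Phi>" using polynomial_triple assms(1) .
  then have "\<exists>i. F $ i \<noteq> 0" using assms(2) by (metis eval3_simps(1) eval_triple_eq_0_iff)
  then obtain e c G where G: "homogeneous3 e G" "coprime3 G" "c \<noteq> 0" "\<And>i. F $ i = c * G $ i"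
    using reduce_triple F(1) by metis
  have *: "\<Phi> v = eval3 c v *s eval_triple G v" for v
    unfolding F(2)[symmetric] by (simp add: eval_triple_def G(4) vec_eq_iff)
  have "triple_map G (abs_proj_plane v) = Some (abs_proj_plane (\<Phi> v))" if "v \<noteq> 0" "\<Phi> v \<noteq> 0" for v
    using that triple_map_abs[OF G(1) that(1)] by (auto simp: * abs_scale)
  moreover have "rational_map (triple_map G)" using G by (auto simp: rational_map_iff)
  ultimately show ?thesis using that by blast
qed

lemma generic_forms_nonzero:
  fixes \<Phi> :: "complex ^ 3 \<Rightarrow> complex ^ 3"
  assumes "\<And>i. form d (\<lambda>v. \<Phi> v $ i)" "\<Phi> w \<noteq> 0"
    and "\<And>v. v \<noteq> 0 \<Longrightarrow> \<Phi> v \<noteq> 0 \<Longrightarrow> P (abs_proj_plane v)"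
  shows "generic P"
  using polynomial_triple[of d \<Phi>] assms generic_eval_triple_nonzero by metis

text \<open>
  Substitution of one triple into the other gives a triple for the composite, possibly with a common
  factor. Cancelling the factor can only enlarge the domain of definition.
\<close>

lemma map_comp_extension:
  assumes "rational_map f" "rational_map g" "dom (f \<circ>\<^sub>m g) \<noteq> {}"
  obtains h where "rational_map h" "f \<circ>\<^sub>m g \<subseteq>\<^sub>m h" "generic (\<lambda>p. p \<in> dom (f \<circ>\<^sub>m g))"
proof -
  obtain d F where F: "homogeneous3 d F" "f = triple_map F"
    using rational_map_form[OF assms(1)] by metis
  obtain e G where G: "homogeneous3 e G" "g = triple_map G"
    using rational_map_form[OF assms(2)] by metis
  define \<Phi> where "\<Phi> v = eval_triple F (eval_triple G v)" for v
  have G0: "eval_triple G v \<noteq> 0" if "\<Phi> v \<noteq> 0 \<or> d = 0" "g (abs_proj_plane v) \<noteq> None" "v \<noteq> 0" for v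
    using that triple_map_abs[OF G(1)] by (auto simp: G(2))
  have fg: "(f \<circ>\<^sub>m g) (abs_proj_plane v) = (if eval_triple G v = 0 \<or> \<Phi> v = 0 then None
      else Some (abs_proj_plane (\<Phi> v)))" if "v \<noteq> 0" for v
    using that triple_map_abs[OF G(1) that] triple_map_abs[OF F(1)]
    by (auto simp: map_comp_def G(2) F(2) \<Phi>_def)
  have form: "form (d * e) (\<lambda>v. \<Phi> v $ i)" for i
    unfolding \<Phi>_def
    by (rule form_compose[of d "\<lambda>v. eval_triple F v $ i" e "eval_triple G"])
      (use form_eval_triple F G in auto)
  obtain p where p: "(f \<circ>\<^sub>m g) p \<noteq> None" using assms(3) unfolding dom_def by blast
  obtain w where w: "w \<noteq> 0" "p = abs_proj_plane w" using point_cases .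
  have w': "\<Phi> w \<noteq> 0" "eval_triple G w \<noteq> 0" using p fg[OF w(1)] w(2) by (auto split: if_splits)
  obtain h where h: "rational_map h"
    "\<And>v. v \<noteq> 0 \<Longrightarrow> \<Phi> v \<noteq> 0 \<Longrightarrow> h (abs_proj_plane v) = Some (abs_proj_plane (\<Phi> v))"
    using rational_map_of_forms[OF form w'(1)] by metis
  have "f \<circ>\<^sub>m g \<subseteq>\<^sub>m h"
    unfolding map_le_def
  proof
    fix x assume x: "x \<in> dom (f \<circ>\<^sub>m g)"
    obtain v where v: "v \<noteq> 0" "x = abs_proj_plane v" using point_cases .
    show "(f \<circ>\<^sub>m g) x = h x" using x fg[OF v(1)] h(2)[OF v(1)] v(2) by (auto split: if_splits)
  qed
  moreover have "generic (\<lambda>p. \<Phi> (rep_proj_plane p) \<noteq> 0)"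
    using form w'(1)
  proof (rule generic_forms_nonzero)
    fix v :: "complex ^ 3" assume v: "v \<noteq> 0" "\<Phi> v \<noteq> 0"
    obtain c where c: "c \<noteq> 0" "rep_proj_plane (abs_proj_plane v) = c *s v"
      using rep_abs[OF v(1)] .
    then have "\<Phi> (rep_proj_plane (abs_proj_plane v)) = c ^ (d * e) *s \<Phi> v"
      unfolding c(2) using form by (simp add: vec_eq_iff form_def)
    then show "\<Phi> (rep_proj_plane (abs_proj_plane v)) \<noteq> 0" using v(2) c(1) by (simp add: vector_mul_eq_0)
  qed
  then have "generic (\<lambda>p. (\<exists>q. g p = Some q) \<and> \<Phi> (rep_proj_plane p) \<noteq> 0)"
    by (intro generic_conj generic_rational_map_defined assms)
  then have "generic (\<lambda>p. p \<in> dom (f \<circ>\<^sub>m g))"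
  proof (rule generic_mono)
    fix p assume p: "(\<exists>q. g p = Some q) \<and> \<Phi> (rep_proj_plane p) \<noteq> 0"
    then have "eval_triple G (rep_proj_plane p) \<noteq> 0"
      using triple_map_abs[OF G(1) rep_nonzero, of p] by (auto simp: G(2))
    then show "p \<in> dom (f \<circ>\<^sub>m g)" using fg[OF rep_nonzero, of p] p by auto
  qed
  ultimately show ?thesis using that h(1) by blast
qed

lemma
  assumes "rational_map f" "rational_map g" "dom (f \<circ>\<^sub>m g) \<noteq> {}"
  shows rational_map_rat_comp: "rational_map (rat_comp f g)"
    and rat_comp_extends: "f \<circ>\<^sub>m g \<subseteq>\<^sub>m rat_comp f g"
    and generic_dom_map_comp: "generic (\<lambda>p. p \<in> dom (f \<circ>\<^sub>m g))"
proof -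
  obtain k where k: "rational_map k" "f \<circ>\<^sub>m g \<subseteq>\<^sub>m k" and gen: "generic (\<lambda>p. p \<in> dom (f \<circ>\<^sub>m g))"
    using map_comp_extension[OF assms] .
  have uniq: "h = k" if h: "rational_map h" "f \<circ>\<^sub>m g \<subseteq>\<^sub>m h" for h
  proof (rule rational_map_eqI[OF h(1) k(1)])
    show "generic (\<lambda>p. h p = k p)"
      using gen by (rule generic_mono) (use h k in \<open>auto simp: map_le_def\<close>)
  qed
  have rk: "rat_comp f g = k"
    unfolding rat_comp_def by (rule the_equality) (simp_all add: k uniq)
  show "rational_map (rat_comp f g)" "f \<circ>\<^sub>m g \<subseteq>\<^sub>m rat_comp f g"
    unfolding rk by (rule k)+
  show "generic (\<lambda>p. p \<in> dom (f \<circ>\<^sub>m g))" by (rule gen)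
qed

section \<open>The Cremona group is a group\<close>

lemma rational_map_Some: "rational_map Some"
proof -
  obtain f where f: "rational_map f"
    "\<And>v. v \<noteq> 0 \<Longrightarrow> v \<noteq> 0 \<Longrightarrow> f (abs_proj_plane v) = Some (abs_proj_plane v)"
    by (rule rational_map_of_forms[of 1 "\<lambda>v. v" "axis 1 1"]) (auto simp: form_def axis_eq_0_iff)
  have "f = Some" by (rule ext) (metis f(2) point_cases)
  then show ?thesis using f by simp
qed

definition generic_inverse where
  "generic_inverse f g \<longleftrightarrow> generic (\<lambda>p. \<exists>q. f p = Some q \<and> g q = Some p)"

text \<open>
  If the composite of two rational maps is the identity at generic points, then the rational map that
  extends it is the identity, so the composite is the identity wherever it is defined.
\<close>

lemma birational_iff:
  "birational f \<longleftrightarrow> rational_map f \<and>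
     (\<exists>g. rational_map g \<and> generic_inverse f g \<and> generic_inverse g f)"
proof -
  have 1: "generic_inverse f g"
    if "rational_map f" "rational_map g" "dom (g \<circ>\<^sub>m f) \<noteq> {}" "(g \<circ>\<^sub>m f) \<subseteq>\<^sub>m Some" for f g
    using generic_dom_map_comp[OF that(2,1,3)] unfolding generic_inverse_def
    by (rule generic_mono) (use that(4) in \<open>auto simp: map_le_def map_comp_def split: option.splits\<close>)
  have 2: "dom (g \<circ>\<^sub>m f) \<noteq> {} \<and> (g \<circ>\<^sub>m f) \<subseteq>\<^sub>m Some"
    if fg: "rational_map f" "rational_map g" "generic_inverse f g" for f g
  proof -
    obtain p q where "f p = Some q" "g q = Some p"
      using generic_ex[OF fg(3)[unfolded generic_inverse_def]] by blast
    then have "(g \<circ>\<^sub>m f) p = Some p" by (simp add: map_comp_def)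
    then have ne: "dom (g \<circ>\<^sub>m f) \<noteq> {}" by blast
    obtain h where h: "rational_map h" "g \<circ>\<^sub>m f \<subseteq>\<^sub>m h"
      using map_comp_extension[OF fg(2,1) ne] by metis
    have "generic (\<lambda>p. h p = Some p)"
      using fg(3) unfolding generic_inverse_def
      by (rule generic_mono) (use h(2) in \<open>force simp: map_le_def dom_def map_comp_def\<close>)
    then have "h = Some" using rational_map_eqI[OF h(1) rational_map_Some] by simp
    then show ?thesis using ne h by simp
  qed
  show ?thesis unfolding birational_def using 1 2 by metis
qed

lemma birational_rational: "birational f \<Longrightarrow> rational_map f"
  by (simp add: birational_def)

lemma birationalI:
  "rational_map f \<Longrightarrow> rational_map g \<Longrightarrow> generic_inverse f g \<Longrightarrow> generic_inverse g f \<Longrightarrow> birational f"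
  by (auto simp: birational_iff)

text \<open>
  Birational maps are dominant: a nonzero form does not become zero after substitution, since the
  image of a birational map contains generic points.
\<close>

lemma generic_pullback:
  assumes "birational f" "generic P"
  shows "generic (\<lambda>p. \<exists>q. f p = Some q \<and> P q)"
proof -
  obtain d F where F: "homogeneous3 d F" "f = triple_map F"
    using rational_map_form[OF birational_rational[OF assms(1)]] by metis
  obtain e b w where b: "form e b" "b w \<noteq> 0"
    "\<And>v. v \<noteq> 0 \<Longrightarrow> b v \<noteq> 0 \<Longrightarrow> P (abs_proj_plane v)"
    using assms(2) unfolding generic_def by metis
  obtain g where g: "generic_inverse g f" using assms(1) birational_iff by metis
  have "generic (\<lambda>q. \<exists>v. v \<noteq> 0 \<and> q = abs_proj_plane v \<and> b v \<noteq> 0)"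
    by (rule genericI[OF b(1,2)]) auto
  from generic_conj[OF this g[unfolded generic_inverse_def]]
  obtain p q v where pq: "f p = Some q" "v \<noteq> 0" "q = abs_proj_plane v" "b v \<noteq> 0"
    by (rule generic_ex) blast
  obtain x where x: "x \<noteq> 0" "p = abs_proj_plane x" using point_cases .
  have Fx: "eval_triple F x \<noteq> 0" "abs_proj_plane (eval_triple F x) = abs_proj_plane v"
    using pq(1,3) triple_map_abs[OF F(1) x(1)] F(2) x(2) by (auto split: if_splits)
  then obtain c where "c \<noteq> 0" "v = c *s eval_triple F x" using abs_eq_iff[OF Fx(1) pq(2)] by auto
  then have bF: "b (eval_triple F x) \<noteq> 0" using pq(4) b(1) by (auto simp: form_scale)
  have "generic (\<lambda>p. \<exists>v. v \<noteq> 0 \<and> p = abs_proj_plane v \<and> b (eval_triple F v) \<noteq> 0)"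
    by (rule genericI[OF form_compose[OF b(1) form_eval_triple[OF F(1)]] bF]) auto
  then have "generic (\<lambda>p. (\<exists>q. f p = Some q) \<and> (\<exists>v. v \<noteq> 0 \<and> p = abs_proj_plane v \<and> b (eval_triple F v) \<noteq> 0))"
    by (intro generic_conj generic_rational_map_defined birational_rational assms)
  then show ?thesis
  proof (rule generic_mono)
    fix p assume "(\<exists>q. f p = Some q) \<and> (\<exists>v. v \<noteq> 0 \<and> p = abs_proj_plane v \<and> b (eval_triple F v) \<noteq> 0)"
    then obtain q v where v: "f p = Some q" "v \<noteq> 0" "p = abs_proj_plane v" "b (eval_triple F v) \<noteq> 0" by blast
    then have "eval_triple F v \<noteq> 0" "q = abs_proj_plane (eval_triple F v)"
      using triple_map_abs[OF F(1) v(2)] F(2) by (auto split: if_splits)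
    then show "\<exists>q. f p = Some q \<and> P q" using v b(3) by blast
  qed
qed

lemma
  assumes "birational f" "birational g"
  shows rational_map_rat_comp_birational: "rational_map (rat_comp f g)"
    and rat_comp_Some: "g p = Some q \<Longrightarrow> f q = Some r \<Longrightarrow> rat_comp f g p = Some r"
    and generic_rat_comp: "generic (\<lambda>p. \<exists>q r. g p = Some q \<and> f q = Some r \<and> rat_comp f g p = Some r)"
proof -
  note r = assms[THEN birational_rational]
  have gen: "generic (\<lambda>p. \<exists>q. g p = Some q \<and> (\<exists>r. f q = Some r))"
    by (rule generic_pullback[OF assms(2) generic_rational_map_defined[OF r(1)]])
  then obtain p q r where "g p = Some q" "f q = Some r" by (rule generic_ex) blast
  then have "(f \<circ>\<^sub>m g) p = Some r" by (simp add: map_comp_def)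
  then have ne: "dom (f \<circ>\<^sub>m g) \<noteq> {}" by blast
  show "rational_map (rat_comp f g)" by (rule rational_map_rat_comp[OF r ne])
  have *: "rat_comp f g p = Some r" if "g p = Some q" "f q = Some r" for p q r
  proof -
    have "(f \<circ>\<^sub>m g) p = Some r" using that by (simp add: map_comp_def)
    then show ?thesis using rat_comp_extends[OF r ne] by (metis domI map_le_def)
  qed
  then show "g p = Some q \<Longrightarrow> f q = Some r \<Longrightarrow> rat_comp f g p = Some r" for p q r .
  show "generic (\<lambda>p. \<exists>q r. g p = Some q \<and> f q = Some r \<and> rat_comp f g p = Some r)"
    using gen by (rule generic_mono) (use * in blast)
qed

lemma generic_inverse_rat_comp:
  assumes "birational f" "birational g" "birational f'" "birational g'"
    "generic_inverse f f'" "generic_inverse g g'"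
  shows "generic_inverse (rat_comp f g) (rat_comp g' f')"
proof -
  have "generic (\<lambda>p. \<exists>q. g p = Some q \<and> (\<exists>r. f q = Some r \<and> f' r = Some q))"
    using generic_pullback[OF assms(2) assms(5)[unfolded generic_inverse_def]] .
  from generic_conj[OF assms(6)[unfolded generic_inverse_def] this] show ?thesis
    unfolding generic_inverse_def
  proof (rule generic_mono)
    fix p assume "(\<exists>q. g p = Some q \<and> g' q = Some p) \<and> (\<exists>q. g p = Some q \<and> (\<exists>r. f q = Some r \<and> f' r = Some q))"
    then obtain q r where "g p = Some q" "g' q = Some p" "f q = Some r" "f' r = Some q" by auto
    then show "\<exists>q. rat_comp f g p = Some q \<and> rat_comp g' f' q = Some p"
      using rat_comp_Some[OF assms(1,2)] rat_comp_Some[OF assms(4,3)] by metis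
  qed
qed

lemma birational_inverse:
  assumes "birational f"
  obtains g where "birational g" "generic_inverse f g" "generic_inverse g f"
  using assms birational_iff birationalI by metis

lemma birational_rat_comp:
  assumes "birational f" "birational g"
  shows "birational (rat_comp f g)"
proof -
  obtain f' where f': "birational f'" "generic_inverse f f'" "generic_inverse f' f"
    using birational_inverse[OF assms(1)] .
  obtain g' where g': "birational g'" "generic_inverse g g'" "generic_inverse g' g"
    using birational_inverse[OF assms(2)] .
  show ?thesis
    using rational_map_rat_comp_birational generic_inverse_rat_comp assms f' g' by (intro birationalI) metis+
qed

lemma birational_Some: "birational Some"
proof (rule birationalI[OF rational_map_Some rational_map_Some])
  show "generic_inverse Some Some" "generic_inverse Some Some"
    unfolding generic_inverse_def by (rule genericI[OF form_one[of 1]]; simp)+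
qed

lemma Cremona_simps [simp]:
  "f \<in> carrier Cremona \<longleftrightarrow> birational f" "mult Cremona = rat_comp" "one Cremona = Some"
  by (simp_all add: Cremona_def)

lemma group_Cremona: "group Cremona"
proof (rule groupI)
  fix f g h
  assume a: "f \<in> carrier Cremona" "g \<in> carrier Cremona" "h \<in> carrier Cremona"
  then have b: "birational f" "birational g" "birational h" by auto
  note fg = birational_rat_comp[OF b(1,2)] and gh = birational_rat_comp[OF b(2,3)]
  have "generic (\<lambda>p. \<exists>q. h p = Some q \<and> (\<exists>r s. g q = Some r \<and> f r = Some s \<and> rat_comp f g q = Some s))"
    by (rule generic_pullback[OF b(3) generic_rat_comp[OF b(1,2)]])
  then have "generic (\<lambda>p. rat_comp (rat_comp f g) h p = rat_comp f (rat_comp g h) p)"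
  proof (rule generic_mono)
    fix p assume "\<exists>q. h p = Some q \<and> (\<exists>r s. g q = Some r \<and> f r = Some s \<and> rat_comp f g q = Some s)"
    then obtain q r s where "h p = Some q" "g q = Some r" "f r = Some s" "rat_comp f g q = Some s" by blast
    then have "rat_comp (rat_comp f g) h p = Some s" "rat_comp f (rat_comp g h) p = Some s"
      using rat_comp_Some b fg gh by metis+
    then show "rat_comp (rat_comp f g) h p = rat_comp f (rat_comp g h) p" by simp
  qed
  then have "rat_comp (rat_comp f g) h = rat_comp f (rat_comp g h)"
    using rational_map_eqI rational_map_rat_comp_birational b fg gh by metis
  then show "f \<otimes>\<^bsub>Cremona\<^esub> g \<otimes>\<^bsub>Cremona\<^esub> h = f \<otimes>\<^bsub>Cremona\<^esub> (g \<otimes>\<^bsub>Cremona\<^esub> h)" by simp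
next
  fix f assume "f \<in> carrier Cremona"
  then have f: "birational f" by simp
  have "generic (\<lambda>p. rat_comp Some f p = f p)"
    using generic_rational_map_defined[OF birational_rational[OF f]]
    by (rule generic_mono) (use rat_comp_Some[OF birational_Some f] in force)
  then show "\<one>\<^bsub>Cremona\<^esub> \<otimes>\<^bsub>Cremona\<^esub> f = f"
    using rational_map_eqI rational_map_rat_comp_birational[OF birational_Some f] birational_rational[OF f] by simp
  obtain g where g: "birational g" "generic_inverse f g" using birational_inverse[OF f] by metis
  have "generic (\<lambda>p. rat_comp g f p = Some p)"
    using g(2) unfolding generic_inverse_def
    by (rule generic_mono) (use rat_comp_Some[OF g(1) f] in blast)
  then have "rat_comp g f = Some"
    using rational_map_eqI rational_map_rat_comp_birational[OF g(1) f] rational_map_Some by simp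
  then show "\<exists>g\<in>carrier Cremona. g \<otimes>\<^bsub>Cremona\<^esub> f = \<one>\<^bsub>Cremona\<^esub>" using g by auto
qed (auto intro: birational_rat_comp birational_Some)

lemma generic_inverse_inv:
  assumes "birational f"
  shows "generic_inverse f (inv\<^bsub>Cremona\<^esub> f)"
proof -
  interpret group Cremona by (rule group_Cremona)
  let ?g = "inv\<^bsub>Cremona\<^esub> f"
  have g: "birational ?g" using inv_closed[of f] assms by simp
  have "rat_comp ?g f = Some" using l_inv[of f] assms by simp
  with generic_rat_comp[OF g assms] show ?thesis
    unfolding generic_inverse_def by (auto elim!: generic_mono)
qed

section \<open>Common zeros of forms\<close>

text \<open>
  Without a zero the restriction to the line through \<open>w\<close> with direction \<open>x\<close> would be constant by the
  fundamental theorem of algebra. Seen from \<open>x\<close>, the form would restrict to the monomial \<open>f w t\<^sup>d\<close> and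
  vanish at \<open>x\<close>, the point at infinity of the line.
\<close>

lemma form_has_zero_on_line:
  assumes f: "form d f" "d > 0" and o: "f x \<noteq> 0"
  shows "\<exists>t. f (w + t *s x) = 0"
proof (rule ccontr)
  assume no: "\<nexists>t. f (w + t *s x) = 0"
  obtain p where p: "\<forall>t. poly p t = f (w + t *s x)" using poly_fun_line f form_poly_fun by metis
  have "constant (poly p)" using fundamental_theorem_of_algebra[of p] no p by auto
  then have c: "f (w + t *s x) = f w" for t
    using p unfolding constant_def by (metis add_0_right vector_smult_lzero)
  obtain q where q: "\<forall>t. poly q t = f (x + t *s w)" using poly_fun_line f form_poly_fun by metis
  have "poly q t = poly (monom (f w) d) t" if "t \<noteq> 0" for t
  proof -
    have "x + t *s w = t *s (w + inverse t *s x)" using that by (simp add: vec_eq_iff field_simps)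
    then have "f (x + t *s w) = t ^ d * f w" using form_scale[OF f(1)] c by metis
    then show ?thesis using q by (simp add: poly_monom)
  qed
  then have "UNIV - {0} \<subseteq> {t. poly (q - monom (f w) d) t = 0}" by auto
  moreover have "infinite (UNIV - {0::complex})" by (simp add: infinite_UNIV_char_0)
  ultimately have "q - monom (f w) d = 0" using poly_roots_finite finite_subset by metis
  then have "poly q 0 = poly (monom (f w) d) 0" by simp
  then show False using q o f(2) by (simp add: poly_monom power_0_left)
qed

lemma homogeneous_0_is_unit:
  assumes "homogeneous 0 F" "F \<noteq> 0"
  shows "is_unit F"
proof -
  have "eval3 F v = eval3 F 0" for v
    using assms(1) form_scale[of 0 "eval3 F" 0 v] by (simp add: homogeneous_iff_form)
  then have "eval3 F = eval3 [:[:[:eval3 F 0:]:]:]" by auto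
  then have F: "F = [:[:[:eval3 F 0:]:]:]" by (simp only: eval3_inject)
  then have nz: "eval3 F 0 \<noteq> 0" using assms(2) by auto
  have "eval3 1 = eval3 (F * [:[:[:inverse (eval3 F 0):]:]:])"
    by (subst F) (rule ext, simp only: eval3_simps right_inverse[OF nz])
  then have "1 = F * [:[:[:inverse (eval3 F 0):]:]:]" by (simp only: eval3_inject)
  then show ?thesis by (rule dvdI)
qed

lemma homogeneous_unit_degree:
  assumes "homogeneous d F" "is_unit F"
  shows "d = 0"
proof -
  obtain K where K: "1 = F * K" using assms(2) by (auto elim: dvdE)
  have one: "homogeneous 0 (1::poly3)" using form_one[of 1] by (simp add: homogeneous_iff_form form_def)
  have "K dvd 1" using K by (metis dvd_triv_right)
  then obtain e where "homogeneous e K" using homogeneous_divisor[OF one one_neq_zero] by blast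
  then have "homogeneous (d + e) (1::poly3)" using homogeneous_mult assms(1) K by metis
  then show ?thesis using homogeneous_degree_unique[OF one _ one_neq_zero] by force
qed

text \<open>
  A combination of \<open>P\<close> and \<open>G\<close> of least degree divides multiples of both by nonzero
  constants; unless it is itself constant, the prime \<open>P\<close> divides it and hence \<open>G\<close>.
\<close>

lemma eliminate_variable:
  fixes P G :: "poly3"
  assumes P: "prime_elem P" "degree P > 0" and ndvd: "\<not> P dvd G"
  shows "\<exists>A B R. R \<noteq> 0 \<and> A * P + B * G = [:R:]"
proof -
  define S where "S = {H. H \<noteq> 0 \<and> (\<exists>A B. H = A * P + B * G)}"
  have "P = 1 * P + 0 * G" by simp
  then have "P \<in> S" using P(2) unfolding S_def by fastforce
  then obtain H where H: "H \<in> S" "\<And>K. K \<in> S \<Longrightarrow> degree H \<le> degree K"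
    using ex_has_least_nat[of "\<lambda>H. H \<in> S" P degree] by blast
  obtain A B where AB: "H = A * P + B * G" and H0: "H \<noteq> 0" using H(1) by (auto simp: S_def)
  have divides: "\<exists>a q. a \<noteq> 0 \<and> smult a K = H * q" if K: "K = A' * P + B' * G" for K A' B'
  proof -
    obtain a q where aq: "a \<noteq> 0" "smult a K = H * q + pseudo_mod K H"
      using pseudo_mod(1)[OF H0, of K] by blast
    have "pseudo_mod K H = smult a K - H * q" using aq by simp
    also have "\<dots> = (smult a A' - A * q) * P + (smult a B' - B * q) * G"
      by (simp add: K AB algebra_simps smult_add_right)
    finally have "pseudo_mod K H = 0"
      using H(2)[of "pseudo_mod K H"] pseudo_mod(2)[OF H0, of K] unfolding S_def
      by (metis (mono_tags, lifting) mem_Collect_eq not_le)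
    then show ?thesis using aq by auto
  qed
  obtain a q where aq: "a \<noteq> 0" "smult a P = H * q" using divides[of P 1 0] by auto
  obtain b r where br: "b \<noteq> 0" "smult b G = H * r" using divides[of G 0 1] by auto
  have "degree H = 0"
  proof (rule ccontr)
    assume pos: "degree H \<noteq> 0"
    have "P dvd H * q" by (metis aq(2) dvd_refl dvd_smult)
    then consider "P dvd H" | "P dvd q" using P(1) by (auto simp: prime_elem_dvd_mult_iff)
    then show False
    proof cases
      case 1
      have "smult b G = [:b:] * G" by simp
      then have "P dvd [:b:] * G" using br(2) 1 by (metis dvd_mult2)
      then have "P dvd [:b:]" using prime_elem_dvd_multD[OF P(1)] ndvd by blast
      then have "degree P \<le> degree [:b:]" using br(1) by (intro dvd_imp_degree_le) auto
      then show False using P(2) by simp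
    next
      case 2
      then obtain q' where "q = P * q'" by (elim dvdE)
      then have "P * [:a:] = P * (H * q')" using aq(2) by (simp add: mult_ac)
      then have "[:a:] = H * q'" using P(1) by (subst (asm) mult_cancel_left) auto
      moreover from this have "H \<noteq> 0" "q' \<noteq> 0" using aq(1) by auto
      ultimately have "degree [:a:] = degree H + degree q'" by (metis degree_mult_eq)
      then show False using pos by simp
    qed
  qed
  then obtain R where "H = [:R:]" using degree_0_id by metis
  then show ?thesis using AB H0 by (metis pCons_0_0)
qed

abbreviation e1 :: "complex ^ 3" where "e1 \<equiv> axis 1 1"
abbreviation e2 :: "complex ^ 3" where "e2 \<equiv> axis 2 1"
abbreviation e3 :: "complex ^ 3" where "e3 \<equiv> axis 3 1"

text \<open>
  If \<open>P\<close> is nonzero at \<open>e1\<close>, then projection from \<open>e1\<close> is finite-to-one on the zeros of \<open>P\<close>. Eliminating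
  the first variable yields a nonzero polynomial in the other two, which vanishes at the projections of
  all common zeros and all their multiples; this leaves finitely many directions.
\<close>

lemma finite_common_zeros_monic:
  fixes P G :: "poly3"
  assumes P: "homogeneous d P" "prime_elem P" "eval3 P e1 \<noteq> 0" and G: "homogeneous e G" "\<not> P dvd G"
  shows "finite {p. vanishes P p \<and> vanishes G p}"
proof -
  note fP = P(1)[unfolded homogeneous_iff_form]
  have "d > 0" using homogeneous_0_is_unit P(1,2) by (metis gr0I prime_elem_def)
  then have P0: "eval3 P 0 = 0" using form_scale[OF fP, of 0 0] by (simp add: power_0_left)
  have "degree P > 0"
  proof (rule ccontr)
    assume "\<not> degree P > 0"
    then obtain c where "P = [:c:]" using degree_0_id by (metis gr0I)
    then have "eval3 P e1 = eval3 P 0" by (simp add: eval3_def axis_def)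
    then show False using P0 P(3) by simp
  qed
  then obtain A B R where R: "R \<noteq> 0" "A * P + B * G = [:R:]"
    using eliminate_variable[OF P(2) _ G(2)] by blast
  define r where "r v = eval3 [:R:] v" for v
  have r: "r v = eval3 A v * eval3 P v + eval3 B v * eval3 G v" for v
    unfolding r_def R(2)[symmetric] by simp
  have r_indep: "r v = r w" if "v $ 2 = w $ 2" "v $ 3 = w $ 3" for v w
    using that by (simp add: r_def eval3_def)
  define T where "T = {\<tau>. \<forall>s. r (s *s (\<tau> *s e2 + e3)) = 0}"
  have "finite T"
  proof -
    have "\<exists>v. r v * v $ 3 \<noteq> 0"
    proof (rule poly_fun_nonzero_mult)
      show "\<exists>v. r v \<noteq> 0" unfolding r_def using R(1) by (intro eval3_nonzero) simp
      show "\<exists>v::complex ^ 3. v $ 3 \<noteq> 0" by (rule exI[of _ e3]) simp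
    qed (simp_all add: r_def[abs_def])
    then obtain v where v: "r v \<noteq> 0" "v $ 3 \<noteq> 0" by auto
    have fin: "finite {t. r (v + t *s e2) = 0}"
      by (rule poly_fun_line_finite[of _ _ 0]) (use v in \<open>simp_all add: r_def[abs_def]\<close>)
    have "T \<subseteq> (\<lambda>t. (t + v $ 2) / v $ 3) ` {t. r (v + t *s e2) = 0}"
    proof
      fix \<tau> assume \<tau>: "\<tau> \<in> T"
      have "r (v + (v $ 3 * \<tau> - v $ 2) *s e2) = r (v $ 3 *s (\<tau> *s e2 + e3))"
        by (rule r_indep) (simp_all add: axis_def)
      then show "\<tau> \<in> (\<lambda>t. (t + v $ 2) / v $ 3) ` {t. r (v + t *s e2) = 0}"
        using \<tau> v(2) by (intro image_eqI[of _ _ "v $ 3 * \<tau> - v $ 2"]) (auto simp: T_def)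
    qed
    then show ?thesis using fin finite_surj by blast
  qed
  define W where "W = insert e2 ((\<lambda>\<tau>. \<tau> *s e2 + e3) ` T)"
  have fin: "finite {t. eval3 P (e1 + t *s w) = 0}" for w
    by (rule poly_fun_line_finite[of _ _ 0]) (use P in simp_all)
  define Z where "Z = (\<Union>w\<in>W. insert (abs_proj_plane w)
     ((\<lambda>t. abs_proj_plane (e1 + t *s w)) ` {t. eval3 P (e1 + t *s w) = 0}))"
  have "finite W" using \<open>finite T\<close> by (simp add: W_def)
  then have "finite Z" using fin unfolding Z_def by blast
  moreover have "{p. vanishes P p \<and> vanishes G p} \<subseteq> Z"
  proof
    fix p assume p: "p \<in> {p. vanishes P p \<and> vanishes G p}"
    define v where "v = rep_proj_plane p"
    have v: "eval3 P v = 0" "eval3 G v = 0" "v \<noteq> 0" "p = abs_proj_plane v"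
      using p by (auto simp: v_def vanishes_def)
    have rv: "r (s *s v) = 0" for s
      using fP G(1)[unfolded homogeneous_iff_form] v by (simp add: r form_scale)
    have "\<exists>w\<in>W. \<exists>b. b \<noteq> 0 \<and> v = v $ 1 *s e1 + b *s w"
    proof (cases "v $ 3 = 0")
      case False
      have "v $ 2 / v $ 3 \<in> T"
        unfolding T_def
      proof (intro CollectI allI)
        fix s
        have "r (s *s ((v $ 2 / v $ 3) *s e2 + e3)) = r ((s / v $ 3) *s v)"
          using False by (intro r_indep) (simp_all add: axis_def)
        then show "r (s *s ((v $ 2 / v $ 3) *s e2 + e3)) = 0" by (simp add: rv)
      qed
      moreover have "v = v $ 1 *s e1 + v $ 3 *s ((v $ 2 / v $ 3) *s e2 + e3)"
        using False by (simp add: vec_eq_iff forall_3 axis_def)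
      ultimately show ?thesis using False unfolding W_def by blast
    next
      case True
      then have *: "v = v $ 1 *s e1 + v $ 2 *s e2" by (simp add: vec_eq_iff forall_3 axis_def)
      have "v $ 2 \<noteq> 0"
      proof
        assume "v $ 2 = 0"
        then have "v = v $ 1 *s e1" using * by simp
        then have "eval3 P v = v $ 1 ^ d * eval3 P e1" using form_scale[OF fP] by metis
        moreover have "v $ 1 \<noteq> 0" using \<open>v = v $ 1 *s e1\<close> v(3) by auto
        ultimately show False using v(1) P(3) by simp
      qed
      then show ?thesis using * unfolding W_def by blast
    qed
    then obtain w b where w: "w \<in> W" "b \<noteq> 0" "v = v $ 1 *s e1 + b *s w" by blast
    show "p \<in> Z"
    proof (cases "v $ 1 = 0")
      case True
      then have vb: "v = b *s w" using w(3) by simp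
      then have "w \<noteq> 0" using v(3) by auto
      then have "p = abs_proj_plane w" using v(4) w(2) vb by (simp add: abs_scale)
      then show ?thesis using w(1) by (auto simp: Z_def)
    next
      case False
      have vs: "v = v $ 1 *s (e1 + (b / v $ 1) *s w)"
        by (subst w(3)) (use False in \<open>simp add: vec_eq_iff field_simps\<close>)
      then have "eval3 P v = v $ 1 ^ d * eval3 P (e1 + (b / v $ 1) *s w)" using form_scale[OF fP] by metis
      then have "eval3 P (e1 + (b / v $ 1) *s w) = 0" using v(1) False by simp
      moreover have "e1 + (b / v $ 1) *s w \<noteq> 0" using vs v(3) by (metis vector_smult_rzero)
      then have "p = abs_proj_plane (e1 + (b / v $ 1) *s w)"
        using v(4) vs False by (metis abs_scale)
      ultimately show ?thesis using w(1) by (auto simp: Z_def)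
    qed
  qed
  ultimately show ?thesis using finite_subset by blast
qed

lemma coordinate_change:
  fixes x :: "complex ^ 3"
  assumes "x \<noteq> 0"
  obtains A B :: "complex ^ 3 \<Rightarrow> complex ^ 3" where
    "\<And>i. form 1 (\<lambda>v. A v $ i)" "\<And>i. form 1 (\<lambda>v. B v $ i)"
    "\<And>v. A (B v) = v" "\<And>v. B (A v) = v" "A e1 = x"
proof -
  obtain j where j: "x $ j \<noteq> 0" using assms by (auto simp: vec_eq_iff)
  define \<sigma> where "\<sigma> i = (if i = j then 1 else if i = 1 then j else i)" for i
  have \<sigma>: "\<sigma> i \<noteq> 1 \<and> \<sigma> (\<sigma> i) = i" if "i \<noteq> j" for i using that by (auto simp: \<sigma>_def)
  have \<sigma>': "\<sigma> i \<noteq> j \<and> \<sigma> (\<sigma> i) = i" if "i \<noteq> 1" for i using that by (auto simp: \<sigma>_def)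
  define A :: "complex ^ 3 \<Rightarrow> complex ^ 3" where
    "A v = (\<chi> i. v $ 1 * x $ i + (if i = j then 0 else v $ \<sigma> i))" for v
  define B :: "complex ^ 3 \<Rightarrow> complex ^ 3" where
    "B w = (\<chi> k. if k = 1 then w $ j / x $ j else w $ \<sigma> k - x $ \<sigma> k * (w $ j / x $ j))" for w
  show ?thesis
  proof
    fix i
    have "poly_fun (\<lambda>v. A v $ i)" unfolding A_def by (cases "i = j") (auto intro!: poly_fun_add poly_fun_mult)
    then show "form 1 (\<lambda>v. A v $ i)" by (simp add: form_def) (simp add: A_def algebra_simps)
    have "poly_fun (\<lambda>v. v $ \<sigma> i - x $ \<sigma> i * (v $ j * inverse (x $ j)))"
      "poly_fun (\<lambda>v. v $ j * inverse (x $ j))" for i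
      by (intro poly_fun_diff poly_fun_mult poly_fun_const poly_fun_coord)+
    then have "poly_fun (\<lambda>v. B v $ i)" unfolding B_def by (cases "i = 1") (auto simp: divide_inverse)
    then show "form 1 (\<lambda>v. B v $ i)" by (simp add: form_def) (simp add: B_def algebra_simps)
  next
    fix v
    show "A (B v) = v" using j \<sigma> by (auto simp: A_def B_def vec_eq_iff)
    show "B (A v) = v" using j \<sigma>' by (auto simp: A_def B_def vec_eq_iff)
  next
    show "A e1 = x" using \<sigma> by (auto simp: A_def vec_eq_iff axis_def)
  qed
qed

lemma poly_fun_of_forms: "(\<And>i. form d (\<lambda>v. A v $ i)) \<Longrightarrow> poly_fun f \<Longrightarrow> poly_fun (\<lambda>v. f (A v))"
  for A :: "complex ^ 3 \<Rightarrow> complex ^ 3"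
  using poly_fun_compose[of f A] form_poly_fun by blast

text \<open>
  A linear change of coordinates makes the form monic in the first variable and preserves both
  irreducibility and divisibility.
\<close>

lemma finite_common_zeros:
  fixes P G :: "poly3"
  assumes P: "homogeneous d P" "irreducible P" and G: "homogeneous e G" "\<not> P dvd G"
  shows "finite {p. vanishes P p \<and> vanishes G p}"
proof -
  have "P \<noteq> 0" using P(2) by auto
  then obtain x where x: "x \<noteq> 0" "eval3 P x \<noteq> 0"
    using eval3_nonzero poly_fun_nonzero_point poly_fun_eval3(1) by metis
  obtain A B where A: "\<And>i. form 1 (\<lambda>v. A v $ i)" "\<And>i. form 1 (\<lambda>v. B v $ i)"
    "\<And>v. A (B v) = v" "\<And>v. B (A v) = v" "A e1 = x"
    using coordinate_change[OF x(1)] by blast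
  have A_scale: "A (s *s v) = s *s A v" for s v using A(1) by (simp add: form_def vec_eq_iff)
  have subst: "\<exists>Q. \<forall>v. eval3 Q v = eval3 K (A v)" "\<exists>Q. \<forall>v. eval3 Q v = eval3 K (B v)" for K
    using poly_fun_of_forms[OF A(1), of "eval3 K"] poly_fun_of_forms[OF A(2), of "eval3 K"]
    unfolding poly_fun_def fun_eq_iff by metis+
  obtain P' where P': "\<And>v. eval3 P' v = eval3 P (A v)" using subst by metis
  obtain G' where G': "\<And>v. eval3 G' v = eval3 G (A v)" using subst by metis
  have hom: "homogeneous d P'" "homogeneous e G'"
    using P(1) G(1) by (simp_all add: homogeneous_iff_form form_def P' G' A_scale)
  have eqI: "K = L" if "\<And>v. eval3 K v = eval3 L v" for K L
    using that eval3_inject by (metis ext)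
  have unit: "is_unit K" if K: "is_unit L" "\<And>v. eval3 L v = eval3 K (B v)" for K L
  proof -
    obtain M where M: "1 = L * M" using K(1) by (elim dvdE)
    obtain M' where M': "\<And>v. eval3 M' v = eval3 M (A v)" using subst by metis
    have "1 = K * M'"
    proof (rule eqI)
      fix v
      have "eval3 1 (A v) = eval3 L (A v) * eval3 M (A v)" using M by (metis eval3_simps(6))
      then show "eval3 1 v = eval3 (K * M') v" by (simp add: K(2) A(4) M')
    qed
    then show ?thesis by (rule dvdI)
  qed
  have "irreducible P'"
  proof (rule irreducibleI)
    show "P' \<noteq> 0" using x(2) A(5) P'[of e1] by auto
    show "\<not> is_unit P'"
    proof
      assume "is_unit P'"
      then have "d = 0" using homogeneous_unit_degree hom(1) by blast
      then show False using P homogeneous_0_is_unit \<open>P \<noteq> 0\<close> by (auto simp: irreducible_def)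
    qed
    fix a b assume ab: "P' = a * b"
    obtain a' where a': "\<And>v. eval3 a' v = eval3 a (B v)" using subst by metis
    obtain b' where b': "\<And>v. eval3 b' v = eval3 b (B v)" using subst by metis
    have "P = a' * b'"
      by (rule eqI) (metis P' a' ab b' A(3) eval3_simps(6))
    then have "is_unit a' \<or> is_unit b'" using P(2) by (simp add: irreducible_def)
    then show "is_unit a \<or> is_unit b" using unit a' b' by blast
  qed
  moreover have "\<not> P' dvd G'"
  proof
    assume "P' dvd G'"
    then obtain K where K: "G' = P' * K" by (elim dvdE)
    obtain K' where K': "\<And>v. eval3 K' v = eval3 K (B v)" using subst by metis
    have "G = P * K'"
      by (rule eqI) (metis P' G' K K' A(3) eval3_simps(6))
    then show False using G(2) by simp
  qed
  moreover have "eval3 P' e1 \<noteq> 0" using P' A(5) x by simp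
  ultimately have fin: "finite {p. vanishes P' p \<and> vanishes G' p}"
    using finite_common_zeros_monic[OF hom(1) _ _ hom(2)] irreducible_imp_prime_elem by blast
  have "{p. vanishes P p \<and> vanishes G p}
     \<subseteq> (\<lambda>p. abs_proj_plane (A (rep_proj_plane p))) ` {p. vanishes P' p \<and> vanishes G' p}"
  proof
    fix p assume p: "p \<in> {p. vanishes P p \<and> vanishes G p}"
    obtain v where v: "v \<noteq> 0" "p = abs_proj_plane v" using point_cases .
    have Bv: "B v \<noteq> 0" using A(3)[of v] v(1) A_scale[of 0 0] by auto
    obtain c where c: "c \<noteq> 0" "rep_proj_plane (abs_proj_plane (B v)) = c *s B v" using rep_abs[OF Bv] .
    have "p = abs_proj_plane (A (rep_proj_plane (abs_proj_plane (B v))))"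
      using v c by (simp add: A_scale A(3) abs_scale)
    moreover have "vanishes P' (abs_proj_plane (B v))" "vanishes G' (abs_proj_plane (B v))"
      using p v vanishes_abs[OF hom(1) Bv] vanishes_abs[OF hom(2) Bv]
        vanishes_abs[OF P(1) v(1)] vanishes_abs[OF G(1) v(1)] by (simp_all add: P' G' A(3))
    ultimately show "p \<in> (\<lambda>p. abs_proj_plane (A (rep_proj_plane p))) ` {p. vanishes P' p \<and> vanishes G' p}"
      by blast
  qed
  then show ?thesis using fin finite_surj by blast
qed

text \<open>
  Each prime factor of a component fails to divide some other component, with which it has only
  finitely many common zeros.
\<close>

lemma finite_base_points:
  assumes F: "homogeneous3 d F" "coprime3 F"
  shows "finite {p. triple_map F p = None}"
proof -
  have eq: "{p. triple_map F p = None} = {p. \<forall>i. vanishes (F $ i) p}"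
    by (auto simp: triple_map_def Let_def eval_triple_eq_0_iff vanishes_def split: if_splits)
  have "finite {p. vanishes H p \<and> (\<forall>i. vanishes (F $ i) p)}" if "homogeneous k H" "H \<noteq> 0" for H k
    using that
  proof (induction H arbitrary: k rule: prime_divisors_induct)
    case (unit x)
    then obtain y where y: "1 = x * y" by (elim dvdE)
    have "eval3 x v \<noteq> 0" for v
      using y by (metis eval3_simps(2,6) mult_zero_left zero_neq_one)
    then show ?case by (simp add: vanishes_def)
  next
    case (factor p x)
    obtain k1 k2 where k: "homogeneous k1 p" "homogeneous k2 x"
      using homogeneous_divisor[OF factor.prems] by (meson dvd_triv_left dvd_triv_right)
    have irr: "irreducible p" using factor.hyps by (simp add: prime_elem_imp_irreducible)
    then have "\<not> is_unit p" by (simp add: irreducible_def)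
    then obtain i where i: "\<not> p dvd F $ i" using F(2) unfolding coprime3_def by blast
    have "finite {q. vanishes p q \<and> vanishes (F $ i) q}"
      by (rule finite_common_zeros[OF k(1) irr _ i]) (use F in \<open>auto simp: homogeneous3_def\<close>)
    moreover have "finite {q. vanishes x q \<and> (\<forall>i. vanishes (F $ i) q)}"
      using factor.IH[OF k(2)] factor.prems by auto
    ultimately have "finite ({q. vanishes p q \<and> vanishes (F $ i) q} \<union> {q. vanishes x q \<and> (\<forall>i. vanishes (F $ i) q)})"
      by simp
    then show ?case by (rule finite_subset[rotated]) (auto simp: vanishes_def)
  qed auto
  moreover obtain i where "F $ i \<noteq> 0" using coprime3_nonzero F(2) by blast
  ultimately have "finite {p. vanishes (F $ i) p \<and> (\<forall>i. vanishes (F $ i) p)}"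
    using F(1) by (auto simp: homogeneous3_def)
  then show ?thesis unfolding eq by (rule finite_subset[rotated]) auto
qed

section \<open>Irreducible curves\<close>

definition irreducible_curve :: "proj_plane set \<Rightarrow> bool" where
  "irreducible_curve D \<longleftrightarrow> (\<exists>d P. homogeneous d P \<and> irreducible P \<and> D = {p. vanishes P p})"

text \<open>
  A form with infinitely many zeros on an irreducible curve is divisible by the equation of the curve.
  Every later appeal to irreducibility goes through this statement.
\<close>

lemma irreducible_curve_subset:
  assumes "irreducible_curve D" "homogeneous e G" "infinite {p \<in> D. vanishes G p}" "p \<in> D"
  shows "vanishes G p"
proof -
  obtain d P where P: "homogeneous d P" "irreducible P" "D = {p. vanishes P p}"
    using assms(1) unfolding irreducible_curve_def by blast
  then have "P dvd G" using finite_common_zeros[OF P(1,2) assms(2)] assms(3) by auto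
  then show ?thesis using assms(4) P(3) by (auto simp: vanishes_def elim!: dvdE)
qed

text \<open>
  Every line through a point off the curve meets the curve.
\<close>

lemma infinite_zeros:
  assumes F: "homogeneous d F" "d > 0" "F \<noteq> 0"
  shows "infinite {p. vanishes F p}"
proof -
  note fF = F(1)[unfolded homogeneous_iff_form]
  obtain x where x: "x \<noteq> 0" "eval3 F x \<noteq> 0"
    using eval3_nonzero F(3) poly_fun_nonzero_point poly_fun_eval3(1) by metis
  obtain A B where A: "\<And>i. form 1 (\<lambda>v. A v $ i)" "\<And>i. form 1 (\<lambda>v. B v $ i)"
    "\<And>v. A (B v) = v" "\<And>v. B (A v) = v" "A e1 = x"
    using coordinate_change[OF x(1)] by blast
  have A_scale: "A (s *s v) = s *s A v" and B_scale: "B (s *s v) = s *s B v" for s v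
    using A(1,2) by (simp_all add: form_def vec_eq_iff)
  have fA: "form (d * 1) (\<lambda>v. eval3 F (A v))" by (rule form_compose[OF fF A(1)])
  have "\<exists>t. eval3 F (A ((\<tau> *s e2 + e3) + t *s e1)) = 0" for \<tau>
    by (rule form_has_zero_on_line[OF fA]) (use F x A in auto)
  then obtain t where t: "\<And>\<tau>. eval3 F (A ((\<tau> *s e2 + e3) + t \<tau> *s e1)) = 0" by metis
  define u where "u \<tau> = (\<tau> *s e2 + e3) + t \<tau> *s e1" for \<tau>
  have u3: "u \<tau> $ 3 = 1" "u \<tau> $ 2 = \<tau>" for \<tau> by (auto simp: u_def axis_def)
  have Au: "A (u \<tau>) \<noteq> 0" for \<tau>
  proof
    assume "A (u \<tau>) = 0"
    then have "u \<tau> = 0" using A(4)[of "u \<tau>"] B_scale[of 0 0] by simp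
    then show False using u3(1)[of \<tau>] by simp
  qed
  have "inj (\<lambda>\<tau>. abs_proj_plane (A (u \<tau>)))"
  proof (rule injI)
    fix \<sigma> \<tau> assume "abs_proj_plane (A (u \<sigma>)) = abs_proj_plane (A (u \<tau>))"
    then obtain c where "A (u \<tau>) = c *s A (u \<sigma>)" using abs_eq_iff[OF Au Au] by blast
    then have "u \<tau> = c *s u \<sigma>" using A(4) B_scale by metis
    then have "u \<tau> $ 3 = c * u \<sigma> $ 3" "u \<tau> $ 2 = c * u \<sigma> $ 2" by simp_all
    then show "\<sigma> = \<tau>" by (simp add: u3)
  qed
  then have "infinite (range (\<lambda>\<tau>. abs_proj_plane (A (u \<tau>))))"
    using finite_image_iff infinite_UNIV_char_0 by blast
  moreover have "range (\<lambda>\<tau>. abs_proj_plane (A (u \<tau>))) \<subseteq> {p. vanishes F p}"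
    using t[folded u_def] vanishes_abs[OF F(1) Au] by auto
  ultimately show ?thesis using finite_subset by blast
qed

lemma irreducible_curve_infinite:
  assumes "irreducible_curve D"
  shows "infinite D"
proof -
  obtain d P where P: "homogeneous d P" "irreducible P" "D = {p. vanishes P p}"
    using assms unfolding irreducible_curve_def by blast
  then have "P \<noteq> 0" "\<not> is_unit P" by (auto simp: irreducible_def)
  then have "d > 0" using homogeneous_0_is_unit P(1) by (metis gr0I)
  then show ?thesis using infinite_zeros[OF P(1) _ \<open>P \<noteq> 0\<close>] P(3) by simp
qed

lemma homogeneous_factor_degrees:
  assumes "homogeneous d F" "F \<noteq> 0" "F = G * H" "\<not> is_unit G" "\<not> is_unit H"
  obtains a b where "homogeneous a G" "homogeneous b H" "a + b = d" "a > 0" "b > 0"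
proof -
  obtain a b where ab: "homogeneous a G" "homogeneous b H"
    using homogeneous_divisor[OF assms(1,2)] assms(3) by (meson dvd_triv_left dvd_triv_right)
  moreover have "a + b = d" using homogeneous_degree_unique[OF _ assms(1,2)] homogeneous_mult[OF ab] assms(3) by simp
  moreover have "a > 0" "b > 0"
    using homogeneous_0_is_unit ab assms by (metis gr0I mult_zero_left, metis gr0I mult_zero_right)
  ultimately show ?thesis using that by blast
qed

lemma line_irreducible_curve:
  assumes "line L"
  shows "irreducible_curve L"
proof -
  obtain F where F: "homogeneous 1 F" "F \<noteq> 0" "L = {p. vanishes F p}"
    using assms unfolding line_def by blast
  have "irreducible F"
  proof (rule irreducibleI)
    show "F \<noteq> 0" by fact
    show "\<not> is_unit F" using homogeneous_unit_degree[OF F(1)] by auto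
    fix a b assume "F = a * b"
    then show "is_unit a \<or> is_unit b"
      using homogeneous_factor_degrees[OF F(1,2)] by (metis One_nat_def add_is_1 less_irrefl)
  qed
  then show ?thesis using F unfolding irreducible_curve_def by blast
qed

text \<open>
  Applying a derivation to all coefficients is a derivation; this gives the product rule for the
  partial derivatives with respect to the inner variables.
\<close>

lemma map_poly_derivation:
  fixes \<delta> :: "'a::comm_ring_1 \<Rightarrow> 'a"
  assumes "\<delta> 0 = 0" "\<And>a b. \<delta> (a + b) = \<delta> a + \<delta> b" "\<And>a b. \<delta> (a * b) = a * \<delta> b + \<delta> a * b"
  shows "map_poly \<delta> (p * q) = p * map_poly \<delta> q + map_poly \<delta> p * q"
    "map_poly \<delta> (p + q) = map_poly \<delta> p + map_poly \<delta> q"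
proof -
  have sum: "\<delta> (sum f I) = (\<Sum>i\<in>I. \<delta> (f i))" for f :: "nat \<Rightarrow> 'a" and I
    by (induction I rule: infinite_finite_induct) (auto simp: assms)
  show "map_poly \<delta> (p * q) = p * map_poly \<delta> q + map_poly \<delta> p * q"
    by (rule poly_eqI) (simp add: coeff_map_poly assms coeff_mult sum sum.distrib)
  show "map_poly \<delta> (p + q) = map_poly \<delta> p + map_poly \<delta> q"
    by (rule poly_eqI) (simp add: coeff_map_poly assms)
qed

lemma homogeneous_altdef:
  assumes "homogeneous d F"
  shows "eval3 F v = (\<Sum>i\<le>d. \<Sum>j\<le>d. \<Sum>k\<le>d. if i + j + k = d then
     coeff (coeff (coeff F i) j) k * (v $ 1 ^ i * v $ 2 ^ j * v $ 3 ^ k) else 0)"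
proof -
  have z: "coeff (coeff (coeff F i) j) k = 0" if "i + j + k \<noteq> d" for i j k
    using assms that by (auto simp: homogeneous_def)
  have d1: "degree (coeff (coeff F i) j) \<le> d" for i j by (rule degree_le) (auto simp: z)
  have z2: "coeff (coeff F i) j = 0" if "j > d" for i j using z that by (intro poly_eqI) auto
  have d2: "degree (coeff F i) \<le> d" for i by (rule degree_le) (auto simp: z2)
  have z3: "coeff F i = 0" if "i > d" for i using z that by (intro poly_eqI) auto
  have d3: "degree F \<le> d" by (rule degree_le) (auto simp: z3)
  have "eval3 F v = (\<Sum>i\<le>d. \<Sum>j\<le>d. \<Sum>k\<le>d.
     coeff (coeff (coeff F i) j) k * (v $ 1 ^ i * v $ 2 ^ j * v $ 3 ^ k))"
    unfolding eval3_altdef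
    by (intro sum.mono_neutral_cong_left)
      (use d1 d2 d3 in \<open>auto simp: coeff_eq_0 not_le intro!: sum.mono_neutral_cong_left\<close>)
  also have "\<dots> = (\<Sum>i\<le>d. \<Sum>j\<le>d. \<Sum>k\<le>d. if i + j + k = d then
     coeff (coeff (coeff F i) j) k * (v $ 1 ^ i * v $ 2 ^ j * v $ 3 ^ k) else 0)"
    using z by (intro sum.cong) auto
  finally show ?thesis .
qed

lemma form_1_linear:
  assumes "form 1 f"
  obtains a b c where "\<And>v. f v = a * v $ 1 + b * v $ 2 + c * v $ 3"
proof -
  obtain F where F: "f = eval3 F" "homogeneous 1 F" using form_obtain_poly[OF assms] .
  let ?c = "\<lambda>i j k. coeff (coeff (coeff F i) j) k"
  have "f v = ?c 1 0 0 * v $ 1 + ?c 0 1 0 * v $ 2 + ?c 0 0 1 * v $ 3" for v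
    unfolding F(1) homogeneous_altdef[OF F(2)]
    by (simp add: atMost_Suc)
  then show ?thesis using that by blast
qed

lemma form_3_cubic:
  assumes "form 3 f"
  obtains c1 c2 c3 c4 c5 c6 c7 c8 c9 c10 where
    "\<And>v. f v = c1 * v $ 1 ^ 3 + c2 * v $ 2 ^ 3 + c3 * v $ 3 ^ 3
      + c4 * (v $ 1 ^ 2 * v $ 2) + c5 * (v $ 1 ^ 2 * v $ 3) + c6 * (v $ 2 ^ 2 * v $ 1)
      + c7 * (v $ 2 ^ 2 * v $ 3) + c8 * (v $ 3 ^ 2 * v $ 1) + c9 * (v $ 3 ^ 2 * v $ 2)
      + c10 * (v $ 1 * v $ 2 * v $ 3)"
proof -
  obtain F where F: "f = eval3 F" "homogeneous 3 F" using form_obtain_poly[OF assms] .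
  let ?c = "\<lambda>i j k. coeff (coeff (coeff F i) j) k"
  have "f v = ?c 3 0 0 * v $ 1 ^ 3 + ?c 0 3 0 * v $ 2 ^ 3 + ?c 0 0 3 * v $ 3 ^ 3
      + ?c 2 1 0 * (v $ 1 ^ 2 * v $ 2) + ?c 2 0 1 * (v $ 1 ^ 2 * v $ 3) + ?c 1 2 0 * (v $ 2 ^ 2 * v $ 1)
      + ?c 0 2 1 * (v $ 2 ^ 2 * v $ 3) + ?c 1 0 2 * (v $ 3 ^ 2 * v $ 1) + ?c 0 1 2 * (v $ 3 ^ 2 * v $ 2)
      + ?c 1 1 1 * (v $ 1 * v $ 2 * v $ 3)" for v
    unfolding F(1) homogeneous_altdef[OF F(2)]
    by (simp add: atMost_Suc numeral_2_eq_2 numeral_3_eq_3)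
  then show ?thesis using that by blast
qed

lemma form_1_add: "form 1 f \<Longrightarrow> f (x + y) = f x + f y"
  by (erule form_1_linear) (simp add: algebra_simps)

text \<open>
  In a proper factorization of a cubic form one factor is linear. Its zero line meets the conic
  defined by the other factor, and the cubic is singular there by the product rule.
\<close>

lemma smooth_cubic_irreducible:
  assumes F: "homogeneous 3 F"
    and smooth: "\<And>p. vanishes F p \<Longrightarrow> \<not> (vanishes (pderiv F) p \<and>
                     vanishes (map_poly pderiv F) p \<and> vanishes (map_poly (map_poly pderiv) F) p)"
  shows "irreducible F"
proof (rule irreducibleI)
  show F0: "F \<noteq> 0"
  proof
    assume "F = 0"
    then show False using smooth[of "abs_proj_plane e1"] by (simp add: vanishes_def)
  qed
  show "\<not> is_unit F" using homogeneous_unit_degree[OF F] by auto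
  have no_common: "\<not> (vanishes G p \<and> vanishes H p)" if "F = G * H" for G H p
  proof
    assume v: "vanishes G p \<and> vanishes H p"
    define D2 :: "complex poly poly \<Rightarrow> complex poly poly" where "D2 = map_poly pderiv"
    have d1: "pderiv (0::complex poly) = 0" "pderiv (a + b) = pderiv a + pderiv b"
      "pderiv (a * b) = a * pderiv b + pderiv a * b" for a b :: "complex poly"
      by (simp_all add: pderiv_add pderiv_mult mult.commute)
    note d2 = map_poly_derivation[of pderiv, OF d1, folded D2_def]
    have d2': "D2 0 = 0" by (simp add: D2_def)
    note d3 = map_poly_derivation[of D2, OF d2' d2(2,1)]
    have d4: "pderiv (0::complex poly poly) = 0" "pderiv (a + b) = pderiv a + pderiv b"
      "pderiv (a * b) = a * pderiv b + pderiv a * b" for a b :: "complex poly poly"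
      by (simp_all add: pderiv_add pderiv_mult mult.commute)
    have e1: "map_poly pderiv F = G * map_poly pderiv H + map_poly pderiv G * H"
      unfolding that by (rule map_poly_derivation(1)[OF d4])
    have "vanishes (pderiv F) p" using v by (simp add: that pderiv_mult vanishes_def)
    moreover have "vanishes (map_poly pderiv F) p" using v by (simp add: e1 vanishes_def)
    moreover have "vanishes (map_poly (map_poly pderiv) F) p"
      using v d3(1)[of G H] by (simp add: that vanishes_def D2_def)
    moreover have "vanishes F p" using v by (simp add: that vanishes_def)
    ultimately show False using smooth by blast
  qed
  have *: "\<exists>p. vanishes G p \<and> vanishes H p" if hom: "homogeneous 1 G" "G \<noteq> 0" "homogeneous 2 H" for G H
  proof -
    have inf: "infinite {p. vanishes G p}" using infinite_zeros hom by auto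
    then obtain p where p: "vanishes G p" using not_finite_existsD by blast
    obtain q where q: "vanishes G q" "q \<noteq> p"
      using infinite_remove[OF inf, of p] not_finite_existsD[of "\<lambda>q. vanishes G q \<and> q \<noteq> p"]
      by (metis (mono_tags, lifting) DiffD1 DiffD2 finite.emptyI equals0I insertI1 mem_Collect_eq)
    obtain x where x: "x \<noteq> 0" "p = abs_proj_plane x" using point_cases .
    obtain y where y: "y \<noteq> 0" "q = abs_proj_plane y" using point_cases .
    have G: "eval3 G (x + t *s y) = 0" for t
      using p q vanishes_abs[OF hom(1) x(1)] vanishes_abs[OF hom(1) y(1)]
        hom(1)[unfolded homogeneous_iff_form] by (simp add: x y form_1_add form_scale)
    show ?thesis
    proof (cases "vanishes H q")
      case False
      then have "eval3 H y \<noteq> 0" using vanishes_abs[OF hom(3) y(1)] y by simp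
      then obtain t where t: "eval3 H (x + t *s y) = 0"
        using form_has_zero_on_line[of 2 "eval3 H"] hom(3) by (auto simp: homogeneous_iff_form)
      have "x + t *s y \<noteq> 0"
      proof
        assume "x + t *s y = 0"
        then have "x = (- t) *s y" by (simp add: vec_eq_iff eq_neg_iff_add_eq_0)
        then have "parallel x y" by (simp add: parallel_def)
        then show False using parallel_iff x y q(2) by metis
      qed
      then show ?thesis using t G vanishes_abs hom by blast
    qed (use q in auto)
  qed
  fix G H assume GH: "F = G * H"
  show "is_unit G \<or> is_unit H"
  proof (rule ccontr)
    assume "\<not> (is_unit G \<or> is_unit H)"
    then obtain a b where ab: "homogeneous a G" "homogeneous b H" "a + b = 3" "a > 0" "b > 0"
      using homogeneous_factor_degrees[OF F F0 GH] by metis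
    then consider "a = 1" "b = 2" | "a = 2" "b = 1" by linarith
    then show False
      using * no_common[OF GH] ab F0 GH by cases (metis mult_zero_left, metis mult_zero_right)
  qed
qed

lemma smooth_cubic_irreducible_curve:
  assumes "smooth_cubic D"
  shows "irreducible_curve D"
  using assms smooth_cubic_irreducible unfolding smooth_cubic_def irreducible_curve_def by blast

section \<open>Conjugates of maps that fix a curve\<close>

text \<open>
  Membership in an inertia group only asks that fixed points are dense on the curve. Fixing all but
  finitely many points of an irreducible curve is what conjugation preserves directly.
\<close>

definition fixers :: "proj_plane set \<Rightarrow> (proj_plane \<rightharpoonup> proj_plane) set" where
  "fixers D = {f. birational f \<and> finite {x \<in> D. f x \<noteq> Some x}}"

lemma fixers_birational: "f \<in> fixers D \<Longrightarrow> birational f"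
  by (simp add: fixers_def)

text \<open>
  Being sent to a given point is a condition on the components of the map given by forms; if it holds at
  infinitely many points of an irreducible curve, then it holds on the whole curve.
\<close>

lemma finite_fibre_on_curve:
  assumes D: "irreducible_curve D" and f: "rational_map f" "\<not> contracts f D"
  shows "finite {x \<in> D. f x = Some y}"
proof (rule ccontr)
  assume inf: "infinite {x \<in> D. f x = Some y}"
  obtain d F where F: "homogeneous3 d F" "f = triple_map F" using rational_map_form[OF f(1)] by metis
  obtain w where w: "w \<noteq> 0" "y = abs_proj_plane w" using point_cases .
  have "z = y" if z: "x \<in> D" "f x = Some z" for x z
  proof -
    have val: "eval_triple F (rep_proj_plane x') \<noteq> 0 \<and> z' = abs_proj_plane (eval_triple F (rep_proj_plane x'))"
      if "f x' = Some z'" for x' z'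
      using that F(2) by (auto simp: triple_map_def Let_def split: if_splits)
    have "eval3 (F $ i) (rep_proj_plane x) * w $ j = eval3 (F $ j) (rep_proj_plane x) * w $ i" for i j
    proof -
      define G where "G = [:[:[:w $ j:]:]:] * F $ i - [:[:[:w $ i:]:]:] * F $ j"
      have eG: "eval3 G v = eval3 (F $ i) v * w $ j - eval3 (F $ j) v * w $ i" for v
        by (simp add: G_def mult.commute)
      have "form d (eval3 G)"
        using F(1) by (auto simp: form_def eG homogeneous3_def homogeneous_iff_form algebra_simps)
      then have "homogeneous d G" by (simp add: homogeneous_iff_form)
      moreover have "{x \<in> D. f x = Some y} \<subseteq> {x \<in> D. vanishes G x}"
      proof (intro subsetI CollectI conjI)
        fix x' assume "x' \<in> {x \<in> D. f x = Some y}"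
        then have "x' \<in> D" "parallel (eval_triple F (rep_proj_plane x')) w"
          using val[of x' y] w by (auto simp: parallel_iff)
        then show "x' \<in> D" "vanishes G x'"
          by (auto simp: vanishes_def eG parallel_def eval_triple_def)
      qed
      then have "infinite {x \<in> D. vanishes G x}" using inf finite_subset by blast
      ultimately have "vanishes G x" using irreducible_curve_subset[OF D] z(1) by blast
      then show ?thesis by (simp add: vanishes_def eG)
    qed
    then have "parallel (eval_triple F (rep_proj_plane x)) w" by (simp add: parallel_def eval_triple_def)
    then show ?thesis using val[OF z(2)] w by (auto simp: parallel_iff)
  qed
  then have "ran (f |` D) \<subseteq> {y}" by (auto simp: ran_def restrict_map_def split: if_splits)
  then show False using f(2) by (auto simp: contracts_def)
qed

lemma finite_undefined: "rational_map f \<Longrightarrow> finite {x. f x = None}"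
  using rational_map_form finite_base_points by metis

text \<open>
  The exceptional points are undefined for \<open>\<phi>\<close> or are sent to one of the finitely many points where the
  inverse is undefined, and each of these has a finite fibre on the curve.
\<close>

lemma finite_not_inverse_on_curve:
  assumes D: "irreducible_curve D" and \<phi>: "birational \<phi>" "\<not> contracts \<phi> D"
  shows "finite {x \<in> D. \<not> (\<exists>y. \<phi> x = Some y \<and> (inv\<^bsub>Cremona\<^esub> \<phi>) y = Some x)}"
proof -
  interpret group Cremona by (rule group_Cremona)
  let ?\<psi> = "inv\<^bsub>Cremona\<^esub> \<phi>"
  have \<psi>: "birational ?\<psi>" using inv_closed[of \<phi>] \<phi>(1) by simp
  have "rat_comp ?\<psi> \<phi> = Some" using l_inv[of \<phi>] \<phi>(1) by simp
  then have *: "z = x" if "\<phi> x = Some y" "?\<psi> y = Some z" for x y z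
    using rat_comp_Some[OF \<psi> \<phi>(1) that] by simp
  note fin = finite_undefined[OF birational_rational[OF \<phi>(1)]] finite_undefined[OF birational_rational[OF \<psi>]]
  have "finite ({x. \<phi> x = None} \<union> (\<Union>y\<in>{y. ?\<psi> y = None}. {x \<in> D. \<phi> x = Some y}))"
    using fin finite_fibre_on_curve[OF D birational_rational[OF \<phi>(1)] \<phi>(2)] by blast
  moreover have "{x \<in> D. \<not> (\<exists>y. \<phi> x = Some y \<and> ?\<psi> y = Some x)}
     \<subseteq> {x. \<phi> x = None} \<union> (\<Union>y\<in>{y. ?\<psi> y = None}. {x \<in> D. \<phi> x = Some y})"
  proof
    fix x assume x: "x \<in> {x \<in> D. \<not> (\<exists>y. \<phi> x = Some y \<and> ?\<psi> y = Some x)}"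
    show "x \<in> {x. \<phi> x = None} \<union> (\<Union>y\<in>{y. ?\<psi> y = None}. {x \<in> D. \<phi> x = Some y})"
      using x * by (cases "\<phi> x"; cases "?\<psi> (the (\<phi> x))") auto
  qed
  ultimately show ?thesis by (rule finite_subset[rotated])
qed

text \<open>
  The conjugate fixes \<open>\<phi> x\<close> for all but finitely many \<open>x\<close> on \<open>D\<close>. A form that vanishes at these images pulls
  back to a form with infinitely many zeros on \<open>D\<close>, so it vanishes on the whole strict transform.
\<close>

lemma conjugate_in_inertia_group:
  assumes D: "irreducible_curve D" and \<phi>: "birational \<phi>" "\<not> contracts \<phi> D" and f: "f \<in> fixers D"
  shows "\<phi> \<otimes>\<^bsub>Cremona\<^esub> f \<otimes>\<^bsub>Cremona\<^esub> inv\<^bsub>Cremona\<^esub> \<phi> \<in> inertia_group (strict_transform \<phi> D)"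
proof -
  interpret group Cremona by (rule group_Cremona)
  let ?\<psi> = "inv\<^bsub>Cremona\<^esub> \<phi>"
  define h where "h = \<phi> \<otimes>\<^bsub>Cremona\<^esub> f \<otimes>\<^bsub>Cremona\<^esub> ?\<psi>"
  have \<psi>: "birational ?\<psi>" using inv_closed[of \<phi>] \<phi>(1) by simp
  have fb: "birational f" using f by (simp add: fixers_def)
  have pf: "birational (rat_comp \<phi> f)" using birational_rat_comp \<phi>(1) fb by blast
  have h: "birational h" using birational_rat_comp[OF pf \<psi>] by (simp add: h_def)
  define M where "M = {x \<in> D. \<not> (\<exists>y. \<phi> x = Some y \<and> ?\<psi> y = Some x)} \<union> {x \<in> D. f x \<noteq> Some x}"
  have "finite M"
    using finite_not_inverse_on_curve[OF D \<phi>] f by (simp add: M_def fixers_def)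
  have fixed: "h y = Some y" if "x \<in> D" "x \<notin> M" "\<phi> x = Some y" for x y
    using that rat_comp_Some[OF \<phi>(1) fb] rat_comp_Some[OF pf \<psi>] by (auto simp: M_def h_def)
  obtain d F where F: "homogeneous3 d F" "\<phi> = triple_map F"
    using rational_map_form[OF birational_rational[OF \<phi>(1)]] by metis
  have "ran (\<phi> |` D) \<subseteq> Z" if Z: "zariski_closed Z" "{y. h y = Some y} \<subseteq> Z" for Z
  proof
    fix z assume "z \<in> ran (\<phi> |` D)"
    then obtain x where x: "x \<in> D" "\<phi> x = Some z" by (auto simp: ran_def restrict_map_def split: if_splits)
    obtain S where S: "\<And>H. H \<in> S \<Longrightarrow> \<exists>e. homogeneous e H" "Z = {p. \<forall>H\<in>S. vanishes H p}"
      using Z(1) unfolding zariski_closed_def by metis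
    have "vanishes H z" if H: "H \<in> S" for H
    proof -
      obtain e where e: "homogeneous e H" using S(1) H by blast
      have "form (e * d) (\<lambda>v. eval3 H (eval_triple F v))"
        by (rule form_compose) (use e form_eval_triple[OF F(1)] in \<open>auto simp: homogeneous_iff_form\<close>)
      then obtain K where K: "(\<lambda>v. eval3 H (eval_triple F v)) = eval3 K" "homogeneous (e * d) K"
        by (rule form_obtain_poly)
      have K_iff: "vanishes K x' \<longleftrightarrow> vanishes H y" if "\<phi> x' = Some y" for x' y
      proof -
        define w where "w = eval_triple F (rep_proj_plane x')"
        have "w \<noteq> 0" "y = abs_proj_plane w"
          using that F(2) by (auto simp: w_def triple_map_def Let_def split: if_splits)
        then show ?thesis
          using vanishes_abs[OF e] fun_cong[OF K(1), of "rep_proj_plane x'"]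
          by (simp add: vanishes_def[of K] w_def)
      qed
      have "vanishes K x'" if x': "x' \<in> D - M" for x'
      proof -
        obtain y where y: "\<phi> x' = Some y" using x' unfolding M_def by blast
        then have "y \<in> Z" using fixed x' Z(2) by blast
        then show ?thesis using K_iff[OF y] S(2) H by blast
      qed
      then have "D - M \<subseteq> {x' \<in> D. vanishes K x'}" by blast
      moreover have "infinite (D - M)" using irreducible_curve_infinite[OF D] \<open>finite M\<close> by simp
      ultimately have "infinite {x' \<in> D. vanishes K x'}" using finite_subset by blast
      then have "vanishes K x" using irreducible_curve_subset[OF D K(2)] x by blast
      then show ?thesis using K_iff x by blast
    qed
    then show "z \<in> Z" using S(2) by blast
  qed
  then have "strict_transform \<phi> D \<subseteq> zariski_closure {y. h y = Some y}"
    unfolding strict_transform_def zariski_closure_def hull_def by blast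
  then show ?thesis using h by (simp add: inertia_group_def fixes_pointwise_def h_def)
qed

section \<open>Determinants and pencils of lines\<close>

definition det3 :: "complex ^ 3 \<Rightarrow> complex ^ 3 \<Rightarrow> complex ^ 3 \<Rightarrow> complex" where
  "det3 x y z = x $ 1 * (y $ 2 * z $ 3 - y $ 3 * z $ 2) - x $ 2 * (y $ 1 * z $ 3 - y $ 3 * z $ 1)
     + x $ 3 * (y $ 1 * z $ 2 - y $ 2 * z $ 1)"

lemma det3_simps [simp]:
  "det3 x x y = 0" "det3 x y x = 0" "det3 x y y = 0"
  "det3 (c *s x) y z = c * det3 x y z" "det3 x (c *s y) z = c * det3 x y z"
  "det3 x y (c *s z) = c * det3 x y z"
  "det3 x (y + y') z = det3 x y z + det3 x y' z" "det3 x y (z + z') = det3 x y z + det3 x y z'"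
  "det3 x y (z - z') = det3 x y z - det3 x y z'"
  by (simp_all add: det3_def algebra_simps)

lemma form_det3: "form 1 (\<lambda>v. det3 x y v)" "form 1 (\<lambda>v. det3 x v y)"
proof -
  have "poly_fun (\<lambda>v. det3 x y v)" "poly_fun (\<lambda>v. det3 x v y)"
    unfolding det3_def
    by (intro poly_fun_add poly_fun_diff poly_fun_mult poly_fun_const poly_fun_coord)+
  then show "form 1 (\<lambda>v. det3 x y v)" "form 1 (\<lambda>v. det3 x v y)" by (simp_all add: form_def)
qed

lemma det3_nonzero:
  assumes "\<not> parallel x y"
  shows "\<exists>v. det3 x y v \<noteq> 0" "\<exists>v. det3 x v y \<noteq> 0"
proof -
  have "\<exists>v. det3 x y v \<noteq> 0"
  proof (rule ccontr)
    assume "\<nexists>v. det3 x y v \<noteq> 0"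
    then have "det3 x y e1 = 0" "det3 x y e2 = 0" "det3 x y e3 = 0" by auto
    then have "parallel x y" by (simp add: det3_def axis_def parallel_def forall_3 mult.commute)
    then show False using assms by simp
  qed
  moreover have "det3 x v y = - det3 x y v" for v by (simp add: det3_def algebra_simps)
  ultimately show "\<exists>v. det3 x y v \<noteq> 0" "\<exists>v. det3 x v y \<noteq> 0" by auto
qed

lemma det3_basis:
  assumes "det3 x y z \<noteq> 0"
  shows "w = (det3 x y w / det3 x y z) *s z + ((det3 w y z / det3 x y z) *s x + (det3 x w z / det3 x y z) *s y)"
proof -
  have "det3 x y z *s w = det3 x y w *s z + (det3 w y z *s x + det3 x w z *s y)"
    by (simp add: vec_eq_iff forall_3 det3_def algebra_simps)
  then have "w = inverse (det3 x y z) *s (det3 x y w *s z + (det3 w y z *s x + det3 x w z *s y))"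
    using assms by (metis left_inverse vector_smult_assoc vector_smult_lid)
  then show ?thesis
    by (simp add: vec_eq_iff divide_inverse algebra_simps)
qed

text \<open>
  The forms \<open>l\<close> and \<open>m\<close> are homogeneous coordinates on the pencil of lines through \<open>q\<close>: they take proportional
  values at two vectors iff both vectors lie on one line with \<open>q\<close>.
\<close>

lemma pencil_coordinates:
  assumes "q \<noteq> 0"
  obtains l m c where "form 1 l" "form 1 m" "c \<noteq> 0" "l q = 0" "m q = 0"
    "\<And>v w. l v * m w - l w * m v = c * det3 q v w"
    "\<And>v. l v = 0 \<Longrightarrow> m v = 0 \<Longrightarrow> \<exists>\<beta>. v = \<beta> *s q" "\<exists>v. m v \<noteq> 0"
proof -
  have f: "form 1 (\<lambda>v. a * v $ i - b * v $ j)" for a b and i j :: 3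
    by (intro form_diff form_cmult form_coord)
  obtain i where i: "q $ i \<noteq> 0" using assms by (auto simp: vec_eq_iff)
  have sol: "\<exists>\<beta>. v = \<beta> *s q" if "\<And>j. q $ i * v $ j = q $ j * v $ i" for v
    using i that by (intro exI[of _ "v $ i / q $ i"]) (simp add: vec_eq_iff field_simps)
  consider (1) "i = 1" | (2) "i = 2" | (3) "i = 3" using index_cases by blast
  then show ?thesis
  proof cases
    case 1
    show ?thesis
    proof (rule that[of "\<lambda>v. q $ 1 * v $ 2 - q $ 2 * v $ 1" "\<lambda>v. q $ 1 * v $ 3 - q $ 3 * v $ 1" "q $ 1"])
      show "form 1 (\<lambda>v. q $ 1 * v $ 2 - q $ 2 * v $ 1)" "form 1 (\<lambda>v. q $ 1 * v $ 3 - q $ 3 * v $ 1)"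
        by (rule f)+
      show "\<exists>v :: complex ^ 3. q $ 1 * v $ 3 - q $ 3 * v $ 1 \<noteq> 0"
        by (rule exI[of _ e3]) (use i 1 in \<open>simp add: axis_def\<close>)
      fix v :: "complex ^ 3" assume "q $ 1 * v $ 2 - q $ 2 * v $ 1 = 0" "q $ 1 * v $ 3 - q $ 3 * v $ 1 = 0"
      then have "q $ i * v $ j = q $ j * v $ i" for j :: 3 using index_cases[of j] 1 by auto
      then show "\<exists>\<beta>. v = \<beta> *s q" by (rule sol)
    qed (use i 1 in \<open>simp_all add: det3_def algebra_simps\<close>)
  next
    case 2
    show ?thesis
    proof (rule that[of "\<lambda>v. q $ 2 * v $ 1 - q $ 1 * v $ 2" "\<lambda>v. q $ 2 * v $ 3 - q $ 3 * v $ 2" "- (q $ 2)"])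
      show "form 1 (\<lambda>v. q $ 2 * v $ 1 - q $ 1 * v $ 2)" "form 1 (\<lambda>v. q $ 2 * v $ 3 - q $ 3 * v $ 2)"
        by (rule f)+
      show "\<exists>v :: complex ^ 3. q $ 2 * v $ 3 - q $ 3 * v $ 2 \<noteq> 0"
        by (rule exI[of _ e3]) (use i 2 in \<open>simp add: axis_def\<close>)
      fix v :: "complex ^ 3" assume "q $ 2 * v $ 1 - q $ 1 * v $ 2 = 0" "q $ 2 * v $ 3 - q $ 3 * v $ 2 = 0"
      then have "q $ i * v $ j = q $ j * v $ i" for j :: 3 using index_cases[of j] 2 by auto
      then show "\<exists>\<beta>. v = \<beta> *s q" by (rule sol)
    qed (use i 2 in \<open>simp_all add: det3_def algebra_simps\<close>)
  next
    case 3
    show ?thesis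
    proof (rule that[of "\<lambda>v. q $ 3 * v $ 1 - q $ 1 * v $ 3" "\<lambda>v. q $ 3 * v $ 2 - q $ 2 * v $ 3" "q $ 3"])
      show "form 1 (\<lambda>v. q $ 3 * v $ 1 - q $ 1 * v $ 3)" "form 1 (\<lambda>v. q $ 3 * v $ 2 - q $ 2 * v $ 3)"
        by (rule f)+
      show "\<exists>v :: complex ^ 3. q $ 3 * v $ 2 - q $ 2 * v $ 3 \<noteq> 0"
        by (rule exI[of _ e2]) (use i 3 in \<open>simp add: axis_def\<close>)
      fix v :: "complex ^ 3" assume "q $ 3 * v $ 1 - q $ 1 * v $ 3 = 0" "q $ 3 * v $ 2 - q $ 2 * v $ 3 = 0"
      then have "q $ i * v $ j = q $ j * v $ i" for j :: 3 using index_cases[of j] 3 by auto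
      then show "\<exists>\<beta>. v = \<beta> *s q" by (rule sol)
    qed (use i 3 in \<open>simp_all add: det3_def algebra_simps\<close>)
  qed
qed

section \<open>Maps that preserve the lines through a point\<close>

text \<open>
  The restriction of the form \<open>E\<close> to lines with direction \<open>q\<close> is quadratic in the parameter, with
  coefficients \<open>E\<close>, \<open>E1\<close>, \<open>E2\<close>: the point \<open>q\<close> has multiplicity at least \<open>e - 2\<close> on the curve defined by \<open>E\<close>, so each line
  through \<open>q\<close> meets that curve in at most two further points.
\<close>

definition quadratic_along ::
  "complex ^ 3 \<Rightarrow> nat \<Rightarrow> (complex ^ 3 \<Rightarrow> complex) \<Rightarrow> (complex ^ 3 \<Rightarrow> complex) \<Rightarrow> (complex ^ 3 \<Rightarrow> complex) \<Rightarrow> bool" where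
  "quadratic_along q e E E1 E2 \<longleftrightarrow> e \<ge> 2 \<and> form e E \<and> (\<exists>v. E v \<noteq> 0) \<and> poly_fun E1 \<and>
     (\<forall>a t v. E (a *s v + t *s q) = a ^ (e - 2) * (a\<^sup>2 * E v + a * t * E1 v + t\<^sup>2 * E2 v))"

lemma quadratic_along_derivative:
  assumes "quadratic_along q e E E1 E2"
  shows "E1 (a *s v + t *s q) = a ^ (e - 2) * (a * E1 v + 2 * t * E2 v)"
proof -
  have E: "E (a *s v + t *s q) = a ^ (e - 2) * (a\<^sup>2 * E v + a * t * E1 v + t\<^sup>2 * E2 v)" for a t v
    using assms by (simp add: quadratic_along_def)
  have "E (1 *s (a *s v + t *s q) + s *s q) = E (a *s v + (t + s) *s q)" for s
    by (rule arg_cong[of _ _ E]) (simp add: vec_eq_iff algebra_simps)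
  note shifted = this
  let ?w = "a *s v + t *s q"
  define R where "R s = a ^ (e - 2) * (a\<^sup>2 * E v + a * s * E1 v + s\<^sup>2 * E2 v)" for s
  have "R t + E1 ?w + E2 ?w = R (t + 1)" using shifted[of 1] unfolding E R_def by simp
  moreover have "R t - E1 ?w + E2 ?w = R (t - 1)" using shifted[of "- 1"] unfolding E R_def by simp
  moreover have "2 * E1 ?w = (R t + E1 ?w + E2 ?w) - (R t - E1 ?w + E2 ?w)" by simp
  ultimately have "2 * E1 ?w = R (t + 1) - R (t - 1)" by simp
  also have "\<dots> = 2 * (a ^ (e - 2) * (a * E1 v + 2 * t * E2 v))"
    by (simp add: R_def algebra_simps power2_eq_square)
  finally show ?thesis by simp
qed

lemma quadratic_along_derivative_form:
  assumes Q: "quadratic_along q e E E1 E2"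
  shows "form (e - 1) E1"
proof -
  have "e \<ge> 2" using Q by (simp add: quadratic_along_def)
  then have "a ^ (e - 1) = a ^ (e - 2) * a" for a :: complex
    by (metis Suc_1 Suc_diff_Suc Suc_le_lessD One_nat_def power_Suc2)
  then have "E1 (a *s v) = a ^ (e - 1) * E1 v" for a v
    using quadratic_along_derivative[OF Q, of a v 0] by simp
  then show ?thesis using Q by (simp add: form_def quadratic_along_def)
qed

text \<open>
  Preserving every line through \<open>q\<close> and fixing the zeros of \<open>E\<close> amounts, on each such line, to a projective
  transformation of the line that fixes the two zeros of a quadratic polynomial. These transformations
  are given by the matrices \<open>n I + k N\<close>, where \<open>N\<close> is a trace-free matrix built from the coefficients of
  the quadratic polynomial, and \<open>n\<close>, \<open>k\<close> are scalars that may vary with the line.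
\<close>

definition pencil_map where
  "pencil_map q E E1 n k v = (n v + k v * E1 v / 2) *s v - (k v * E v) *s q"
  for q :: "complex ^ 3" and E E1 n k :: "complex ^ 3 \<Rightarrow> complex"

text \<open>
  The matrix identity behind the composite is \<open>(n I - k N) (n I + k N) = (n\<^sup>2 - k\<^sup>2 \<Delta>) I\<close>, where \<open>N\<^sup>2 = \<Delta> I\<close> and \<open>4 \<Delta>\<close> is
  the discriminant.
\<close>

lemma pencil_map_composite:
  assumes Q: "quadratic_along q e E E1 E2"
    and n: "form e n" "\<And>v t. n (v + t *s q) = n v"
    and k: "form 1 k" "\<And>v t. k (v + t *s q) = k v"
  shows "pencil_map q E E1 n (\<lambda>v. - k v) (pencil_map q E E1 n k v) =
    ((n v + k v * E1 v / 2) ^ e * ((n v)\<^sup>2 - (k v)\<^sup>2 * ((E1 v)\<^sup>2 / 4 - E v * E2 v))) *s v"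
proof -
  define a where "a = n v + k v * E1 v / 2"
  define t where "t = - (k v * E v)"
  define P where "P = a ^ (e - 2)"
  have e: "a ^ e = P * a\<^sup>2"
    using Q unfolding P_def quadratic_along_def by (metis le_add_diff_inverse2 power_add)
  have w: "pencil_map q E E1 n k v = a *s v + t *s q"
    by (simp add: pencil_map_def a_def t_def vec_eq_iff)
  have En: "E (a *s v + t *s q) = P * (a\<^sup>2 * E v + a * t * E1 v + t\<^sup>2 * E2 v)"
    using Q by (simp add: quadratic_along_def P_def)
  have E1n: "E1 (a *s v + t *s q) = P * (a * E1 v + 2 * t * E2 v)"
    using quadratic_along_derivative[OF Q] by (simp add: P_def)
  have nn: "n (a *s v + t *s q) = P * a\<^sup>2 * n v" using n form_scale[OF n(1)] by (simp add: e)
  have kn: "k (a *s v + t *s q) = a * k v" using k form_scale[OF k(1)] by simp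
  have nv: "n v = a - k v * E1 v / 2" by (simp add: a_def)
  show ?thesis
    unfolding w unfolding pencil_map_def a_def[symmetric] e nn kn En E1n
    unfolding vec_eq_iff
    by (intro allI) (simp add: nv t_def power2_eq_square field_simps)
qed

lemma form_pencil_map:
  assumes Q: "quadratic_along q e E E1 E2" and n: "form e n" and k: "form 1 k"
  shows "form (e + 1) (\<lambda>v. pencil_map q E E1 n k v $ i)"
proof -
  have fE: "form e E" and e: "e \<ge> 2" using Q by (simp_all add: quadratic_along_def)
  have E1: "form (e - 1) E1" by (rule quadratic_along_derivative_form[OF Q])
  have "form (1 + (e - 1)) (\<lambda>v. k v * E1 v)" by (rule form_mult[OF k E1])
  then have "form e (\<lambda>v. 1 / 2 * (k v * E1 v))" using e by (intro form_cmult) simp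
  then have "form e (\<lambda>v. n v + 1 / 2 * (k v * E1 v))" by (rule form_add[OF n])
  then have "form (e + 1) (\<lambda>v. (n v + 1 / 2 * (k v * E1 v)) * v $ i)" by (rule form_mult[OF _ form_coord])
  moreover have "form (e + 1) (\<lambda>v. q $ i * (k v * E v))"
    using form_mult[OF k fE] by (intro form_cmult) simp
  ultimately have "form (e + 1) (\<lambda>v. (n v + 1 / 2 * (k v * E1 v)) * v $ i - q $ i * (k v * E v))"
    by (rule form_diff)
  moreover have "(n v + 1 / 2 * (k v * E1 v)) * v $ i - q $ i * (k v * E v) = pencil_map q E E1 n k v $ i" for v
    by (simp add: pencil_map_def algebra_simps)
  ultimately show ?thesis by simp
qed

text \<open>
  At a vector where \<open>k\<close> vanishes but \<open>n\<close> does not the map is the identity, so the composite of the two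
  triples is not zero.
\<close>

lemma pencil_map_birational:
  assumes Q: "quadratic_along q e E E1 E2"
    and n: "form e n" "\<And>v t. n (v + t *s q) = n v"
    and k: "form 1 k" "\<And>v t. k (v + t *s q) = k v"
    and x: "k x = 0" "n x \<noteq> 0"
  obtains f where "birational f"
    "\<And>v. v \<noteq> 0 \<Longrightarrow> pencil_map q E E1 n k v \<noteq> 0 \<Longrightarrow>
       f (abs_proj_plane v) = Some (abs_proj_plane (pencil_map q E E1 n k v))"
proof -
  let ?k = "\<lambda>v. - k v"
  define F where "F = pencil_map q E E1 n k"
  define G where "G = pencil_map q E E1 n ?k"
  have k': "form 1 ?k" "\<And>v t. ?k (v + t *s q) = ?k v"
    using form_cmult[OF k(1), of "-1"] k(2) by simp_all
  have fF: "form (e + 1) (\<lambda>v. F v $ i)" for i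
    unfolding F_def by (rule form_pencil_map[OF Q n(1) k(1)])
  have fG: "form (e + 1) (\<lambda>v. G v $ i)" for i
    unfolding G_def by (rule form_pencil_map[OF Q n(1) k'(1)])
  have e0: "e > 0" using Q by (simp add: quadratic_along_def)
  have "x \<noteq> 0" using x(2) form_scale[OF n(1), of 0 x] e0 by (auto simp: power_0_left)
  have Fx: "F x = n x *s x" "G x = n x *s x" by (simp_all add: F_def G_def pencil_map_def x)
  then have nz: "F x \<noteq> 0" "G x \<noteq> 0" using x(2) \<open>x \<noteq> 0\<close> by (simp_all add: vector_mul_eq_0)
  obtain f where f: "rational_map f"
    "\<And>v. v \<noteq> 0 \<Longrightarrow> F v \<noteq> 0 \<Longrightarrow> f (abs_proj_plane v) = Some (abs_proj_plane (F v))"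
    using rational_map_of_forms[OF fF nz(1)] by metis
  obtain g where g: "rational_map g"
    "\<And>v. v \<noteq> 0 \<Longrightarrow> G v \<noteq> 0 \<Longrightarrow> g (abs_proj_plane v) = Some (abs_proj_plane (G v))"
    using rational_map_of_forms[OF fG nz(2)] by metis
  have inverse: "generic_inverse f' g'"
    if f': "\<And>v. v \<noteq> 0 \<Longrightarrow> F' v \<noteq> 0 \<Longrightarrow> f' (abs_proj_plane v) = Some (abs_proj_plane (F' v))"
      and g': "\<And>v. v \<noteq> 0 \<Longrightarrow> G' v \<noteq> 0 \<Longrightarrow> g' (abs_proj_plane v) = Some (abs_proj_plane (G' v))"
      and forms: "\<And>i. form (e + 1) (\<lambda>v. F' v $ i)" "\<And>i. form (e + 1) (\<lambda>v. G' v $ i)"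
      and c: "\<And>v. G' (F' v) = c v *s v" "c x \<noteq> 0"
    for f' g' F' G' c
    unfolding generic_inverse_def
  proof (rule generic_forms_nonzero)
    show "form ((e + 1) * (e + 1)) (\<lambda>v. G' (F' v) $ i)" for i
      by (rule form_compose[OF forms(2) forms(1)])
    show "G' (F' x) \<noteq> 0" using c \<open>x \<noteq> 0\<close> by (simp add: vector_mul_eq_0)
    fix v :: "complex ^ 3" assume v: "v \<noteq> 0" "G' (F' v) \<noteq> 0"
    have "G' 0 $ i = 0" for i using form_scale[OF forms(2)[of i], of 0 0] by simp
    then have "G' 0 = 0" by (simp add: vec_eq_iff)
    then have "F' v \<noteq> 0" using v(2) by auto
    moreover have "abs_proj_plane (G' (F' v)) = abs_proj_plane v"
      using v by (metis abs_scale c(1) vector_smult_lzero)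
    ultimately show "\<exists>q. f' (abs_proj_plane v) = Some q \<and> g' q = Some (abs_proj_plane v)"
      using f' g' v by auto
  qed
  have cx: "(n x + k x * E1 x / 2) ^ e * ((n x)\<^sup>2 - (k x)\<^sup>2 * ((E1 x)\<^sup>2 / 4 - E x * E2 x)) \<noteq> 0"
    "(n x + - k x * E1 x / 2) ^ e * ((n x)\<^sup>2 - (- k x)\<^sup>2 * ((E1 x)\<^sup>2 / 4 - E x * E2 x)) \<noteq> 0"
    using x by simp_all
  have "generic_inverse f g"
    by (rule inverse[OF f(2) g(2) fF fG pencil_map_composite[OF Q n k, folded F_def G_def] cx(1)])
  moreover have "F = pencil_map q E E1 n (\<lambda>v. - ?k v)" by (simp add: F_def)
  moreover define c where "c v = (n v + - k v * E1 v / 2) ^ e *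
      ((n v)\<^sup>2 - (- k v)\<^sup>2 * ((E1 v)\<^sup>2 / 4 - E v * E2 v))" for v
  ultimately have FG: "\<And>v. F (G v) = c v *s v"
    using pencil_map_composite[OF Q n k', folded G_def] by simp
  have "c x \<noteq> 0" using cx(2) by (simp add: c_def)
  then have "generic_inverse g f"
    using inverse[where f' = g and g' = f and F' = G and G' = F and c = c] g(2) f(2) fG fF FG by blast
  with \<open>generic_inverse f g\<close> have "birational f" using birationalI f(1) g(1) by blast
  then show ?thesis using that f(2) by (simp add: F_def)
qed

definition collinear_with :: "complex ^ 3 \<Rightarrow> proj_plane \<Rightarrow> proj_plane \<Rightarrow> bool" where
  "collinear_with q x y \<longleftrightarrow> det3 q (rep_proj_plane x) (rep_proj_plane y) = 0"

lemma collinear_with_abs: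
  assumes "v \<noteq> 0" "w \<noteq> 0"
  shows "collinear_with q (abs_proj_plane v) (abs_proj_plane w) \<longleftrightarrow> det3 q v w = 0"
proof -
  obtain c where "c \<noteq> 0" "rep_proj_plane (abs_proj_plane v) = c *s v" using rep_abs[OF assms(1)] .
  moreover obtain c where "c \<noteq> 0" "rep_proj_plane (abs_proj_plane w) = c *s w" using rep_abs[OF assms(2)] .
  ultimately show ?thesis by (simp add: collinear_with_def)
qed

text \<open>
  Preservation of the lines through \<open>q\<close> is required at generic points only; it is a polynomial identity
  in the components of the map, so it extends to all points where the map is defined.
\<close>

definition pencil_fixers :: "proj_plane set \<Rightarrow> complex ^ 3 \<Rightarrow> (proj_plane \<rightharpoonup> proj_plane) set" where
  "pencil_fixers D q = {f \<in> fixers D. generic (\<lambda>x. \<exists>y. f x = Some y \<and> collinear_with q x y)}"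

lemma linear_form_shift: "form 1 l \<Longrightarrow> l q = 0 \<Longrightarrow> l (v + t *s q) = l v"
  by (simp add: form_1_add form_scale)

lemma linear_form_nonzero:
  assumes "form 1 l" "l q = 0" "l v \<noteq> 0" "q \<noteq> 0"
  shows "v \<noteq> 0" "\<not> parallel q v"
proof -
  show v: "v \<noteq> 0" using assms(3) form_scale[OF assms(1), of 0 0] by auto
  show "\<not> parallel q v"
  proof
    assume "parallel q v"
    then obtain c where "v = c *s q" using parallel_iff[OF assms(4) v] abs_eq_iff[OF assms(4) v] by blast
    then show False using assms by (simp add: form_scale)
  qed
qed

lemma curve_point_off_center:
  assumes "irreducible_curve D" "q \<noteq> 0"
  obtains z l where "z \<noteq> 0" "abs_proj_plane z \<in> D" "form 1 l" "l q = 0" "l z \<noteq> 0"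
proof -
  have "infinite (D - {abs_proj_plane q})" using irreducible_curve_infinite[OF assms(1)] by simp
  then have "D - {abs_proj_plane q} \<noteq> {}" by (rule infinite_imp_nonempty)
  then obtain p where p: "p \<in> D" "p \<noteq> abs_proj_plane q" by blast
  obtain z where z: "z \<noteq> 0" "p = abs_proj_plane z" using point_cases .
  have "\<not> parallel q z" using parallel_iff[OF assms(2) z(1)] p z by auto
  then obtain x where "det3 q x z \<noteq> 0" using det3_nonzero(2) by blast
  then show ?thesis using that[OF z(1) _ form_det3(1), of q x] p(1) z(2) by simp
qed

lemma irreducible_curve_finite_zeros:
  assumes "irreducible_curve D" "form e g" "y \<noteq> 0" "abs_proj_plane y \<in> D" "g y \<noteq> 0"
  shows "finite {x \<in> D. \<exists>v. v \<noteq> 0 \<and> x = abs_proj_plane v \<and> g v = 0}"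
proof -
  obtain G where G: "g = eval3 G" "homogeneous e G" using form_obtain_poly[OF assms(2)] .
  have "finite {x \<in> D. vanishes G x}"
    using irreducible_curve_subset[OF assms(1) G(2), of "abs_proj_plane y"] assms(3-5)
      vanishes_abs[OF G(2) assms(3)] by (auto simp: G(1))
  then show ?thesis
    by (rule finite_subset[rotated]) (auto simp: vanishes_abs[OF G(2)] G(1))
qed

text \<open>
  For \<open>k\<close> a multiple of the form that cuts out the line joining \<open>q\<close> and \<open>x\<close>, the map fixes that line
  pointwise, while on the line joining \<open>q\<close> and \<open>y\<close> the multiple can be adjusted to move \<open>y\<close> to almost any
  prescribed point. The vector \<open>z\<close> on the curve witnesses that the map fixes almost all of the curve:
  the coefficient of \<open>v\<close> in the map must not vanish identically on \<open>D\<close>.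
\<close>

lemma pencil_fixers_move:
  assumes D: "irreducible_curve D" "\<And>v. v \<noteq> 0 \<Longrightarrow> abs_proj_plane v \<in> D \<Longrightarrow> E v = 0"
    and Q: "quadratic_along q e E E1 E2"
    and l: "form 1 l" "l q = 0" "l x \<noteq> 0" "l y \<noteq> 0" "l z \<noteq> 0"
    and z: "z \<noteq> 0" "abs_proj_plane z \<in> D"
    and y: "E y \<noteq> 0" "det3 q x y \<noteq> 0"
  shows "finite {s. \<not> (\<exists>f\<in>pencil_fixers D q. f (abs_proj_plane x) = Some (abs_proj_plane x) \<and>
     f (abs_proj_plane y) = Some (abs_proj_plane (y + s *s q)))}"
proof -
  define n where "n v = l v ^ e" for v
  have e0: "e \<ge> 2" using Q by (simp add: quadratic_along_def)
  have n: "form e n" using form_power[OF l(1), of e] by (simp add: n_def[abs_def])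
  have lq: "l (v + t *s q) = l v" for v t using l(1,2) by (simp add: form_1_add form_scale)
  then have nq: "n (v + t *s q) = n v" for v t by (simp add: n_def)
  have l0: "v \<noteq> 0" if "l v \<noteq> 0" for v using that form_scale[OF l(1), of 0 0] by auto
  have n_nz: "n x \<noteq> 0" "n y \<noteq> 0" "n z \<noteq> 0" using l by (simp_all add: n_def)
  define \<delta> where "\<delta> v = det3 q x v" for v
  have \<delta>q: "\<delta> (v + t *s q) = \<delta> v" for v t by (simp add: \<delta>_def)
  define la where "la = \<delta> y * E1 y / 2"
  define \<mu> where "\<mu> = \<delta> y * E y"
  define lz where "lz = \<delta> z * E1 z / 2"
  have \<mu>: "\<mu> \<noteq> 0" using y by (simp add: \<mu>_def \<delta>_def)
  have moves: "\<exists>f\<in>pencil_fixers D q. f (abs_proj_plane x) = Some (abs_proj_plane x) \<and>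
     f (abs_proj_plane y) = Some (abs_proj_plane (y + s *s q))"
    if s: "\<mu> + s * la \<noteq> 0" "n z * (\<mu> + s * la) - s * n y * lz \<noteq> 0" for s
  proof -
    \<comment> \<open>the solution of \<open>- c * \<mu> = s * (n y + c * la)\<close>, which says that \<open>y\<close> moves to \<open>y + s *s q\<close>\<close>
    define c where "c = - s * n y / (\<mu> + s * la)"
    define k where "k v = c * \<delta> v" for v
    have k: "form 1 k" "\<And>v t. k (v + t *s q) = k v"
      using form_cmult[OF form_det3(1)] by (simp_all add: k_def[abs_def] \<delta>_def[abs_def])
    have kx: "k x = 0" by (simp add: k_def \<delta>_def)
    define F where "F = pencil_map q E E1 n k"
    obtain f where f: "birational f"
      "\<And>v. v \<noteq> 0 \<Longrightarrow> F v \<noteq> 0 \<Longrightarrow> f (abs_proj_plane v) = Some (abs_proj_plane (F v))"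
      using pencil_map_birational[OF Q n nq k kx n_nz(1)] unfolding F_def by metis
    have Fx: "F x = n x *s x" by (simp add: F_def pencil_map_def kx)
    have fx: "f (abs_proj_plane x) = Some (abs_proj_plane x)"
      using f(2)[OF l0[OF l(3)]] l0[OF l(3)] n_nz by (simp add: Fx vector_mul_eq_0 abs_scale)
    define \<alpha> where "\<alpha> = n y + c * la"
    have \<alpha>: "\<alpha> = n y * \<mu> / (\<mu> + s * la)" using s(1) by (simp add: \<alpha>_def c_def field_simps)
    have "c * \<mu> = - s * \<alpha>" unfolding \<alpha> by (simp add: c_def)
    moreover have "F y = \<alpha> *s y - (c * \<mu>) *s q"
      by (simp add: F_def pencil_map_def k_def la_def \<mu>_def \<alpha>_def mult.assoc)
    ultimately have Fy: "F y = \<alpha> *s (y + s *s q)" by (simp add: vec_eq_iff algebra_simps)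
    have ys: "y + s *s q \<noteq> 0" by (rule l0) (simp add: lq l)
    have \<alpha>0: "\<alpha> \<noteq> 0" unfolding \<alpha> using n_nz \<mu> s by simp
    have "F y \<noteq> 0" unfolding Fy using ys \<alpha>0 by (simp only: vector_mul_eq_0 simp_thms)
    from f(2)[OF l0[OF l(4)] this] have fy: "f (abs_proj_plane y) = Some (abs_proj_plane (y + s *s q))"
      unfolding Fy abs_scale[OF ys \<alpha>0] .
    have fF: "form (e + 1) (\<lambda>v. F v $ i)" for i
      unfolding F_def by (rule form_pencil_map[OF Q n k(1)])
    have gen: "generic (\<lambda>x. \<exists>y. f x = Some y \<and> collinear_with q x y)"
    proof (rule generic_forms_nonzero[OF fF])
      show "F x \<noteq> 0" using l0 l n_nz by (simp add: Fx vector_mul_eq_0)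
      fix v :: "complex ^ 3" assume v: "v \<noteq> 0" "F v \<noteq> 0"
      have "det3 q v (F v) = 0" by (simp add: F_def pencil_map_def)
      then show "\<exists>y. f (abs_proj_plane v) = Some y \<and> collinear_with q (abs_proj_plane v) y"
        using f(2) v by (simp add: collinear_with_abs)
    qed
    define a where "a v = n v + 1 / 2 * (k v * E1 v)" for v
    have "form (e - 1) E1" by (rule quadratic_along_derivative_form[OF Q])
    from form_mult[OF k(1) this] have "form e (\<lambda>v. k v * E1 v)" using e0 by simp
    then have a: "form e a" unfolding a_def[abs_def] by (intro form_add form_cmult n)
    have "n z + c * lz = (n z * (\<mu> + s * la) - s * n y * lz) / (\<mu> + s * la)"
      using s(1) by (simp add: c_def field_simps)
    then have "n z + c * lz \<noteq> 0" using s by simp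
    moreover have "a z = n z + c * lz" by (simp add: a_def k_def lz_def)
    ultimately have "a z \<noteq> 0" by simp
    then have fin: "finite {x \<in> D. \<exists>v. v \<noteq> 0 \<and> x = abs_proj_plane v \<and> a v = 0}"
      using irreducible_curve_finite_zeros[OF D(1) a z] by blast
    have "finite {x \<in> D. f x \<noteq> Some x}"
      using fin
    proof (rule finite_subset[rotated], intro subsetI CollectI conjI)
      fix p assume p: "p \<in> {x \<in> D. f x \<noteq> Some x}"
      then show "p \<in> D" by blast
      obtain v where v: "v \<noteq> 0" "p = abs_proj_plane v" using point_cases .
      have "E v = 0" using D(2) v p by blast
      then have "F v = a v *s v" by (simp add: F_def pencil_map_def a_def)
      then have "a v = 0" using p f(2)[OF v(1)] v by (auto simp: vector_mul_eq_0 abs_scale)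
      then show "\<exists>v. v \<noteq> 0 \<and> p = abs_proj_plane v \<and> a v = 0" using v by blast
    qed
    then have "f \<in> pencil_fixers D q" using f(1) gen by (simp add: pencil_fixers_def fixers_def)
    then show ?thesis using fx fy by blast
  qed
  define p where "p = [:\<mu>, la:] * [:n z * \<mu>, n z * la - n y * lz:]"
  have "p \<noteq> 0" using \<mu> n_nz by (simp add: p_def)
  then have "finite {s. poly p s = 0}" by (rule poly_roots_finite)
  moreover have "poly p s = (\<mu> + s * la) * (n z * (\<mu> + s * la) - s * n y * lz)" for s
    by (simp add: p_def algebra_simps)
  ultimately show ?thesis
    using moves by (elim finite_subset[rotated]) auto
qed

section \<open>Pencils preserved by maps that fix a curve\<close>

text \<open>
  After cancelling the common factor, the fraction of the polynomials \<open>u\<close> and \<open>v\<close> is a nonconstant rational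
  function: it takes every value except possibly one, and only finitely many of these values exclusively at points of \<open>B\<close>.
\<close>

lemma finite_missed_values:
  fixes u v :: "complex poly"
  assumes "finite B" and nonprop: "poly u s * poly v t \<noteq> poly u t * poly v s"
  shows "finite {c. \<forall>t. poly u t = c * poly v t \<longrightarrow> t \<in> B}"
proof -
  define d where "d = gcd u v"
  have "d \<noteq> 0" using nonprop by (auto simp: d_def)
  obtain u1 v1 where uv: "u = u1 * d" "v = v1 * d" "coprime u1 v1"
    using gcd_coprime_exists[of u v] \<open>d \<noteq> 0\<close> unfolding d_def by blast
  have v1: "poly v1 t \<noteq> 0" if "poly u1 t = c * poly v1 t" for c t
  proof
    assume "poly v1 t = 0"
    moreover from this have "poly u1 t = 0" using that by simp
    ultimately have "[:- t, 1:] dvd u1" "[:- t, 1:] dvd v1" by (simp_all add: poly_eq_0_iff_dvd)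
    then have "is_unit [:- t, 1:]" using uv(3) by (rule coprime_common_divisor[rotated])
    then show False by (auto simp: is_unit_iff_degree)
  qed
  have subset: "{c. \<forall>t. poly u t = c * poly v t \<longrightarrow> t \<in> B} \<subseteq>
     {c. degree (u1 - smult c v1) = 0} \<union> (\<lambda>t. poly u1 t / poly v1 t) ` B"
  proof
    fix c assume c: "c \<in> {c. \<forall>t. poly u t = c * poly v t \<longrightarrow> t \<in> B}"
    show "c \<in> {c. degree (u1 - smult c v1) = 0} \<union> (\<lambda>t. poly u1 t / poly v1 t) ` B"
    proof (cases "degree (u1 - smult c v1) = 0")
      case False
      then have "\<not> constant (poly (u1 - smult c v1))" by (simp only: constant_degree not_False_eq_True)
      from fundamental_theorem_of_algebra[OF this]
      obtain t where t: "poly (u1 - smult c v1) t = 0" ..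
      then have *: "poly u1 t = c * poly v1 t" by simp
      then have "t \<in> B" using c by (auto simp: uv)
      moreover have "c = poly u1 t / poly v1 t" using * v1[OF *] by simp
      ultimately show ?thesis by blast
    qed auto
  qed
  have single: "c = c'" if c: "degree (u1 - smult c v1) = 0" "degree (u1 - smult c' v1) = 0" for c c'
  proof (rule ccontr)
    assume ne: "c \<noteq> c'"
    obtain a where a: "u1 - smult c v1 = [:a:]" using c(1) degree_0_id by metis
    obtain b where b: "u1 - smult c' v1 = [:b:]" using c(2) degree_0_id by metis
    have ab: "poly u1 x - c * poly v1 x = a" "poly u1 x - c' * poly v1 x = b" for x
      using arg_cong[OF a, of "\<lambda>p. poly p x"] arg_cong[OF b, of "\<lambda>p. poly p x"] by simp_all
    have "(c' - c) * poly v1 s = (c' - c) * poly v1 t"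
      using ab[of s] ab[of t] by (simp add: algebra_simps) (metis add_diff_cancel_left' add.commute diff_add_eq)
    then have "poly v1 s = poly v1 t" using ne by simp
    moreover from this have "poly u1 s = poly u1 t" using ab(1)[of s] ab(1)[of t] by (metis diff_add_cancel)
    ultimately show False using nonprop by (simp add: uv)
  qed
  have "finite {c. degree (u1 - smult c v1) = 0}"
  proof (cases "\<exists>c. degree (u1 - smult c v1) = 0")
    case True
    then obtain c where "degree (u1 - smult c v1) = 0" ..
    then have "{c. degree (u1 - smult c v1) = 0} \<subseteq> {c}" using single by blast
    then show ?thesis by (rule finite_subset) simp
  next
    case False
    then have "{c. degree (u1 - smult c v1) = 0} = {}" by blast
    then show ?thesis by (simp only: finite.emptyI)
  qed
  then show ?thesis using assms(1) by (intro finite_subset[OF subset]) simp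
qed

lemma poly_fun_common_nonzero:
  assumes "finite S" "\<And>f. f \<in> S \<Longrightarrow> poly_fun f \<and> (\<exists>v. f v \<noteq> 0)"
  obtains v where "\<And>f. f \<in> S \<Longrightarrow> f v \<noteq> 0"
proof -
  have "poly_fun (\<lambda>v. \<Prod>f\<in>S. f v) \<and> (\<exists>v. (\<Prod>f\<in>S. f v) \<noteq> 0)"
    using assms
  proof (induction S rule: finite_induct)
    case (insert f S)
    then have "poly_fun f" "\<exists>v. f v \<noteq> 0" "poly_fun (\<lambda>v. \<Prod>f\<in>S. f v)" "\<exists>v. (\<Prod>f\<in>S. f v) \<noteq> 0" by auto
    then show ?case
      using insert.hyps poly_fun_nonzero_mult[of f "\<lambda>v. \<Prod>f\<in>S. f v"]
      by (simp add: poly_fun_mult)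
  qed simp
  then show ?thesis using that assms(1) by (metis prod_zero)
qed

lemma poly_fun_line_zero:
  fixes x y :: "complex ^ 3"
  assumes "poly_fun f" "finite S" "\<And>t. t \<notin> S \<Longrightarrow> f (x + t *s y) = 0"
  shows "f (x + t *s y) = 0"
proof (rule ccontr)
  assume "f (x + t *s y) \<noteq> 0"
  then have "finite {t. f (x + t *s y) = 0}" using poly_fun_line_finite assms(1) by blast
  moreover have "UNIV = S \<union> {t. f (x + t *s y) = 0}" using assms(3) by auto
  ultimately show False using assms(2) infinite_UNIV_char_0[where 'a = complex] by (metis finite_Un)
qed

text \<open>
  The fraction \<open>g / h\<close> describes a pencil of curves. Suppose that each map in question sends curves of this
  pencil into curves of it, and that \<open>g / h\<close> is not constant on the generic line through \<open>q\<close>. Then \<open>g / h\<close>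
  takes the same value at some vector \<open>y\<close> on such a line and at a generic vector \<open>x1\<close>. There are maps
  that fix \<open>x1\<close> and move \<open>y\<close> to almost any other point of its line, so \<open>g / h\<close> would be constant on that
  line after all. Hence every preserved pencil is composed of the lines through \<open>q\<close>. The form \<open>b\<close> leaves room for
  exceptional curves.
\<close>

lemma preserved_pencil_constant:
  assumes D: "irreducible_curve D" "\<And>v. v \<noteq> 0 \<Longrightarrow> abs_proj_plane v \<in> D \<Longrightarrow> E v = 0"
    and Q: "quadratic_along q e E E1 E2" "q \<noteq> 0"
    and gh: "form m g" "form m h" "\<exists>v. h v \<noteq> 0" and b: "form k b" "\<exists>v. b v \<noteq> 0"
    and pres: "\<And>f v w v' w'. f \<in> pencil_fixers D q \<Longrightarrow> v \<noteq> 0 \<Longrightarrow> w \<noteq> 0 \<Longrightarrow> v' \<noteq> 0 \<Longrightarrow> w' \<noteq> 0 \<Longrightarrow>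
       f (abs_proj_plane v) = Some (abs_proj_plane v') \<Longrightarrow> f (abs_proj_plane w) = Some (abs_proj_plane w') \<Longrightarrow>
       b v \<noteq> 0 \<Longrightarrow> b w \<noteq> 0 \<Longrightarrow> b v' \<noteq> 0 \<Longrightarrow> b w' \<noteq> 0 \<Longrightarrow> h v \<noteq> 0 \<Longrightarrow> h w \<noteq> 0 \<Longrightarrow>
       g v * h w = g w * h v \<Longrightarrow> g v' * h w' = g w' * h v'"
  shows "g v * h (v + t *s q) = g (v + t *s q) * h v"
proof (rule ccontr)
  define W where "W x = g x * h (x + t *s q) - g (x + t *s q) * h x" for x
  assume "g v * h (v + t *s q) \<noteq> g (v + t *s q) * h v"
  then have Wv: "\<exists>v. W v \<noteq> 0" unfolding W_def by (metis eq_iff_diff_eq_0)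
  have shift: "poly_fun (\<lambda>x. f (x + t *s q))" if "form m f" for f
    by (rule poly_fun_compose[OF form_poly_fun[OF that]]) (auto intro!: poly_fun_add)
  have W: "poly_fun W" unfolding W_def
    by (intro poly_fun_diff poly_fun_mult shift) (use gh form_poly_fun in auto)
  have E: "poly_fun E" "\<exists>v. E v \<noteq> 0" using Q form_poly_fun by (auto simp: quadratic_along_def)
  obtain z l where z: "z \<noteq> 0" "abs_proj_plane z \<in> D" and l: "form 1 l" "l q = 0" "l z \<noteq> 0"
    by (rule curve_point_off_center[OF D(1) Q(2)])
  have pl: "poly_fun l" "\<exists>v. l v \<noteq> 0" using l form_poly_fun by blast+
  note lq = linear_form_shift[OF l(1,2)]
  have l0: "v \<noteq> 0" if "l v \<noteq> 0" for v by (rule linear_form_nonzero(1)[OF l(1,2) that Q(2)])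
  have pg: "poly_fun g" "poly_fun h" "poly_fun b" using gh b form_poly_fun by blast+
  obtain x0 where "\<And>f. f \<in> {W, h, b, E, l} \<Longrightarrow> f x0 \<noteq> 0"
    by (rule poly_fun_common_nonzero[of "{W, h, b, E, l}"]) (use W Wv gh b E pl pg in auto)
  then have x0: "W x0 \<noteq> 0" "h x0 \<noteq> 0" "b x0 \<noteq> 0" "E x0 \<noteq> 0" "l x0 \<noteq> 0" by auto
  have fin: "finite {s. f (x0 + s *s q) = 0}" if "poly_fun f" "f x0 \<noteq> 0" for f
    by (rule poly_fun_line_finite[OF that(1), of _ 0]) (use that in simp)
  define B where "B = {s. h (x0 + s *s q) = 0} \<union> {s. b (x0 + s *s q) = 0} \<union> {s. E (x0 + s *s q) = 0}"
  have "finite B" using fin pg E x0 by (simp add: B_def)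
  obtain gp where gp: "\<forall>s. poly gp s = g (x0 + s *s q)" using poly_fun_line pg by blast
  obtain hp where hp: "\<forall>s. poly hp s = h (x0 + s *s q)" using poly_fun_line pg by blast
  define X where "X = {c. \<forall>s. poly gp s = c * poly hp s \<longrightarrow> s \<in> B}"
  have "poly gp 0 * poly hp t \<noteq> poly gp t * poly hp 0" using x0(1) by (simp add: W_def gp hp)
  then have "finite X" unfolding X_def by (rule finite_missed_values[OF \<open>finite B\<close>])
  have l0': "\<not> parallel q x0" by (rule linear_form_nonzero(2)[OF l(1,2) x0(5) Q(2)])
  have nonprop: "\<exists>v. g v - c * h v \<noteq> 0" for c
  proof (rule ccontr)
    assume "\<nexists>v. g v - c * h v \<noteq> 0"
    then have "g v = c * h v" for v by simp
    then show False using x0(1) by (simp add: W_def)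
  qed
  define S where "S = {h, b, l, (\<lambda>x. det3 q x x0)} \<union> (\<lambda>c v. g v - c * h v) ` X"
  obtain x1 where x1S: "\<And>f. f \<in> S \<Longrightarrow> f x1 \<noteq> 0"
  proof (rule poly_fun_common_nonzero)
    show "finite S" using \<open>finite X\<close> by (simp add: S_def)
    have "poly_fun (\<lambda>v. g v - c * h v)" for c by (intro poly_fun_diff poly_fun_mult poly_fun_const pg)
    then show "poly_fun f \<and> (\<exists>v. f v \<noteq> 0)" if "f \<in> S" for f
      using that gh(3) b(2) pl pg nonprop det3_nonzero(2)[OF l0'] form_poly_fun[OF form_det3(2)]
      by (auto simp: S_def)
  qed (rule that)
  have x1: "h x1 \<noteq> 0" "b x1 \<noteq> 0" "l x1 \<noteq> 0" "det3 q x1 x0 \<noteq> 0"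
    using x1S[of h] x1S[of b] x1S[of l] x1S[of "\<lambda>x. det3 q x x0"] by (simp_all add: S_def)
  have x1X: "g x1 - c * h x1 \<noteq> 0" if "c \<in> X" for c
    using that x1S[of "\<lambda>v. g v - c * h v"] unfolding S_def by blast
  define c where "c = g x1 / h x1"
  have "c \<notin> X" using x1X[of c] x1 by (auto simp: c_def)
  then obtain s0 where s0: "g (x0 + s0 *s q) = c * h (x0 + s0 *s q)" "s0 \<notin> B"
    unfolding X_def gp[rule_format] hp[rule_format] by blast
  define y where "y = x0 + s0 *s q"
  have y: "h y \<noteq> 0" "b y \<noteq> 0" "E y \<noteq> 0" "l y \<noteq> 0" "det3 q x1 y \<noteq> 0" "g y = c * h y"
    using s0 x0 x1 by (auto simp: B_def y_def lq)
  define Z where "Z = {s. \<not> (\<exists>f\<in>pencil_fixers D q. f (abs_proj_plane x1) = Some (abs_proj_plane x1) \<and>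
     f (abs_proj_plane y) = Some (abs_proj_plane (y + s *s q)))}"
  have "finite Z"
    unfolding Z_def by (rule pencil_fixers_move[OF D Q(1) l(1,2) x1(3) y(4) l(3) z(1,2) y(3,5)])
  moreover have "finite {s. b (y + s *s q) = 0}"
    by (rule poly_fun_line_finite[OF pg(3), of _ 0]) (use y in simp)
  ultimately have fin: "finite (Z \<union> {s. b (y + s *s q) = 0})" by simp
  define K where "K v = g v - c * h v" for v
  have pK: "poly_fun K" unfolding K_def by (intro poly_fun_diff poly_fun_mult poly_fun_const pg)
  have "K (y + s *s q) = 0" if s: "s \<notin> Z \<union> {s. b (y + s *s q) = 0}" for s
  proof -
    obtain f where f: "f \<in> pencil_fixers D q" "f (abs_proj_plane x1) = Some (abs_proj_plane x1)"
      "f (abs_proj_plane y) = Some (abs_proj_plane (y + s *s q))"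
      using s unfolding Z_def by blast
    have "y + s *s q \<noteq> 0" by (rule l0) (simp add: lq y)
    moreover have "g y * h x1 = g x1 * h y" using x1(1) y(6) by (simp add: c_def)
    moreover have "b (y + s *s q) \<noteq> 0" using s by simp
    ultimately have "g (y + s *s q) * h x1 = g x1 * h (y + s *s q)"
      using pres[OF f(1) l0[OF y(4)] l0[OF x1(3)] _ l0[OF x1(3)] f(3,2)] x1(1,2) y(1,2) by blast
    then show ?thesis using x1(1) by (simp add: K_def c_def field_simps)
  qed
  then have "K (y + s *s q) = 0" for s using poly_fun_line_zero[OF pK fin] by blast
  moreover have "y + (s - s0) *s q = x0 + s *s q" for s by (simp add: y_def vec_eq_iff algebra_simps)
  ultimately have "K (x0 + s *s q) = 0" for s by metis
  then have "g (x0 + s *s q) = c * h (x0 + s *s q)" for s by (simp add: K_def)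
  from this[of 0] this[of t] show False using x0(1) by (simp add: W_def)
qed

text \<open>
  The points to which a given vector can be moved distinguish infinitely many maps.
\<close>

lemma infinite_fixers:
  assumes D: "irreducible_curve D" "\<And>v. v \<noteq> 0 \<Longrightarrow> abs_proj_plane v \<in> D \<Longrightarrow> E v = 0"
    and Q: "quadratic_along q e E E1 E2" "q \<noteq> 0"
  shows "infinite (fixers D)"
proof
  assume finD: "finite (fixers D)"
  have E: "poly_fun E" "\<exists>v. E v \<noteq> 0" using Q form_poly_fun by (auto simp: quadratic_along_def)
  obtain z l where z: "z \<noteq> 0" "abs_proj_plane z \<in> D" and l: "form 1 l" "l q = 0" "l z \<noteq> 0"
    by (rule curve_point_off_center[OF D(1) Q(2)])
  note lq = linear_form_shift[OF l(1,2)]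
  have l0: "v \<noteq> 0" if "l v \<noteq> 0" for v by (rule linear_form_nonzero(1)[OF l(1,2) that Q(2)])
  obtain y where "\<And>f. f \<in> {E, l} \<Longrightarrow> f y \<noteq> 0"
    by (rule poly_fun_common_nonzero[of "{E, l}"]) (use E l form_poly_fun in auto)
  then have y: "E y \<noteq> 0" "l y \<noteq> 0" by auto
  have "\<not> parallel q y" by (rule linear_form_nonzero(2)[OF l(1,2) y(2) Q(2)])
  then obtain x where "\<And>f. f \<in> {l, (\<lambda>x. det3 q x y)} \<Longrightarrow> f x \<noteq> 0"
    using poly_fun_common_nonzero[of "{l, (\<lambda>x. det3 q x y)}"] l form_poly_fun[OF form_det3(2)] form_poly_fun[OF l(1)]
      det3_nonzero(2)[of q y] by (metis (no_types, lifting) empty_iff finite.emptyI finite.insertI insert_iff)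
  then have x: "l x \<noteq> 0" "det3 q x y \<noteq> 0" by auto
  define Z where "Z = {s. \<not> (\<exists>f\<in>pencil_fixers D q. f (abs_proj_plane x) = Some (abs_proj_plane x) \<and>
     f (abs_proj_plane y) = Some (abs_proj_plane (y + s *s q)))}"
  have "finite Z"
    unfolding Z_def by (rule pencil_fixers_move[OF D Q(1) l(1,2) x(1) y(2) l(3) z(1,2) y(1) x(2)])
  have "inj (\<lambda>s. abs_proj_plane (y + s *s q))"
  proof (rule injI)
    fix s t assume "abs_proj_plane (y + s *s q) = abs_proj_plane (y + t *s q)"
    moreover have "y + s *s q \<noteq> 0" for s by (rule l0) (simp add: lq y)
    ultimately obtain c where c: "y + t *s q = c *s (y + s *s q)" using abs_eq_iff by metis
    then have "l (y + t *s q) = c * l (y + s *s q)" using l by (simp only: form_scale) simp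
    then have "c = 1" using y(2) by (simp add: lq)
    then have "t *s q = s *s q" using c by simp
    then show "s = t" using Q(2) by (simp add: vector_mul_rcancel)
  qed
  then have inj: "inj (\<lambda>s. Some (abs_proj_plane (y + s *s q)))" by (simp add: inj_def)
  have "(\<lambda>s. Some (abs_proj_plane (y + s *s q))) ` (- Z) \<subseteq> (\<lambda>f. f (abs_proj_plane y)) ` fixers D"
  proof
    fix w assume "w \<in> (\<lambda>s. Some (abs_proj_plane (y + s *s q))) ` (- Z)"
    then obtain s f where "f \<in> pencil_fixers D q" "f (abs_proj_plane y) = w" unfolding Z_def by blast
    then show "w \<in> (\<lambda>f. f (abs_proj_plane y)) ` fixers D" by (auto simp: pencil_fixers_def)
  qed
  then have "finite ((\<lambda>s. Some (abs_proj_plane (y + s *s q))) ` (- Z))" using finD finite_subset by blast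
  then have "finite (- Z)" using inj by (metis finite_imageD inj_on_subset subset_UNIV)
  then show False using \<open>finite Z\<close> infinite_UNIV_char_0[where 'a = complex] by (metis Compl_partition finite_Un)
qed

text \<open>
  Moving in the directions \<open>q\<close> and \<open>q'\<close> and rescaling connects a generic vector with almost every other one.
\<close>

lemma two_constant_pencils:
  assumes gh: "form m g" "form m h" "\<exists>v. h v \<noteq> 0" and q: "\<not> parallel q q'"
    and c: "\<And>v t. g v * h (v + t *s q) = g (v + t *s q) * h v"
      "\<And>v t. g v * h (v + t *s q') = g (v + t *s q') * h v"
  shows "g v * h w = g w * h v"
proof -
  have pg: "poly_fun g" "poly_fun h" using gh form_poly_fun by blast+
  obtain x where "h x * det3 q q' x \<noteq> 0"
    using poly_fun_nonzero_mult[OF pg(2) form_poly_fun[OF form_det3(1)] gh(3) det3_nonzero(1)[OF q]] by blast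
  then have x: "h x \<noteq> 0" "det3 q q' x \<noteq> 0" by auto
  define \<rho> where "\<rho> = g x / h x"
  define K where "K v = g v - \<rho> * h v" for v
  have K: "form m K" unfolding K_def by (intro form_diff form_cmult gh)
  have K1: "K (x + t *s q) = 0" for t using c(1)[of x t] x(1) by (simp add: K_def \<rho>_def field_simps)
  have K2: "K ((x + s *s q') + t *s q) = 0" for s t
  proof (rule poly_fun_line_zero[OF form_poly_fun[OF K]])
    show "finite {t. h (x + t *s q) = 0}"
      by (rule poly_fun_line_finite[OF pg(2), of _ 0]) (use x in simp)
    fix t assume "t \<notin> {t. h (x + t *s q) = 0}"
    then have t: "h (x + t *s q) \<noteq> 0" by simp
    have "g (x + t *s q) = \<rho> * h (x + t *s q)" using K1[of t] by (simp add: K_def)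
    then have "K ((x + t *s q) + s *s q') = 0"
      using c(2)[of "x + t *s q" s] t by (simp add: K_def)
    then show "K ((x + s *s q') + t *s q) = 0" by (simp add: add_ac)
  qed
  have "K w = 0" if w: "det3 q q' w \<noteq> 0" for w
  proof -
    define a where "a = det3 q q' w / det3 q q' x"
    obtain t s where "w = a *s x + (t *s q + s *s q')" using det3_basis[OF x(2), of w] unfolding a_def by blast
    moreover have "a \<noteq> 0" using w x(2) by (simp add: a_def)
    ultimately have "w = a *s ((x + (s / a) *s q') + (t / a) *s q)"
      by (simp add: vec_eq_iff field_simps)
    then show ?thesis using K2 form_scale[OF K] by (metis mult_zero_right)
  qed
  then have "K w * det3 q q' w = 0" for w by (cases "det3 q q' w = 0") auto
  then have "K w = 0" for w
    using poly_fun_nonzero_mult[OF form_poly_fun[OF K] form_poly_fun[OF form_det3(1)] _ det3_nonzero(1)[OF q]] by blast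
  then show ?thesis by (simp add: K_def)
qed

section \<open>Maps that fix a curve do not all commute\<close>

lemma birational_triple:
  assumes "birational f"
  obtains d F where "homogeneous3 d F" "f = triple_map F"
    "\<And>l k. form k l \<Longrightarrow> \<exists>v. l v \<noteq> 0 \<Longrightarrow> \<exists>v. l (eval_triple F v) \<noteq> 0"
proof -
  obtain d F where F: "homogeneous3 d F" "f = triple_map F"
    using rational_map_form[OF birational_rational[OF assms]] by metis
  have "\<exists>v. l (eval_triple F v) \<noteq> 0" if l: "form k l" "l w \<noteq> 0" for l k w
  proof -
    have "generic (\<lambda>q. \<exists>v. v \<noteq> 0 \<and> q = abs_proj_plane v \<and> l v \<noteq> 0)"
      by (rule genericI[OF l]) auto
    from generic_pullback[OF assms this] obtain p v where
      pv: "f p = Some (abs_proj_plane v)" "v \<noteq> 0" "l v \<noteq> 0" by (rule generic_ex) blast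
    obtain x where x: "x \<noteq> 0" "p = abs_proj_plane x" using point_cases .
    have Fx: "eval_triple F x \<noteq> 0" "abs_proj_plane (eval_triple F x) = abs_proj_plane v"
      using pv(1) triple_map_abs[OF F(1) x(1)] F(2) x(2) by (auto split: if_splits)
    then obtain c where "c \<noteq> 0" "v = c *s eval_triple F x" using abs_eq_iff[OF Fx(1) pv(2)] by auto
    then show ?thesis using pv(3) l(1) by (auto simp: form_scale)
  qed
  then show ?thesis using that[OF F] by blast
qed

lemma triple_map_value:
  assumes "homogeneous3 d F" "v \<noteq> 0" "w \<noteq> 0" "triple_map F (abs_proj_plane v) = Some (abs_proj_plane w)"
  obtains c where "c \<noteq> 0" "w = c *s eval_triple F v" "eval_triple F v \<noteq> 0"
proof -
  have "eval_triple F v \<noteq> 0" "abs_proj_plane (eval_triple F v) = abs_proj_plane w"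
    using assms(4) triple_map_abs[OF assms(1,2)] by (auto split: if_splits)
  then show ?thesis using that abs_eq_iff[OF _ assms(3)] by metis
qed

lemma generic_imp_zero:
  assumes "generic P" "poly_fun K" "\<And>v. v \<noteq> 0 \<Longrightarrow> P (abs_proj_plane v) \<Longrightarrow> K v = 0"
  shows "K v = 0"
proof (rule ccontr)
  assume Kv: "K v \<noteq> 0"
  obtain d f where f: "form d f" "\<exists>v. f v \<noteq> 0" "\<And>v. v \<noteq> 0 \<Longrightarrow> f v \<noteq> 0 \<Longrightarrow> P (abs_proj_plane v)"
    using assms(1) unfolding generic_def by blast
  have fK: "poly_fun (\<lambda>v. f v * K v)" using f(1) assms(2) form_poly_fun by blast
  have "\<exists>v. f v * K v \<noteq> 0"
    using poly_fun_nonzero_mult[OF form_poly_fun[OF f(1)] assms(2) f(2)] Kv by blast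
  then obtain w where "w \<noteq> 0" "f w * K w \<noteq> 0" using poly_fun_nonzero_point[OF fK] by blast
  then show False using f(3) assms(3) by auto
qed

lemma proportional_trans:
  fixes a b c d a' b' c' d' :: complex
  assumes "b \<noteq> 0" "d \<noteq> 0" "a * d = c * b" "a * b' = a' * b" "c * d' = c' * d"
  shows "a' * d' = c' * b'"
proof -
  have "a' = (a / b) * b'" "c' = (c / d) * d'" "a / b = c / d" using assms by (simp_all add: field_simps)
  then show ?thesis by simp
qed

text \<open>
  If \<open>\<gamma>\<close> commutes with all maps \<open>f\<close> that preserve the lines through \<open>q\<close> and fix \<open>D\<close>, then \<open>f\<close> also preserves each
  curve that \<open>\<gamma>\<close> maps into a line through \<open>q\<close>. These curves form a pencil, so they are lines through \<open>q\<close>,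
  and \<open>\<gamma>\<close> maps the pencil of lines through \<open>q\<close> to itself. This holds in particular for all \<open>\<gamma>\<close> that preserve
  the lines through \<open>q'\<close>; hence the lines through \<open>q\<close> are also the lines through \<open>q'\<close>.
\<close>

lemma fixers_not_commuting:
  assumes D: "irreducible_curve D" "\<And>v. v \<noteq> 0 \<Longrightarrow> abs_proj_plane v \<in> D \<Longrightarrow> E v = 0"
    and Q: "quadratic_along q e E E1 E2" "q \<noteq> 0" and Q': "quadratic_along q' e E E1' E2'" "q' \<noteq> 0"
    and qq': "\<not> parallel q q'"
  shows "\<exists>f\<in>fixers D. \<exists>\<gamma>\<in>fixers D. rat_comp f \<gamma> \<noteq> rat_comp \<gamma> f"
proof (rule ccontr)
  assume "\<not> ?thesis"
  then have comm: "rat_comp f \<gamma> = rat_comp \<gamma> f" if "f \<in> fixers D" "\<gamma> \<in> fixers D" for f \<gamma>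
    using that by blast
  obtain l m c where lm: "form 1 l" "form 1 m" "c \<noteq> 0" "l q = 0" "m q = 0"
    "\<And>v w. l v * m w - l w * m v = c * det3 q v w"
    "\<And>v. l v = 0 \<Longrightarrow> m v = 0 \<Longrightarrow> \<exists>\<beta>. v = \<beta> *s q" and m0: "\<exists>v. m v \<noteq> 0"
    using pencil_coordinates[OF Q(2)] by metis
  have lm_iff: "l v * m w = l w * m v \<longleftrightarrow> det3 q v w = 0" for v w
    using lm(3) lm(6)[of v w] by auto
  have image: "det3 q (eval_triple \<Gamma> v) (eval_triple \<Gamma> (v + t *s q)) = 0"
    if \<gamma>: "\<gamma> \<in> fixers D" and \<Gamma>: "homogeneous3 d \<Gamma>" "\<gamma> = triple_map \<Gamma>"
      "\<And>l k. form k l \<Longrightarrow> \<exists>v. l v \<noteq> 0 \<Longrightarrow> \<exists>v. l (eval_triple \<Gamma> v) \<noteq> 0" for \<gamma> d \<Gamma> v t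
  proof -
    have \<gamma>b: "birational \<gamma>" using \<gamma> by (rule fixers_birational)
    have scale: "eval_triple \<Gamma> (a *s x) = a ^ d *s eval_triple \<Gamma> x" for a x by (rule eval_triple_scale[OF \<Gamma>(1)])
    have on_line: "det3 q (eval_triple \<Gamma> x) (eval_triple \<Gamma> y) = 0"
      if f: "f \<in> pencil_fixers D q" and xy: "x \<noteq> 0" "y \<noteq> 0" "f (abs_proj_plane x) = Some (abs_proj_plane y)" for f x y
    proof -
      have fD: "f \<in> fixers D" and fb: "birational f" using f by (auto simp: pencil_fixers_def fixers_def)
      obtain k F where F: "homogeneous3 k F" "f = triple_map F" using birational_triple[OF fb] by metis
      define K where "K x = det3 q (eval_triple \<Gamma> x) (eval_triple \<Gamma> (eval_triple F x))" for x
      have pF: "poly_fun (\<lambda>v. eval_triple F v $ i)" "poly_fun (\<lambda>v. eval_triple \<Gamma> v $ i)" for i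
        using form_eval_triple[OF F(1)] form_eval_triple[OF \<Gamma>(1)] form_poly_fun by blast+
      have pFF: "poly_fun (\<lambda>v. eval_triple \<Gamma> (eval_triple F v) $ i)" for i
        by (rule poly_fun_compose[OF pF(2) pF(1)])
      have pK: "poly_fun K" unfolding K_def det3_def
        by (intro poly_fun_add poly_fun_diff poly_fun_mult poly_fun_const pF pFF)
      have gen: "generic (\<lambda>x. \<exists>y. \<gamma> x = Some y \<and> (\<exists>z. f y = Some z \<and> collinear_with q y z))"
        using f generic_pullback[OF \<gamma>b] by (simp add: pencil_fixers_def)
      have "K v = 0" for v
      proof (rule generic_imp_zero[OF generic_conj[OF gen generic_rat_comp[OF \<gamma>b fb]] pK])
        fix v :: "complex ^ 3" let ?p = "abs_proj_plane v"
        assume v: "v \<noteq> 0" and "(\<exists>y. \<gamma> ?p = Some y \<and> (\<exists>z. f y = Some z \<and> collinear_with q y z)) \<and>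
           (\<exists>q r. f ?p = Some q \<and> \<gamma> q = Some r \<and> rat_comp \<gamma> f ?p = Some r)"
        then obtain y z q' r where *: "\<gamma> ?p = Some y" "f y = Some z" "collinear_with q y z"
          "f ?p = Some q'" "\<gamma> q' = Some r" "rat_comp \<gamma> f ?p = Some r" by blast
        have "z = r" using rat_comp_Some[OF fb \<gamma>b *(1,2)] comm[OF fD \<gamma>] *(6) by simp
        have 1: "eval_triple \<Gamma> v \<noteq> 0" "y = abs_proj_plane (eval_triple \<Gamma> v)"
          using *(1) triple_map_abs[OF \<Gamma>(1) v] \<Gamma>(2) by (auto split: if_splits)
        have 2: "eval_triple F v \<noteq> 0" "q' = abs_proj_plane (eval_triple F v)"
          using *(4) triple_map_abs[OF F(1) v] F(2) by (auto split: if_splits)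
        have 3: "eval_triple \<Gamma> (eval_triple F v) \<noteq> 0" "r = abs_proj_plane (eval_triple \<Gamma> (eval_triple F v))"
          using *(5) triple_map_abs[OF \<Gamma>(1) 2(1)] \<Gamma>(2) 2(2) by (auto split: if_splits)
        show "K v = 0" using *(3) \<open>z = r\<close> 1 3 by (simp add: K_def collinear_with_abs)
      qed
      then have "det3 q (eval_triple \<Gamma> x) (eval_triple \<Gamma> (eval_triple F x)) = 0" by (simp add: K_def)
      moreover obtain a where "y = a *s eval_triple F x"
        using triple_map_value[OF F(1) xy(1,2)] xy(3) F(2) by metis
      ultimately show ?thesis by (simp add: scale)
    qed
    define g where "g x = l (eval_triple \<Gamma> x)" for x
    define h where "h x = m (eval_triple \<Gamma> x)" for x
    have gh: "form (1 * d) g" "form (1 * d) h"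
      unfolding g_def h_def by (rule form_compose[OF _ form_eval_triple[OF \<Gamma>(1)]], rule lm)+
    have h0: "\<exists>v. h v \<noteq> 0" unfolding h_def by (rule \<Gamma>(3)[OF lm(2) m0])
    have "g v * h (v + t *s q) = g (v + t *s q) * h v"
    proof (rule preserved_pencil_constant[OF D Q gh h0 gh(2) h0])
      fix f x y x' y'
      assume f: "f \<in> pencil_fixers D q" "x \<noteq> 0" "y \<noteq> 0" "x' \<noteq> 0" "y' \<noteq> 0"
        "f (abs_proj_plane x) = Some (abs_proj_plane x')" "f (abs_proj_plane y) = Some (abs_proj_plane y')"
        and nz: "h x \<noteq> 0" "h y \<noteq> 0" and eq: "g x * h y = g y * h x"
      have "g x * h x' = g x' * h x" "g y * h y' = g y' * h y"
        unfolding g_def h_def lm_iff using on_line f by blast+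
      then show "g x' * h y' = g y' * h x'" by (rule proportional_trans[OF nz eq])
    qed
    then show ?thesis unfolding g_def h_def lm_iff .
  qed
  have "l v * m (v + t *s q') = l (v + t *s q') * m v" for v t
  proof (rule preserved_pencil_constant[OF D Q' lm(1,2) m0 form_one[of 1]])
    fix \<gamma> x y x' y'
    assume \<gamma>: "\<gamma> \<in> pencil_fixers D q'" "x \<noteq> 0" "y \<noteq> 0" "x' \<noteq> 0" "y' \<noteq> 0"
        "\<gamma> (abs_proj_plane x) = Some (abs_proj_plane x')" "\<gamma> (abs_proj_plane y) = Some (abs_proj_plane y')"
        and nz: "m x \<noteq> 0" "m y \<noteq> 0" and eq: "l x * m y = l y * m x"
    have \<gamma>D: "\<gamma> \<in> fixers D" using \<gamma>(1) by (simp add: pencil_fixers_def)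
    obtain d \<Gamma> where \<Gamma>: "homogeneous3 d \<Gamma>" "\<gamma> = triple_map \<Gamma>"
      "\<And>l k. form k l \<Longrightarrow> \<exists>v. l v \<noteq> 0 \<Longrightarrow> \<exists>v. l (eval_triple \<Gamma> v) \<noteq> 0"
      using birational_triple[OF fixers_birational[OF \<gamma>D]] by metis
    define a where "a = m y / m x"
    have a: "a \<noteq> 0" using nz by (simp add: a_def)
    have "l (y + (- a) *s x) = 0" "m (y + (- a) *s x) = 0"
      unfolding form_1_add[OF lm(1)] form_1_add[OF lm(2)] form_scale[OF lm(1)] form_scale[OF lm(2)]
      using nz eq by (simp_all add: a_def field_simps)
    then obtain \<beta> where "y + (- a) *s x = \<beta> *s q" using lm(7) by blast
    then have "y = a *s x + \<beta> *s q" by (simp add: vec_eq_iff algebra_simps)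
    then have y: "y = a *s (x + (\<beta> / a) *s q)" using a by (simp add: vec_eq_iff field_simps)
    have "det3 q (eval_triple \<Gamma> x) (eval_triple \<Gamma> y) = 0"
      using image[OF \<gamma>D \<Gamma>] by (simp add: y eval_triple_scale[OF \<Gamma>(1)] del: vector_add_ldistrib)
    moreover obtain b where "x' = b *s eval_triple \<Gamma> x"
      using triple_map_value[OF \<Gamma>(1) \<gamma>(2,4)] \<gamma>(6) \<Gamma>(2) by metis
    moreover obtain b where "y' = b *s eval_triple \<Gamma> y"
      using triple_map_value[OF \<Gamma>(1) \<gamma>(3,5)] \<gamma>(7) \<Gamma>(2) by metis
    ultimately show "l x' * m y' = l y' * m x'" unfolding lm_iff by simp
  qed auto
  then have "det3 q v (v + 1 *s q') = 0" for v unfolding lm_iff .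
  then have "det3 q v q' = 0" for v by simp
  then show False using det3_nonzero(2)[OF qq'] by simp
qed

section \<open>Maps that fix a curve preserve no pencil of lines up to conjugation\<close>

lemma line_through:
  assumes "\<not> parallel a b"
  obtains L where "line L" "\<And>v. v \<noteq> 0 \<Longrightarrow> abs_proj_plane v \<in> L \<longleftrightarrow> det3 a b v = 0"
proof -
  obtain F where F: "(\<lambda>v. det3 a b v) = eval3 F" "homogeneous 1 F" using form_obtain_poly[OF form_det3(1)] .
  then have "F \<noteq> 0" using det3_nonzero(1)[OF assms] by auto
  then have "line {p. vanishes F p}" using F(2) unfolding line_def by blast
  moreover have "abs_proj_plane v \<in> {p. vanishes F p} \<longleftrightarrow> det3 a b v = 0" if "v \<noteq> 0" for v
    using vanishes_abs[OF F(2) that] fun_cong[OF F(1), of v] by simp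
  ultimately show ?thesis using that by blast
qed

lemma line_det3:
  assumes "line L" "u \<noteq> 0" "v \<noteq> 0" "w \<noteq> 0" "abs_proj_plane u \<in> L" "abs_proj_plane v \<in> L" "abs_proj_plane w \<in> L"
  shows "det3 u v w = 0"
proof -
  obtain F where F: "homogeneous 1 F" "F \<noteq> 0" "L = {p. vanishes F p}" using assms(1) unfolding line_def by blast
  obtain a b c where abc: "\<And>v. eval3 F v = a * v $ 1 + b * v $ 2 + c * v $ 3"
    using form_1_linear F(1) unfolding homogeneous_iff_form by metis
  have z: "eval3 F u = 0" "eval3 F v = 0" "eval3 F w = 0"
    using assms vanishes_abs[OF F(1)] F(3) by auto
  have "a * det3 u v w = eval3 F u * (v $ 2 * w $ 3 - v $ 3 * w $ 2) - eval3 F v * (u $ 2 * w $ 3 - u $ 3 * w $ 2)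
      + eval3 F w * (u $ 2 * v $ 3 - u $ 3 * v $ 2)"
    "b * det3 u v w = - eval3 F u * (v $ 1 * w $ 3 - v $ 3 * w $ 1) + eval3 F v * (u $ 1 * w $ 3 - u $ 3 * w $ 1)
      - eval3 F w * (u $ 1 * v $ 3 - u $ 3 * v $ 1)"
    "c * det3 u v w = eval3 F u * (v $ 1 * w $ 2 - v $ 2 * w $ 1) - eval3 F v * (u $ 1 * w $ 2 - u $ 2 * w $ 1)
      + eval3 F w * (u $ 1 * v $ 2 - u $ 2 * v $ 1)"
    unfolding abc det3_def by algebra+
  then have "a * det3 u v w = 0" "b * det3 u v w = 0" "c * det3 u v w = 0" by (simp_all add: z)
  moreover have "a \<noteq> 0 \<or> b \<noteq> 0 \<or> c \<noteq> 0" using eval3_nonzero[OF F(2)] by (auto simp: abc)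
  ultimately show ?thesis by auto
qed

text \<open>
  Two points on a line through \<open>p\<close> have images on a line through \<open>p\<close>: if the first line is contracted, then both
  images agree, and otherwise its strict transform is such a line.
\<close>

lemma Jon_collinear:
  assumes h: "h \<in> Jon (abs_proj_plane p)" and p: "p \<noteq> 0" and nz: "y \<noteq> 0" "z \<noteq> 0" "y' \<noteq> 0" "z' \<noteq> 0"
    and yz: "det3 p y z = 0" "\<not> parallel p y"
    and val: "h (abs_proj_plane y) = Some (abs_proj_plane y')" "h (abs_proj_plane z) = Some (abs_proj_plane z')"
  shows "det3 p y' z' = 0"
proof -
  obtain L where L: "line L" "\<And>v. v \<noteq> 0 \<Longrightarrow> abs_proj_plane v \<in> L \<longleftrightarrow> det3 p y v = 0"
    using line_through[OF yz(2)] by blast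
  have inL: "abs_proj_plane p \<in> L" "abs_proj_plane y \<in> L" "abs_proj_plane z \<in> L" using L(2) p nz yz by auto
  have ran: "abs_proj_plane y' \<in> ran (h |` L)" "abs_proj_plane z' \<in> ran (h |` L)"
    using val inL by (auto simp: ran_def restrict_map_def)
  show ?thesis
  proof (cases "contracts h L")
    case True
    then have "abs_proj_plane y' = abs_proj_plane z'" using ran by (auto simp: contracts_def)
    then obtain c where "z' = c *s y'" using abs_eq_iff nz by blast
    then show ?thesis by simp
  next
    case False
    then have "line (strict_transform h L)" "abs_proj_plane p \<in> strict_transform h L"
      using h L(1) inL(1) by (auto simp: Jon_def)
    moreover have "ran (h |` L) \<subseteq> strict_transform h L"
      unfolding strict_transform_def zariski_closure_def by (rule hull_subset)
    ultimately show ?thesis using line_det3 p nz ran by blast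
  qed
qed

text \<open>
  If all conjugates by \<open>\<theta>\<close> preserve the lines through \<open>p\<close>, then the maps that fix \<open>D\<close> preserve the pencil of
  curves that \<open>\<theta>\<close> maps into lines through \<open>p\<close>. Its fraction is constant on the lines through \<open>q\<close> and on
  those through \<open>q'\<close>, so it is constant, although \<open>\<theta>\<close> is dominant.
\<close>

lemma fixers_not_Jon:
  assumes D: "irreducible_curve D" "\<And>v. v \<noteq> 0 \<Longrightarrow> abs_proj_plane v \<in> D \<Longrightarrow> E v = 0"
    and Q: "quadratic_along q e E E1 E2" "q \<noteq> 0" and Q': "quadratic_along q' e E E1' E2'" "q' \<noteq> 0"
    and qq': "\<not> parallel q q'" and \<theta>: "birational \<theta>"
  shows "\<exists>f\<in>fixers D. \<theta> \<otimes>\<^bsub>Cremona\<^esub> f \<otimes>\<^bsub>Cremona\<^esub> inv\<^bsub>Cremona\<^esub> \<theta> \<notin> Jon p"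
proof (rule ccontr)
  interpret group Cremona by (rule group_Cremona)
  let ?\<theta>' = "inv\<^bsub>Cremona\<^esub> \<theta>"
  assume "\<not> ?thesis"
  then have Jon: "rat_comp (rat_comp \<theta> f) ?\<theta>' \<in> Jon p" if "f \<in> fixers D" for f using that by auto
  have \<theta>': "birational ?\<theta>'" using inv_closed[of \<theta>] \<theta> by simp
  obtain pv where p: "pv \<noteq> 0" "p = abs_proj_plane pv" using point_cases .
  obtain l m c where lm: "form 1 l" "form 1 m" "c \<noteq> 0" "l pv = 0" "m pv = 0"
    "\<And>v w. l v * m w - l w * m v = c * det3 pv v w"
    and m0: "\<exists>v. m v \<noteq> 0"
    using pencil_coordinates[OF p(1)] by metis
  have lm_iff: "l v * m w = l w * m v \<longleftrightarrow> det3 pv v w = 0" for v w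
    using lm(3) lm(6)[of v w] by auto
  have not_par: "\<not> parallel pv v" if "m v \<noteq> 0" for v
    by (rule linear_form_nonzero(2)[OF lm(2,5) that p(1)])
  obtain d \<Theta> where \<Theta>: "homogeneous3 d \<Theta>" "\<theta> = triple_map \<Theta>"
    "\<And>l k. form k l \<Longrightarrow> \<exists>v. l v \<noteq> 0 \<Longrightarrow> \<exists>v. l (eval_triple \<Theta> v) \<noteq> 0"
    using birational_triple[OF \<theta>] by metis
  define g where "g x = l (eval_triple \<Theta> x)" for x
  define h where "h x = m (eval_triple \<Theta> x)" for x
  have gh: "form (1 * d) g" "form (1 * d) h"
    unfolding g_def h_def by (rule form_compose[OF _ form_eval_triple[OF \<Theta>(1)]], rule lm)+
  have h0: "\<exists>v. h v \<noteq> 0" unfolding h_def by (rule \<Theta>(3)[OF lm(2) m0])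
  obtain k b where b: "form k b" "\<exists>v. b v \<noteq> 0"
    "\<And>v. v \<noteq> 0 \<Longrightarrow> b v \<noteq> 0 \<Longrightarrow> \<exists>q. \<theta> (abs_proj_plane v) = Some q \<and> ?\<theta>' q = Some (abs_proj_plane v)"
    using generic_inverse_inv[OF \<theta>] unfolding generic_inverse_def generic_def by blast
  have b': "eval_triple \<Theta> v \<noteq> 0 \<and> \<theta> (abs_proj_plane v) = Some (abs_proj_plane (eval_triple \<Theta> v)) \<and>
      ?\<theta>' (abs_proj_plane (eval_triple \<Theta> v)) = Some (abs_proj_plane v)" if "v \<noteq> 0" "b v \<noteq> 0" for v
    using b(3)[OF that] triple_map_abs[OF \<Theta>(1) that(1)] \<Theta>(2) by (auto split: if_splits)
  have pres: "g x' * h y' = g y' * h x'"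
    if f: "f \<in> fixers D" and nz: "x \<noteq> 0" "y \<noteq> 0" "x' \<noteq> 0" "y' \<noteq> 0"
      and val: "f (abs_proj_plane x) = Some (abs_proj_plane x')" "f (abs_proj_plane y) = Some (abs_proj_plane y')"
      and bnz: "b x \<noteq> 0" "b y \<noteq> 0" "b x' \<noteq> 0" "b y' \<noteq> 0" and hnz: "h x \<noteq> 0" and eq: "g x * h y = g y * h x"
    for f x y x' y'
  proof -
    have fb: "birational f" by (rule fixers_birational[OF f])
    have \<theta>f: "birational (rat_comp \<theta> f)" by (rule birational_rat_comp[OF \<theta> fb])
    have conj: "rat_comp (rat_comp \<theta> f) ?\<theta>' (abs_proj_plane (eval_triple \<Theta> v)) =
       Some (abs_proj_plane (eval_triple \<Theta> v'))"
      if "v \<noteq> 0" "v' \<noteq> 0" "b v \<noteq> 0" "b v' \<noteq> 0" "f (abs_proj_plane v) = Some (abs_proj_plane v')" for v v'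
      using rat_comp_Some[OF \<theta>f \<theta>'] rat_comp_Some[OF \<theta> fb] b' that by blast
    have "det3 pv (eval_triple \<Theta> x') (eval_triple \<Theta> y') = 0"
    proof (rule Jon_collinear[OF Jon[OF f, unfolded p(2)] p(1)])
      show "det3 pv (eval_triple \<Theta> x) (eval_triple \<Theta> y) = 0" using eq unfolding g_def h_def lm_iff .
      show "\<not> parallel pv (eval_triple \<Theta> x)" by (rule not_par) (use hnz in \<open>simp add: h_def\<close>)
    qed (use b' conj nz bnz val in auto)
    then show ?thesis unfolding g_def h_def lm_iff .
  qed
  have 1: "g v * h (v + t *s q) = g (v + t *s q) * h v" for v t
  proof (rule preserved_pencil_constant[OF D Q gh h0 b(1,2)])
    fix f x y x' y'
    assume "f \<in> pencil_fixers D q"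
    then have "f \<in> fixers D" by (simp add: pencil_fixers_def)
    then show "x \<noteq> 0 \<Longrightarrow> y \<noteq> 0 \<Longrightarrow> x' \<noteq> 0 \<Longrightarrow> y' \<noteq> 0 \<Longrightarrow> f (abs_proj_plane x) = Some (abs_proj_plane x') \<Longrightarrow>
        f (abs_proj_plane y) = Some (abs_proj_plane y') \<Longrightarrow> b x \<noteq> 0 \<Longrightarrow> b y \<noteq> 0 \<Longrightarrow> b x' \<noteq> 0 \<Longrightarrow>
        b y' \<noteq> 0 \<Longrightarrow> h x \<noteq> 0 \<Longrightarrow> h y \<noteq> 0 \<Longrightarrow> g x * h y = g y * h x \<Longrightarrow> g x' * h y' = g y' * h x'"
      by (rule pres)
  qed
  have 2: "g v * h (v + t *s q') = g (v + t *s q') * h v" for v t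
  proof (rule preserved_pencil_constant[OF D Q' gh h0 b(1,2)])
    fix f x y x' y'
    assume "f \<in> pencil_fixers D q'"
    then have "f \<in> fixers D" by (simp add: pencil_fixers_def)
    then show "x \<noteq> 0 \<Longrightarrow> y \<noteq> 0 \<Longrightarrow> x' \<noteq> 0 \<Longrightarrow> y' \<noteq> 0 \<Longrightarrow> f (abs_proj_plane x) = Some (abs_proj_plane x') \<Longrightarrow>
        f (abs_proj_plane y) = Some (abs_proj_plane y') \<Longrightarrow> b x \<noteq> 0 \<Longrightarrow> b y \<noteq> 0 \<Longrightarrow> b x' \<noteq> 0 \<Longrightarrow>
        b y' \<noteq> 0 \<Longrightarrow> h x \<noteq> 0 \<Longrightarrow> h y \<noteq> 0 \<Longrightarrow> g x * h y = g y * h x \<Longrightarrow> g x' * h y' = g y' * h x'"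
      by (rule pres)
  qed
  have const: "g v * h w = g w * h v" for v w by (rule two_constant_pencils[OF gh h0 qq' 1 2])
  obtain v where v: "h v \<noteq> 0" using h0 by blast
  then have "\<not> parallel pv (eval_triple \<Theta> v)" by (intro not_par) (simp add: h_def)
  then obtain w where "det3 pv (eval_triple \<Theta> v) (eval_triple \<Theta> w) \<noteq> 0"
    using \<Theta>(3)[OF form_det3(1)] det3_nonzero(1) by metis
  then show False using const[of v w] unfolding g_def h_def lm_iff by simp
qed

section \<open>Lines and smooth cubics\<close>

text \<open>
  For a line the double line serves as the quadratic curve, and the center is arbitrary.
\<close>

lemma quadratic_along_square:
  assumes l: "form 1 l" "\<exists>v. l v \<noteq> 0"
  shows "quadratic_along q 2 (\<lambda>v. (l v)\<^sup>2) (\<lambda>v. 2 * l q * l v) (\<lambda>v. (l q)\<^sup>2)"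
  unfolding quadratic_along_def
proof (intro conjI allI)
  show "form 2 (\<lambda>v. (l v)\<^sup>2)" using form_power[OF l(1), of 2] by simp
  show "\<exists>v. (l v)\<^sup>2 \<noteq> 0" using l(2) by simp
  show "poly_fun (\<lambda>v. 2 * l q * l v)" using form_poly_fun[OF l(1)] by (intro poly_fun_mult poly_fun_const)
  show "(l (a *s v + t *s q))\<^sup>2 = a ^ (2 - 2) * (a\<^sup>2 * (l v)\<^sup>2 + a * t * (2 * l q * l v) + t\<^sup>2 * (l q)\<^sup>2)" for a t v
    using l(1) by (simp add: form_1_add form_scale power2_eq_square algebra_simps)
qed simp

text \<open>
  The Taylor expansion of a cubic form, with the two middle coefficients written as differences of values so
  that they are visibly polynomial functions.
\<close>

definition cubic_expansion :: "complex ^ 3 \<Rightarrow> (complex ^ 3 \<Rightarrow> complex) \<Rightarrow> bool" where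
  "cubic_expansion q f \<longleftrightarrow> (\<forall>a t v. f (a *s v + t *s q) = a ^ 3 * f v
     + a\<^sup>2 * t * ((f (v + q) - f (v - q)) / 2 - f q) + a * t\<^sup>2 * ((f (v + q) + f (v - q)) / 2 - f v) + t ^ 3 * f q)"

lemma cubic_expansion_add:
  assumes "cubic_expansion q f" "cubic_expansion q g"
  shows "cubic_expansion q (\<lambda>v. f v + g v)"
  unfolding cubic_expansion_def
    assms[unfolded cubic_expansion_def, rule_format]
  by (simp add: field_simps)

lemma cubic_expansion_cmult:
  assumes "cubic_expansion q f"
  shows "cubic_expansion q (\<lambda>v. c * f v)"
  unfolding cubic_expansion_def assms[unfolded cubic_expansion_def, rule_format]
  by (simp add: field_simps)

lemma cubic_expansion_monomial: "cubic_expansion q (\<lambda>v. v $ i * v $ j * v $ k)"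
  unfolding cubic_expansion_def by (simp add: field_simps power2_eq_square power3_eq_cube)

lemma cubic_expansion_form:
  assumes "form 3 f"
  shows "cubic_expansion q f"
proof -
  obtain c1 c2 c3 c4 c5 c6 c7 c8 c9 c10 where c:
    "\<And>v. f v = c1 * v $ 1 ^ 3 + c2 * v $ 2 ^ 3 + c3 * v $ 3 ^ 3
      + c4 * (v $ 1 ^ 2 * v $ 2) + c5 * (v $ 1 ^ 2 * v $ 3) + c6 * (v $ 2 ^ 2 * v $ 1)
      + c7 * (v $ 2 ^ 2 * v $ 3) + c8 * (v $ 3 ^ 2 * v $ 1) + c9 * (v $ 3 ^ 2 * v $ 2)
      + c10 * (v $ 1 * v $ 2 * v $ 3)"
    using form_3_cubic[OF assms] by blast
  have "cubic_expansion q (\<lambda>v. c1 * v $ 1 ^ 3 + c2 * v $ 2 ^ 3 + c3 * v $ 3 ^ 3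
      + c4 * (v $ 1 ^ 2 * v $ 2) + c5 * (v $ 1 ^ 2 * v $ 3) + c6 * (v $ 2 ^ 2 * v $ 1)
      + c7 * (v $ 2 ^ 2 * v $ 3) + c8 * (v $ 3 ^ 2 * v $ 1) + c9 * (v $ 3 ^ 2 * v $ 2)
      + c10 * (v $ 1 * v $ 2 * v $ 3))"
    unfolding power2_eq_square power3_eq_cube
    by (intro cubic_expansion_add cubic_expansion_cmult cubic_expansion_monomial)
  then show ?thesis using c by (simp add: cubic_expansion_def)
qed

text \<open>
  A line through a point \<open>q\<close> of a cubic meets the cubic in two further points: the coefficient of \<open>t\<^sup>3\<close> in the
  expansion is the value at \<open>q\<close>.
\<close>

lemma quadratic_along_cubic:
  assumes f: "form 3 f" "\<exists>v. f v \<noteq> 0" "f q = 0"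
  shows "quadratic_along q 3 f (\<lambda>v. (f (v + q) - f (v - q)) / 2) (\<lambda>v. (f (v + q) + f (v - q)) / 2 - f v)"
  unfolding quadratic_along_def
proof (intro conjI allI)
  have "poly_fun (\<lambda>v. f (v + c *s q))" for c
    by (rule poly_fun_compose[OF form_poly_fun[OF f(1)]]) (auto intro!: poly_fun_add)
  from poly_fun_mult[OF poly_fun_diff[OF this[of 1] this[of "- 1"]] poly_fun_const[of "1 / 2"]]
  show "poly_fun (\<lambda>v. (f (v + q) - f (v - q)) / 2)" by (simp flip: diff_conv_add_uminus)
  show "f (a *s v + t *s q) = a ^ (3 - 2) * (a\<^sup>2 * f v + a * t * ((f (v + q) - f (v - q)) / 2)
     + t\<^sup>2 * ((f (v + q) + f (v - q)) / 2 - f v))" for a t v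
    using cubic_expansion_form[OF f(1), of q] f(3)
    by (simp add: cubic_expansion_def power2_eq_square power3_eq_cube algebra_simps)
qed (use f in auto)

lemma line_or_cubic_data:
  assumes "line D \<or> smooth_cubic D"
  obtains q q' e E E1 E2 E1' E2' where "irreducible_curve D"
    "\<And>v. v \<noteq> 0 \<Longrightarrow> abs_proj_plane v \<in> D \<Longrightarrow> E v = 0"
    "quadratic_along q e E E1 E2" "q \<noteq> 0" "quadratic_along q' e E E1' E2'" "q' \<noteq> 0" "\<not> parallel q q'"
  using assms
proof
  assume "line D"
  then obtain F where F: "homogeneous 1 F" "F \<noteq> 0" "D = {p. vanishes F p}" unfolding line_def by blast
  have l: "form 1 (eval3 F)" "\<exists>v. eval3 F v \<noteq> 0"
    using F(1) eval3_nonzero[OF F(2)] by (simp_all add: homogeneous_iff_form)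
  show ?thesis
  proof (rule that[OF line_irreducible_curve[OF \<open>line D\<close>] _
        quadratic_along_square[OF l] _ quadratic_along_square[OF l]])
    show "(eval3 F v)\<^sup>2 = 0" if "v \<noteq> 0" "abs_proj_plane v \<in> D" for v
      using that vanishes_abs[OF F(1) that(1)] F(3) by simp
    show "\<not> parallel e1 e2" by (auto simp: parallel_def axis_def intro!: exI[of _ 1] exI[of _ 2])
  qed (simp_all add: axis_eq_0_iff)
next
  assume cubic: "smooth_cubic D"
  have irr: "irreducible_curve D" by (rule smooth_cubic_irreducible_curve[OF cubic])
  obtain F where F: "homogeneous 3 F" "D = {p. vanishes F p}" "irreducible F"
    using cubic smooth_cubic_irreducible unfolding smooth_cubic_def by blast
  have f: "form 3 (eval3 F)" "\<exists>v. eval3 F v \<noteq> 0"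
    using F(1,3) eval3_nonzero by (auto simp: homogeneous_iff_form irreducible_def)
  have inf: "infinite D" by (rule irreducible_curve_infinite[OF irr])
  obtain x where x: "x \<in> D" using infinite_imp_nonempty[OF inf] by blast
  have "infinite (D - {x})" using inf by simp
  then have "D - {x} \<noteq> {}" by (rule infinite_imp_nonempty)
  then obtain y where y: "y \<in> D" "y \<noteq> x" by blast
  obtain q where q: "q \<noteq> 0" "x = abs_proj_plane q" using point_cases .
  obtain q' where q': "q' \<noteq> 0" "y = abs_proj_plane q'" using point_cases .
  have z: "eval3 F v = 0" if "v \<noteq> 0" "abs_proj_plane v \<in> D" for v
    using that vanishes_abs[OF F(1) that(1)] F(2) by simp
  have "\<not> parallel q q'" using parallel_iff[OF q(1) q'(1)] y q q' by auto
  then show ?thesis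
    using that[OF irr z quadratic_along_cubic[OF f z[OF q(1)]] q(1) quadratic_along_cubic[OF f z[OF q'(1)]] q'(1)]
      x y q q' by blast
qed

section \<open>Inertia groups of images of lines and smooth cubics\<close>

theorem proposition4p1:
  fixes C D :: "proj_plane set" and \<phi> :: "proj_plane \<rightharpoonup> proj_plane" and p :: proj_plane
  assumes "line D \<or> smooth_cubic D"
    and "\<phi> \<in> carrier Cremona"
    and "\<not> contracts \<phi> D"
    and "C = strict_transform \<phi> D"
  shows "infinite (inertia_group C)
    \<and> \<not> (\<forall>f\<in>inertia_group C. \<forall>g\<in>inertia_group C. f \<otimes>\<^bsub>Cremona\<^esub> g = g \<otimes>\<^bsub>Cremona\<^esub> f)
    \<and> \<not> (\<exists>\<psi>\<in>carrier Cremona.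
            (\<lambda>f. \<psi> \<otimes>\<^bsub>Cremona\<^esub> f \<otimes>\<^bsub>Cremona\<^esub> inv\<^bsub>Cremona\<^esub> \<psi>) ` inertia_group C \<subseteq> Jon p)"
proof -
  interpret group Cremona by (rule group_Cremona)
  obtain q q' e E E1 E2 E1' E2' where irr: "irreducible_curve D"
    and E: "\<And>v. v \<noteq> 0 \<Longrightarrow> abs_proj_plane v \<in> D \<Longrightarrow> E v = 0"
    and Q: "quadratic_along q e E E1 E2" "q \<noteq> 0" and Q': "quadratic_along q' e E E1' E2'" "q' \<noteq> 0"
    and qq': "\<not> parallel q q'"
    by (rule line_or_cubic_data[OF assms(1)]) blast
  define conj where "conj f = \<phi> \<otimes>\<^bsub>Cremona\<^esub> f \<otimes>\<^bsub>Cremona\<^esub> inv\<^bsub>Cremona\<^esub> \<phi>" for f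
  have conj_in: "conj f \<in> inertia_group C" if "f \<in> fixers D" for f
    unfolding conj_def assms(4)
    by (rule conjugate_in_inertia_group[OF irr _ assms(3) that]) (use assms(2) in simp)
  have carrier: "f \<in> carrier Cremona" if "f \<in> fixers D" for f using that fixers_birational by simp
  note closed = assms(2) inv_closed[OF assms(2)]
  have conj_eq: "f = inv\<^bsub>Cremona\<^esub> \<phi> \<otimes>\<^bsub>Cremona\<^esub> conj f \<otimes>\<^bsub>Cremona\<^esub> \<phi>" if "f \<in> carrier Cremona" for f
  proof -
    have "inv\<^bsub>Cremona\<^esub> \<phi> \<otimes>\<^bsub>Cremona\<^esub> conj f \<otimes>\<^bsub>Cremona\<^esub> \<phi> =
      (inv\<^bsub>Cremona\<^esub> \<phi> \<otimes>\<^bsub>Cremona\<^esub> \<phi>) \<otimes>\<^bsub>Cremona\<^esub> f \<otimes>\<^bsub>Cremona\<^esub> (inv\<^bsub>Cremona\<^esub> \<phi> \<otimes>\<^bsub>Cremona\<^esub> \<phi>)"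
      unfolding conj_def using that closed by (simp only: m_assoc m_closed)
    then show ?thesis using that closed by (simp only: l_inv l_one r_one)
  qed
  have conj_mult: "conj (f \<otimes>\<^bsub>Cremona\<^esub> g) = conj f \<otimes>\<^bsub>Cremona\<^esub> conj g"
    if "f \<in> carrier Cremona" "g \<in> carrier Cremona" for f g
  proof -
    have "conj f \<otimes>\<^bsub>Cremona\<^esub> conj g =
      \<phi> \<otimes>\<^bsub>Cremona\<^esub> (f \<otimes>\<^bsub>Cremona\<^esub> (inv\<^bsub>Cremona\<^esub> \<phi> \<otimes>\<^bsub>Cremona\<^esub> \<phi>) \<otimes>\<^bsub>Cremona\<^esub> g) \<otimes>\<^bsub>Cremona\<^esub> inv\<^bsub>Cremona\<^esub> \<phi>"
      unfolding conj_def using that closed by (simp only: m_assoc m_closed)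
    then show ?thesis using that closed by (simp only: conj_def l_inv r_one)
  qed
  have "inj_on conj (fixers D)"
    by (rule inj_onI) (metis carrier conj_eq)
  then have "infinite (conj ` fixers D)"
    using infinite_fixers[OF irr E Q] finite_imageD by blast
  moreover have "conj ` fixers D \<subseteq> inertia_group C" using conj_in by blast
  ultimately have 1: "infinite (inertia_group C)" using finite_subset by blast
  obtain f g where fg: "f \<in> fixers D" "g \<in> fixers D" "f \<otimes>\<^bsub>Cremona\<^esub> g \<noteq> g \<otimes>\<^bsub>Cremona\<^esub> f"
    using fixers_not_commuting[OF irr E Q Q' qq'] by auto
  have "conj f \<otimes>\<^bsub>Cremona\<^esub> conj g \<noteq> conj g \<otimes>\<^bsub>Cremona\<^esub> conj f"
    using fg conj_eq conj_mult carrier m_closed by metis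
  then have 2: "\<not> (\<forall>f\<in>inertia_group C. \<forall>g\<in>inertia_group C. f \<otimes>\<^bsub>Cremona\<^esub> g = g \<otimes>\<^bsub>Cremona\<^esub> f)"
    using conj_in fg by blast
  have 3: "\<not> (\<lambda>f. \<psi> \<otimes>\<^bsub>Cremona\<^esub> f \<otimes>\<^bsub>Cremona\<^esub> inv\<^bsub>Cremona\<^esub> \<psi>) ` inertia_group C \<subseteq> Jon p"
    if \<psi>: "\<psi> \<in> carrier Cremona" for \<psi>
  proof
    assume sub: "(\<lambda>f. \<psi> \<otimes>\<^bsub>Cremona\<^esub> f \<otimes>\<^bsub>Cremona\<^esub> inv\<^bsub>Cremona\<^esub> \<psi>) ` inertia_group C \<subseteq> Jon p"
    define \<theta> where "\<theta> = \<psi> \<otimes>\<^bsub>Cremona\<^esub> \<phi>"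
    have "birational \<theta>" using m_closed[OF \<psi> assms(2)] by (simp add: \<theta>_def)
    then obtain f where f: "f \<in> fixers D" "\<theta> \<otimes>\<^bsub>Cremona\<^esub> f \<otimes>\<^bsub>Cremona\<^esub> inv\<^bsub>Cremona\<^esub> \<theta> \<notin> Jon p"
      using fixers_not_Jon[OF irr E Q Q' qq'] by blast
    have "\<theta> \<otimes>\<^bsub>Cremona\<^esub> f \<otimes>\<^bsub>Cremona\<^esub> inv\<^bsub>Cremona\<^esub> \<theta> = \<psi> \<otimes>\<^bsub>Cremona\<^esub> conj f \<otimes>\<^bsub>Cremona\<^esub> inv\<^bsub>Cremona\<^esub> \<psi>"
      unfolding \<theta>_def conj_def using carrier[OF f(1)] closed \<psi> inv_closed[OF \<psi>]
      by (simp only: inv_mult_group m_assoc m_closed)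
    then show False using f sub conj_in by auto
  qed
  show ?thesis using 1 2 3 by blast
qed

end
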